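(* Let $\mathbb U=\mathbb U^\pi_{S,\mathcal D}$ be an $\mathrm{SL}(2,q)$-$\pi$-unital. (a) If $\pi=\flat$ and $q\ge 3$, then: (i) if $p=2$, every non-trivial translation of $\mathbb U$ is given by left multiplication $g\mapsto xg$ with an involution $x\in N_{\mathrm{SL}(2,q)}(S)$, and for each Sylow $2$-subgroup $P$ of $\mathrm{SL}(2,q)$, $N_{\mathrm{SL}(2,q)}(S)$ contains exactly one non-trivial element of $P$; (ii) if $q$ is odd, $\mathbb U$ admits no non-trivial translation. (b) If $\pi\in\{\pi_{\mathsf{odd}},\pi_{\mathsf{sq}},\pi_{\mathsf{sq}}^{-1}\}$ (with $q$ odd for $\pi_{\mathsf{odd}}$, and $q$ a square for $\pi_{\mathsf{sq}},\pi_{\mathsf{sq}}^{-1}$), then $\mathbb U$ admits no non-trivial translation with center on $[\infty]$.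
   Context: $p$ prime, $q$ a power of $p$, $\mathfrak P$ the Sylow $p$-subgroups of $\mathrm{SL}(2,q)$. Let $S\le\mathrm{SL}(2,q)$ with $|S|=q+1$ and $\mathcal D$ a collection of $(q+1)$-subsets of $\mathrm{SL}(2,q)$ containing $\mathbb 1$ such that (Q) each $D^*=\{xy^{-1}: x,y\in D,x\ne y\}$ has $q(q+1)$ elements, and (P) $S\smallsetminus\{\mathbb 1\}$, the sets $P\smallsetminus\{\mathbb 1\}$ ($P\in\mathfrak P$) and the $D^*$ partition $\mathrm{SL}(2,q)\smallsetminus\{\mathbb 1\}$. The affine unital $\mathbb U_{S,\mathcal D}$ has points $\mathrm{SL}(2,q)$ and blocks $Sg$, $Pg$, $Dg$ ($g\in\mathrm{SL}(2,q)$, $P\in\mathfrak P$, $D\in\mathcal D$) with containment; its short blocks form $\mathfrak S=\{Pg\}$. A parallelism on $\mathfrak S$ is a partition into $q+1$ classes of $q^2-1$ pairwise disjoint cosets. For such $\pi$, the closure $\mathbb U^\pi_{S,\mathcal D}$ adds one new point per class of $\pi$, incident with all blocks of that class, and one new block $[\infty]$ through these $q+1$ points. Parallelisms: $\flat=\{\{Pg: g\}: P\in\mathfrak P\}$; with $T$ the upper unitriangular matrices, for $q$ odd $\Omega=\{g:\text{lower-left entry of } g\text{ is a square (incl. }0)\}$, $A=\{Tg: g\in\Omega\}\cup\{gT: g\notin\Omega\}$, $\pi_{\mathsf{odd}}=\{\{h^{-1}Xh: X\in A\}: h\in\mathrm{SL}(2,q)\}$; for $q=r^2$, $\overline y=y^r$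 entrywise, $\Omega=\{g:\text{lower-left entry in }\mathbb F_r\}$, $A$ as before, $\vartheta_h(x)=h^{-1}x\overline h$, $\pi_{\mathsf{sq}}=\{\{\vartheta_h(X): X\in A\}: h\}$, $\pi_{\mathsf{sq}}^{-1}=\{\{X^{-1}: X\in B\}: B\in\pi_{\mathsf{sq}}\}$. A translation with center $c$ is an automorphism fixing $c$ and every block through $c$. *)

theory Defs
  imports
    "HOL-Analysis.Analysis"
    "HOL-Algebra.Algebra"
    "HOL-Algebra.Algebraic_Closure_Type"
begin

section \<open>The group \<open>SL(2,q)\<close>\<close>

text \<open>The field with \<open>q\<close> elements is a finite field type \<open>'a\<close> with \<open>CARD('a) = q\<close>.\<close>

type_synonym 'a mat2 = "'a^2^2"

definition SL2 :: "('a::field) mat2 monoid" where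
  "SL2 = \<lparr>carrier = {A. det A = 1}, monoid.mult = (**), one = mat 1\<rparr>"

lemma group_SL2: "group (SL2 :: ('a::field) mat2 monoid)"
proof (rule groupI)
  fix A :: "'a mat2"
  assume "A \<in> carrier SL2"
  then have A: "det A = 1" by (simp add: SL2_def)
  then obtain B where "B ** A = mat 1"
    using invertible_det_nz[of A] invertible_def[of A] by auto
  moreover from this have "det B = 1"
    using A det_mul[of B A] by simp
  ultimately show "\<exists>B\<in>carrier SL2. B \<otimes>\<^bsub>SL2\<^esub> A = \<one>\<^bsub>SL2\<^esub>"
    by (auto simp: SL2_def)
qed (simp_all add: SL2_def det_mul matrix_mul_assoc)

definition sylow_subgroups :: "nat \<Rightarrow> ('g, 'm) monoid_scheme \<Rightarrow> 'g set set" where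
  "sylow_subgroups p G = {P. subgroup P G \<and> card P = p ^ multiplicity p (Coset.order G)}"


section \<open>Affine \<open>SL(2,q)\<close>-unitals\<close>

definition quotient_set :: "('a::field) mat2 set \<Rightarrow> 'a mat2 set" where
  "quotient_set D = {x \<otimes>\<^bsub>SL2\<^esub> inv\<^bsub>SL2\<^esub> y | x y. x \<in> D \<and> y \<in> D \<and> x \<noteq> y}"

text \<open>
  In the partition condition, the sets \<open>D\<^sup>*\<close> form a family indexed by \<open>D\<close>, so distinct \<open>D\<close> have
  disjoint \<open>D\<^sup>*\<close>; this is why injectivity of \<^const>\<open>quotient_set\<close> is required. The other
  members of the partition are automatically distinct, having cardinalities \<open>q\<close>, \<open>q - 1\<close>
  and \<open>q * (q + 1)\<close>.
\<close>

definition affine_unital_data ::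
  "nat \<Rightarrow> ('a::{field,finite}) mat2 set \<Rightarrow> 'a mat2 set set \<Rightarrow> bool" where
  "affine_unital_data p S \<D> \<longleftrightarrow>
     subgroup S SL2 \<and> card S = CARD('a) + 1 \<and>
     (\<forall>D\<in>\<D>. D \<subseteq> carrier SL2 \<and> card D = CARD('a) + 1 \<and> \<one>\<^bsub>SL2\<^esub> \<in> D) \<and>
     (\<forall>D\<in>\<D>. card (quotient_set D) = CARD('a) * (CARD('a) + 1)) \<and>
     inj_on quotient_set \<D> \<and>
     partition_on (carrier SL2 - {\<one>\<^bsub>SL2\<^esub>})
       ({S - {\<one>\<^bsub>SL2\<^esub>}} \<union> {P - {\<one>\<^bsub>SL2\<^esub>} | P. P \<in> sylow_subgroups p SL2} \<union> quotient_set ` \<D>)"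

definition short_blocks :: "nat \<Rightarrow> ('a::field) mat2 set set" where
  "short_blocks p =
     {P #>\<^bsub>SL2\<^esub> g | P g. P \<in> sylow_subgroups p SL2 \<and> g \<in> carrier SL2}"

definition long_blocks :: "('a::field) mat2 set \<Rightarrow> 'a mat2 set set \<Rightarrow> 'a mat2 set set" where
  "long_blocks S \<D> =
     {S #>\<^bsub>SL2\<^esub> g | g. g \<in> carrier SL2} \<union> {D #>\<^bsub>SL2\<^esub> g | D g. D \<in> \<D> \<and> g \<in> carrier SL2}"


section \<open>Parallelisms and closures\<close>

definition parallelism :: "nat \<Rightarrow> ('a::{field,finite}) mat2 set set set \<Rightarrow> bool" where
  "parallelism p \<pi> \<longleftrightarrow>
     partition_on (short_blocks p) \<pi> \<and> card \<pi> = CARD('a) + 1 \<and>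
     (\<forall>C\<in>\<pi>. card C = CARD('a)\<^sup>2 - 1 \<and> disjoint C)"

text \<open>The point at infinity belonging to a parallel class \<open>C\<close> is \<open>Inf_pt C\<close>.\<close>

datatype 'a upoint = Aff "'a mat2" | Inf_pt "'a mat2 set set"

definition infinity_block :: "('a::field) mat2 set set set \<Rightarrow> 'a upoint set" where
  "infinity_block \<pi> = Inf_pt ` \<pi>"

definition unital_points :: "('a::field) mat2 set set set \<Rightarrow> 'a upoint set" where
  "unital_points \<pi> = Aff ` carrier SL2 \<union> infinity_block \<pi>"

definition unital_blocks ::
  "('a::field) mat2 set \<Rightarrow> 'a mat2 set set \<Rightarrow> 'a mat2 set set set \<Rightarrow> 'a upoint set set" where
  "unital_blocks S \<D> \<pi> =
     {Aff ` B | B. B \<in> long_blocks S \<D>} \<union>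
     {insert (Inf_pt C) (Aff ` Y) | C Y. C \<in> \<pi> \<and> Y \<in> C} \<union>
     {infinity_block \<pi>}"

definition SL2_unital ::
  "nat \<Rightarrow> ('a::{field,finite}) mat2 set \<Rightarrow> 'a mat2 set set \<Rightarrow> 'a mat2 set set set \<Rightarrow> bool" where
  "SL2_unital p S \<D> \<pi> \<longleftrightarrow> affine_unital_data p S \<D> \<and> parallelism p \<pi>"


section \<open>The parallelisms under consideration\<close>

definition par_flat :: "nat \<Rightarrow> ('a::field) mat2 set set set" where
  "par_flat p = {{P #>\<^bsub>SL2\<^esub> g | g. g \<in> carrier SL2} | P. P \<in> sylow_subgroups p SL2}"

definition unitriangular :: "('a::field) mat2 set" where
  "unitriangular = {A. A $ 1 $ 1 = 1 \<and> A $ 2 $ 2 = 1 \<and> A $ 2 $ 1 = 0}"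

definition base_class :: "('a::field) mat2 set \<Rightarrow> 'a mat2 set set" where
  "base_class \<Omega> =
     {unitriangular #>\<^bsub>SL2\<^esub> g | g. g \<in> carrier SL2 \<and> g \<in> \<Omega>} \<union>
     {g <#\<^bsub>SL2\<^esub> unitriangular | g. g \<in> carrier SL2 \<and> g \<notin> \<Omega>}"

definition Omega_odd :: "('a::field) mat2 set" where
  "Omega_odd = {g \<in> carrier SL2. \<exists>y. g $ 2 $ 1 = y\<^sup>2}"

definition par_odd :: "('a::field) mat2 set set set" where
  "par_odd =
     {{inv\<^bsub>SL2\<^esub> h <#\<^bsub>SL2\<^esub> Y #>\<^bsub>SL2\<^esub> h | Y. Y \<in> base_class Omega_odd} | h. h \<in> carrier SL2}"

text \<open>A field of order \<open>r\<^sup>2\<close> has exactly one subfield of order \<open>r\<close>.\<close>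

definition Omega_sq :: "nat \<Rightarrow> ('a::field) mat2 set" where
  "Omega_sq r =
     {g \<in> carrier SL2. \<exists>K. subfield K ring_of_type_algebra \<and> card K = r \<and> g $ 2 $ 1 \<in> K}"

definition frob :: "nat \<Rightarrow> ('a::field) mat2 \<Rightarrow> 'a mat2" where
  "frob r A = (\<chi> i j. (A $ i $ j) ^ r)"

definition twisted_conj :: "nat \<Rightarrow> ('a::field) mat2 \<Rightarrow> 'a mat2 \<Rightarrow> 'a mat2" where
  "twisted_conj r h x = inv\<^bsub>SL2\<^esub> h \<otimes>\<^bsub>SL2\<^esub> x \<otimes>\<^bsub>SL2\<^esub> frob r h"

definition par_sq :: "nat \<Rightarrow> ('a::field) mat2 set set set" where
  "par_sq r =
     {{twisted_conj r h ` Y | Y. Y \<in> base_class (Omega_sq r)} | h. h \<in> carrier SL2}"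

definition par_sq_inv :: "nat \<Rightarrow> ('a::field) mat2 set set set" where
  "par_sq_inv r = {{set_inv\<^bsub>SL2\<^esub> Y | Y. Y \<in> B} | B. B \<in> par_sq r}"


section \<open>Translations\<close>

text \<open>An incidence structure is given by its points and its blocks, the latter as sets of points.
  Automorphisms are only constrained on the points.\<close>

definition automorphism :: "'p set \<Rightarrow> 'p set set \<Rightarrow> ('p \<Rightarrow> 'p) \<Rightarrow> bool" where
  "automorphism Pts Blks f \<longleftrightarrow> bij_betw f Pts Pts \<and> (\<lambda>B. f ` B) ` Blks = Blks"

definition translation :: "'p set \<Rightarrow> 'p set set \<Rightarrow> 'p \<Rightarrow> ('p \<Rightarrow> 'p) \<Rightarrow> bool" where
  "translation Pts Blks c f \<longleftrightarrow>
     c \<in> Pts \<and> automorphism Pts Blks f \<and> f c = c \<and> (\<forall>B\<in>Blks. c \<in> B \<longrightarrow> f ` B = B)"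

definition nontrivial_on :: "'p set \<Rightarrow> ('p \<Rightarrow> 'p) \<Rightarrow> bool" where
  "nontrivial_on Pts f \<longleftrightarrow> (\<exists>x\<in>Pts. f x \<noteq> x)"

text \<open>The permutation induced on the points of the closure by left multiplication with \<open>x\<close>:
  a class of short blocks is mapped to the class of their images.\<close>

definition acts_as_left_mult ::
  "('a::field) mat2 set set set \<Rightarrow> 'a mat2 \<Rightarrow> ('a upoint \<Rightarrow> 'a upoint) \<Rightarrow> bool" where
  "acts_as_left_mult \<pi> x f \<longleftrightarrow>
     (\<forall>g\<in>carrier SL2. f (Aff g) = Aff (x \<otimes>\<^bsub>SL2\<^esub> g)) \<and>
     (\<forall>C\<in>\<pi>. f (Inf_pt C) = Inf_pt ((\<lambda>Y. x <#\<^bsub>SL2\<^esub> Y) ` C))"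

definition involution :: "('g, 'm) monoid_scheme \<Rightarrow> 'g \<Rightarrow> bool" where
  "involution G x \<longleftrightarrow> x \<in> carrier G \<and> x \<noteq> \<one>\<^bsub>G\<^esub> \<and> x \<otimes>\<^bsub>G\<^esub> x = \<one>\<^bsub>G\<^esub>"

end

theory Submission
  imports Defs
begin

no_notation fps_nth (infixl \<open>$\<close> 75)

text \<open>The Sylow \<open>p\<close>-subgroups are the stabilizers of non-zero row vectors, and the short blocks are the sets
  of all \<open>g\<close> with \<open>v g = z\<close>.

  A translation with center on \<open>[\<infinity>]\<close> fixes every block of its class. For \<open>\<pi>\<^sub>o\<^sub>d\<^sub>d\<close> and the two
  parallelisms for square order this preserves the lower left entry and one row or column of every matrix, and
  blocks transversal to the class then force the identity. For the flat parallelism it only forces left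
  multiplication by some \<open>x\<close> in the Sylow subgroup, which must normalize \<open>S\<close>. For odd \<open>q\<close> a fixed point count
  in \<open>S\<close> excludes this. For even \<open>q\<close>, such an \<open>x\<close> inverts \<open>S\<close>, a count of centralizers shows that \<open>S\<close> is
  abelian, and an explicit involution inverting one element then normalizes all of \<open>S\<close>.

  A non-trivial translation of a finite unital fixes no point besides its center. Hence a translation with
  affine center moves points of \<open>[\<infinity>]\<close> to affine points, and conjugation transports translations between
  these centers. For odd \<open>q\<close> this contradicts the above. For even \<open>q\<close> every point is the center of exactly one
  non-trivial translation, and the interplay of these translations with right multiplications makes every
  involution of a Sylow subgroup normalize \<open>S\<close>, against uniqueness.\<close>

text \<open>The obstacle is an affine center in characteristic 2, since no formula describes such a
  translation. The way around it is that automorphisms become transitive on the points, so that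
  uniqueness at infinity transfers to every center and \<open>ctr\<close> commutes with all
  automorphisms. The structure at infinity is dihedral: the involutions normalizing
  \<open>S\<close>, one in each Sylow subgroup, invert \<open>S\<close>, any two of them have their
  product in \<open>S\<close>, and for two given Sylow subgroups exactly one of them conjugates the
  first to the second. The bound q >= 3 gives every Sylow subgroup an involution \<open>u\<close>
  beyond the normalizing one, and right multiplication by \<open>u\<close> is the automorphism
  against which this structure is tested. The images of [\<infinity>] turn out to be pairwise
  disjoint, which leaves only cosets of \<open>S\<close> besides [\<infinity>] itself. The
  centralizer count rests on commuting being transitive among non-trivial elements of
  \<open>S\<close>: a matrix commuting with a non-scalar one is a linear polynomial in it.\<close>

subsection \<open>Translations of finite unitals\<close>

text \<open>Orbit sizes divide a power of p, so an orbit that is not a single fixed point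
  contributes a multiple of p. The action is a plain function whose behaviour matters on
  \<open>E\<close> only; \<open>restrict\<close> makes it extensional, as \<open>Bij E\<close>
  demands.\<close>

lemma card_fixed_points_p_group:
  fixes G (structure)
  assumes "group G" and p: "Factorial_Ring.prime (p::nat)" and cG: "card (carrier G) = p ^ k"
    and E: "finite E"
    and cl: "\<And>g x. g \<in> carrier G \<Longrightarrow> x \<in> E \<Longrightarrow> f g x \<in> E"
    and one: "\<And>x. x \<in> E \<Longrightarrow> f \<one> x = x"
    and mult: "\<And>g h x. g \<in> carrier G \<Longrightarrow> h \<in> carrier G \<Longrightarrow> x \<in> E \<Longrightarrow> f (g \<otimes> h) x = f g (f h x)"
  shows "card E mod p = card {x\<in>E. \<forall>g\<in>carrier G. f g x = x} mod p"
proof -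
  interpret G: group G by fact
  define \<phi> where "\<phi> g = restrict (f g) E" for g
  have bij: "\<phi> g \<in> Bij E" if g: "g \<in> carrier G" for g
  proof -
    have "bij_betw (f g) E E"
      by (rule bij_betw_byWitness[of _ "f (inv g)"])
        (use g mult[of g "inv g"] mult[of "inv g" g] one cl in auto)
    then show ?thesis by (simp add: Bij_def \<phi>_def)
  qed
  interpret A: group_action G E \<phi>
  proof (intro group_action.intro group_hom.intro group_hom_axioms.intro)
    show "group G" by fact
    show "group (BijGroup E)" by (rule group_BijGroup)
    show "\<phi> \<in> hom G (BijGroup E)"
    proof (rule homI)
      fix g h assume gh: "g \<in> carrier G" "h \<in> carrier G"
      have "\<phi> (g \<otimes> h) = compose E (\<phi> g) (\<phi> h)"
        using gh by (auto simp: \<phi>_def compose_def mult cl)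
      then show "\<phi> (g \<otimes> h) = \<phi> g \<otimes>\<^bsub>BijGroup E\<^esub> \<phi> h"
        using gh bij by (simp add: BijGroup_def)
    qed (simp add: bij BijGroup_def)
  qed
  let ?F = "{x\<in>E. \<forall>g\<in>carrier G. f g x = x}"
  have orb_sub: "orb \<subseteq> E" if "orb \<in> orbits G E \<phi>" for orb
    using that by (auto simp: orbits_def orbit_def \<phi>_def cl)
  have sum: "(\<Sum>orb\<in>orbits G E \<phi>. \<Sum>x\<in>orb. g x) = (\<Sum>x\<in>E. g x)" for g :: "_ \<Rightarrow> nat"
    by (rule A.disjoint_sum[OF E])
  have "card E mod p = (\<Sum>orb\<in>orbits G E \<phi>. card orb) mod p"
    using sum[of "\<lambda>_. 1"] by simp
  also have "\<dots> = (\<Sum>orb\<in>orbits G E \<phi>. card (orb \<inter> ?F)) mod p"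
  proof -
    have "card orb mod p = card (orb \<inter> ?F) mod p" if orb: "orb \<in> orbits G E \<phi>" for orb
    proof -
      obtain x where x: "x \<in> E" "orb = orbit G \<phi> x" using orb by (auto simp: orbits_def)
      have xo: "x \<in> orb" using A.orbit_refl x by auto
      have fin: "finite orb" using orb_sub[OF orb] E finite_subset by auto
      have "card orb dvd p ^ k"
        using A.orbit_stabilizer_theorem[OF x(1)] x cG by (metis Coset.order_def dvd_triv_left)
      then obtain i where i: "card orb = p ^ i" using p divides_primepow_nat by blast
      show ?thesis
      proof (cases "i = 0")
        case True
        then obtain z where "orb = {z}" using i card_1_singletonE by auto
        then have z: "orb = {x}" using xo by simp
        have "f g x = x" if "g \<in> carrier G" for g
        proof -
          have "\<phi> g x \<in> orb" using that x by (auto simp: orbit_def)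
          then show ?thesis using z x by (simp add: \<phi>_def)
        qed
        then have "orb \<inter> ?F = orb" using z x by auto
        then show ?thesis by simp
      next
        case False
        have "orb \<inter> ?F = {}"
        proof (rule ccontr)
          assume "orb \<inter> ?F \<noteq> {}"
          then obtain y where y: "y \<in> orb" "y \<in> ?F" by auto
          have "x \<in> orbit G \<phi> y" using A.orbit_sym[of x y] x y by auto
          then have "x = y" using y by (auto simp: orbit_def \<phi>_def)
          then have "orb \<subseteq> {x}" using x y by (auto simp: orbit_def \<phi>_def)
          then have "card orb \<le> 1" using card_mono[of "{x}" orb] by simp
          then show False using i False p
            by (metis One_nat_def not_less one_less_power prime_gt_1_nat bot_nat_0.not_eq_extremum)
        qed
        then show ?thesis using i False by simp
      qed
    qed
    then show ?thesis by (metis (mono_tags, lifting) mod_sum_eq sum.cong)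
  qed
  also have "(\<Sum>orb\<in>orbits G E \<phi>. card (orb \<inter> ?F)) = (\<Sum>orb\<in>orbits G E \<phi>. \<Sum>x\<in>orb. if x \<in> ?F then 1 else 0)"
    by (rule sum.cong[OF refl], subst sum.If_cases)
      (use finite_subset[OF orb_sub E] in \<open>auto simp: Int_def intro!: arg_cong[of _ _ card]\<close>)
  also have "\<dots> = (\<Sum>x\<in>E. if x \<in> ?F then 1 else 0)" by (rule sum)
  also have "\<dots> = card ?F"
    by (subst sum.If_cases) (use E in \<open>auto simp: Int_def intro!: arg_cong[of _ _ card]\<close>)
  finally show ?thesis .
qed

text \<open>The group of order p acts through the powers of \<open>f\<close>. With p = 2 this yields
  parity arguments; with \<open>f\<close> the addition of 1 it reads off the characteristic of a
  field.\<close>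

lemma card_fixed_points_prime_order:
  assumes p: "Factorial_Ring.prime (p::nat)" and E: "finite E"
    and cl: "\<And>x. x \<in> E \<Longrightarrow> f x \<in> E" and id: "\<And>x. x \<in> E \<Longrightarrow> (f ^^ p) x = x"
  shows "card E mod p = card {x\<in>E. f x = x} mod p"
proof -
  let ?G = "integer_mod_group p"
  have p0: "p > 0" "p > 1" using p prime_gt_1_nat prime_gt_0_nat by auto
  have car: "carrier ?G = {0..<int p}" using p0 by (simp add: carrier_integer_mod_group)
  have cl': "(f ^^ n) x \<in> E" if "x \<in> E" for n x using that by (induction n) (auto simp: cl)
  have period: "(f ^^ (p * m + n)) x = (f ^^ n) x" if "x \<in> E" for m n x
  proof (induction m)
    case (Suc m)
    have "(f ^^ (p * Suc m + n)) x = (f ^^ (p * m + n)) ((f ^^ p) x)"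
      by (metis (no_types, lifting) add.commute add.left_commute comp_apply funpow_add mult_Suc_right)
    then show ?case using id that Suc by simp
  qed simp
  have "card E mod p = card {x\<in>E. \<forall>g\<in>carrier ?G. (f ^^ nat g) x = x} mod p"
  proof (rule card_fixed_points_p_group[OF group_integer_mod_group p _ E, where k = 1])
    show "card (carrier ?G) = p ^ 1" using car by simp
    fix g h :: int and x assume gh: "g \<in> carrier ?G" "h \<in> carrier ?G" "x \<in> E"
    have "nat ((g + h) mod int p) = (nat g + nat h) mod p" using gh car
      by (auto simp: nat_mod_distrib nat_add_distrib)
    then have "(f ^^ nat (g \<otimes>\<^bsub>?G\<^esub> h)) x = (f ^^ ((nat g + nat h) mod p)) x" by simp
    also have "\<dots> = (f ^^ (nat g + nat h)) x"
      using period[OF gh(3), of "(nat g + nat h) div p" "(nat g + nat h) mod p"] by simp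
    finally show "(f ^^ nat (g \<otimes>\<^bsub>?G\<^esub> h)) x = (f ^^ nat g) ((f ^^ nat h) x)" by (simp add: funpow_add)
  qed (auto simp: cl')
  also have "{x\<in>E. \<forall>g\<in>carrier ?G. (f ^^ nat g) x = x} = {x\<in>E. f x = x}"
  proof -
    have "(f ^^ n) x = x" if "f x = x" for n x using that by (induction n) auto
    moreover have "1 \<in> carrier ?G" using car p0 by simp
    ultimately show ?thesis by (auto dest: bspec[of _ _ 1])
  qed
  finally show ?thesis .
qed

section \<open>Automorphisms of incidence structures and conjugation of translations\<close>

lemma automorphism_comp:
  assumes "automorphism P Bl f" and "automorphism P Bl g"
  shows "automorphism P Bl (f \<circ> g)"
proof -
  have "(\<lambda>B. (f \<circ> g) ` B) ` Bl = (\<lambda>B. f ` B) ` ((\<lambda>B. g ` B) ` Bl)"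
    by (simp add: image_image image_comp[symmetric])
  then show ?thesis using assms by (auto simp: automorphism_def intro: bij_betw_trans)
qed

lemma automorphism_inv_into:
  assumes f: "automorphism P Bl f" and sub: "\<And>B. B \<in> Bl \<Longrightarrow> B \<subseteq> P"
  shows "automorphism P Bl (inv_into P f)"
proof -
  have bij: "bij_betw f P P" and Bl: "(\<lambda>B. f ` B) ` Bl = Bl" using f by (auto simp: automorphism_def)
  have inv: "inv_into P f ` f ` B = B" if "B \<in> Bl" for B
    using inv_into_image_cancel[OF _ sub[OF that]] bij by (metis bij_betw_def)
  have "(\<lambda>B. inv_into P f ` B) ` Bl = (\<lambda>B. inv_into P f ` B) ` ((\<lambda>B. f ` B) ` Bl)" by (simp only: Bl)
  also have "\<dots> = Bl" using inv by (simp add: image_image)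
  finally show ?thesis using bij_betw_inv_into[OF bij] by (simp add: automorphism_def)
qed

text \<open>The inverse is \<open>inv_into P g\<close> because an automorphism need not be injective
  outside the points.\<close>

lemma translation_conjugate:
  assumes f: "translation P Bl c f" and g: "automorphism P Bl g" and sub: "\<And>B. B \<in> Bl \<Longrightarrow> B \<subseteq> P"
  shows "translation P Bl (g c) (g \<circ> f \<circ> inv_into P g)"
proof -
  let ?h = "inv_into P g"
  have bij: "bij_betw g P P" using g by (simp add: automorphism_def)
  have c: "c \<in> P" "f c = c" using f by (auto simp: translation_def)
  have hg: "?h (g x) = x" if "x \<in> P" for x using bij that by (simp add: bij_betw_def)
  have gh: "g (?h x) = x" if "x \<in> P" for x using bij that by (simp add: bij_betw_inv_into_right)
  have h: "automorphism P Bl ?h" by (rule automorphism_inv_into[OF g sub])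
  have "(g \<circ> f \<circ> ?h) ` B = B" if B: "B \<in> Bl" "g c \<in> B" for B
  proof -
    have "?h ` B \<in> Bl" using h B by (auto simp: automorphism_def)
    moreover have "c \<in> ?h ` B" using hg[OF c(1)] B(2) by force
    ultimately have "f ` ?h ` B = ?h ` B" using f by (auto simp: translation_def)
    then have "(g \<circ> f \<circ> ?h) ` B = g ` ?h ` B" by (metis image_comp)
    also have "\<dots> = B" using gh sub[OF B(1)] by (force simp: image_image)
    finally show ?thesis .
  qed
  moreover have "automorphism P Bl (g \<circ> f \<circ> ?h)"
    using f g h by (intro automorphism_comp) (auto simp: translation_def)
  ultimately show ?thesis
    using c hg bij by (auto simp: translation_def bij_betw_def)
qed

lemma nontrivial_on_conjugate:
  assumes f: "nontrivial_on P f" "bij_betw f P P" and g: "bij_betw g P P"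
  shows "nontrivial_on P (g \<circ> f \<circ> inv_into P g)"
proof -
  obtain x where x: "x \<in> P" "f x \<noteq> x" using f by (auto simp: nontrivial_on_def)
  have "f x \<in> P" using f(2) x by (auto simp: bij_betw_def)
  then have "g (f x) \<noteq> g x" using x g by (auto simp: bij_betw_def dest: inj_onD)
  moreover have "inv_into P g (g x) = x" using g x by (simp add: bij_betw_def)
  moreover have "g x \<in> P" using g x by (auto simp: bij_betw_def)
  ultimately show ?thesis by (auto simp: nontrivial_on_def intro!: bexI[of _ "g x"])
qed

section \<open>Abstract unitals, that is, 2-(q^3+1, q+1, 1) designs\<close>

locale unital =
  fixes Pts :: "'p set" and Blks :: "'p set set" and q :: nat
  assumes finite_points: "finite Pts"
    and card_points: "card Pts = q ^ 3 + 1"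
    and order_ge_2: "q \<ge> 2"
    and block_subset: "B \<in> Blks \<Longrightarrow> B \<subseteq> Pts"
    and card_block: "B \<in> Blks \<Longrightarrow> card B = q + 1"
    and ex_join: "x \<in> Pts \<Longrightarrow> y \<in> Pts \<Longrightarrow> x \<noteq> y \<Longrightarrow> \<exists>B\<in>Blks. x \<in> B \<and> y \<in> B"
    and join_unique: "B \<in> Blks \<Longrightarrow> B' \<in> Blks \<Longrightarrow> x \<in> B \<Longrightarrow> y \<in> B \<Longrightarrow> x \<in> B' \<Longrightarrow> y \<in> B' \<Longrightarrow> x \<noteq> y
      \<Longrightarrow> B = B'"
begin

lemma finite_block: "B \<in> Blks \<Longrightarrow> finite B"
  using block_subset finite_points finite_subset by blast

lemma finite_blocks: "finite Blks"
  using block_subset finite_points by (meson Pow_iff finite_Pow_iff finite_subset subsetI)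

text \<open>The other q^3 points are shared out among these blocks, q to each.\<close>

lemma card_pencil:
  assumes "c \<in> Pts"
  shows "card {B\<in>Blks. c \<in> B} = q\<^sup>2"
proof -
  let ?P = "{B\<in>Blks. c \<in> B}"
  have "(\<Union>B\<in>?P. B - {c}) = Pts - {c}"
    using ex_join[OF assms] block_subset by blast
  then have "q ^ 3 = card (\<Union>B\<in>?P. B - {c})"
    using card_points finite_points assms by simp
  also have "\<dots> = (\<Sum>B\<in>?P. card (B - {c}))"
  proof (rule card_UN_disjoint)
    show "\<forall>B\<in>?P. \<forall>B'\<in>?P. B \<noteq> B' \<longrightarrow> (B - {c}) \<inter> (B' - {c}) = {}"
      using join_unique[of _ _ c] by blast
  qed (use finite_blocks finite_block in auto)
  also have "\<dots> = card ?P * q"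
    using card_block finite_block by simp
  finally show ?thesis
    using order_ge_2 by (simp add: power2_eq_square power3_eq_cube)
qed

lemma automorphism_block: "automorphism Pts Blks f \<Longrightarrow> B \<in> Blks \<Longrightarrow> f ` B \<in> Blks"
  by (auto simp: automorphism_def)

lemma translation_funpow:
  assumes "translation Pts Blks c f"
  shows "translation Pts Blks c (f ^^ k)"
proof (induction k)
  case 0
  then show ?case using assms by (simp add: translation_def automorphism_def bij_betw_def)
next
  case (Suc k)
  have "(f \<circ> (f ^^ k)) ` B = f ` ((f ^^ k) ` B)" for B by auto
  moreover have "automorphism Pts Blks (f \<circ> (f ^^ k))"
    using assms Suc by (intro automorphism_comp) (auto simp: translation_def)
  ultimately show ?case
    using assms Suc by (simp add: translation_def o_def)
qed

text \<open>Let \<open>F\<close> be the set of fixed points other than the center. If some point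
  moves, \<open>F\<close> must be a single block missing the center, and counting fixed points on
  two blocks through the center makes q both 1 and 0 modulo s.\<close>

lemma translation_prime_order_fixed_point:
  assumes tr: "translation Pts Blks c g"
    and s: "Factorial_Ring.prime (s::nat)" and gs: "\<And>x. x \<in> Pts \<Longrightarrow> (g ^^ s) x = x"
    and d: "d \<in> Pts" "d \<noteq> c" "g d = d"
    and w: "w \<in> Pts"
  shows "g w = w"
proof (rule ccontr)
  assume gw: "g w \<noteq> w"
  have c: "c \<in> Pts" "g c = c" and aut: "automorphism Pts Blks g"
    and fixB: "\<And>B. B \<in> Blks \<Longrightarrow> c \<in> B \<Longrightarrow> g ` B = B"
    using tr by (auto simp: translation_def)
  have inj: "inj_on g Pts" using aut by (auto simp: automorphism_def bij_betw_def)
  define F where "F = {x\<in>Pts. x \<noteq> c \<and> g x = x}"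
  have finF: "finite F" using finite_points by (simp add: F_def)
  \<comment> \<open>Every block through the center is fixed, so a point of a fixed block
    \<open>B\<close> is the intersection of two fixed blocks and cannot move.\<close>
  have step1: "B \<subseteq> F" if B: "B \<in> Blks" "c \<notin> B" "g ` B = B" for B
  proof
    fix z assume z: "z \<in> B"
    then have zP: "z \<in> Pts" "z \<noteq> c" using B block_subset by auto
    obtain L where L: "L \<in> Blks" "c \<in> L" "z \<in> L" using ex_join[OF c(1) zP(1)] zP by blast
    have "g z \<in> L" using fixB[OF L(1,2)] L(3) by blast
    moreover have "g z \<in> B" using B z by blast
    ultimately have "g z = z" using join_unique[OF B(1) L(1) z] L z B(2) by metis
    then show "z \<in> F" using zP by (simp add: F_def)
  qed
  have step2: "B \<subseteq> F" if "x \<in> F" "y \<in> F" "x \<noteq> y" "B \<in> Blks" "x \<in> B" "y \<in> B" "c \<notin> B" for x y B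
  proof -
    have "g x = x" "g y = y" using that by (auto simp: F_def)
    then have "x \<in> g ` B" "y \<in> g ` B" using that by (metis image_eqI)+
    then have "g ` B = B"
      using join_unique[OF automorphism_block[OF aut that(4)] that(4)] that by blast
    then show ?thesis using step1 that by blast
  qed
  have count: "q mod s = card (L \<inter> F) mod s" if L: "L \<in> Blks" "c \<in> L" for L
  proof -
    have "card (L - {c}) mod s = card {x \<in> L - {c}. g x = x} mod s"
    proof (rule card_fixed_points_prime_order[OF s])
      show "finite (L - {c})" using finite_block L by simp
      fix x assume x: "x \<in> L - {c}"
      then have xP: "x \<in> Pts" using L block_subset by auto
      show "(g ^^ s) x = x" using gs xP by simp
      have "g x \<in> L" using fixB[OF L] x by blast
      moreover have "g x \<noteq> c" using inj_onD[OF inj, of x c] x xP c by auto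
      ultimately show "g x \<in> L - {c}" by simp
    qed
    moreover have "{x \<in> L - {c}. g x = x} = L \<inter> F" using L block_subset by (auto simp: F_def)
    ultimately show ?thesis using L card_block finite_block by simp
  qed
  \<comment> \<open>With this bound the q^2 blocks through a point outnumber the q + 1 points of a
    block.\<close>
  have q4: "q\<^sup>2 \<ge> q + 2"
  proof -
    have "q + 2 \<le> q + q" using order_ge_2 by simp
    also have "\<dots> \<le> q * q" using order_ge_2 by (metis mult_2 mult_le_mono1)
    finally show ?thesis by (simp add: power2_eq_square)
  qed
  have dF: "d \<in> F" using d by (simp add: F_def)
  obtain L0 where L0: "L0 \<in> Blks" "c \<in> L0" "d \<in> L0" using ex_join[OF c(1) d(1)] d(2) by blast
  \<comment> \<open>If all of \<open>F\<close> lay on \<open>L0\<close>, another block through the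
    center would give \<open>s dvd q\<close>. Then s does not divide q^2 - 1, the number of blocks
    through d besides \<open>L0\<close>, so one of these is fixed and hence contained in
    \<open>F\<close>.\<close>
  obtain d' where d': "d' \<in> F" "d' \<notin> L0"
  proof (rule ccontr)
    assume "\<not> thesis"
    then have sub: "F \<subseteq> L0" using that by blast
    have "\<exists>L\<in>Blks. c \<in> L \<and> L \<noteq> L0"
    proof (rule ccontr)
      assume "\<not> ?thesis"
      then have "{B\<in>Blks. c \<in> B} \<subseteq> {L0}" by blast
      then have "card {B\<in>Blks. c \<in> B} \<le> 1" using card_mono[of "{L0}"] by fastforce
      then show False using card_pencil[OF c(1)] q4 by simp
    qed
    then obtain L where L: "L \<in> Blks" "c \<in> L" "L \<noteq> L0" by blast
    have "L \<inter> F = {}"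
      using sub join_unique[OF L(1) L0(1), of c] L L0 by (auto simp: F_def)
    then have sq: "s dvd q" using count[OF L(1,2)] by (simp add: mod_eq_0_iff_dvd)
    let ?E = "{B\<in>Blks. d \<in> B} - {L0}"
    have cE: "card ?E = q\<^sup>2 - 1" using card_pencil[OF d(1)] L0 finite_blocks by simp
    have gB: "(((`) g) ^^ k) B = (g ^^ k) ` B" for k B
      by (induction k) auto
    have "card ?E mod s = card {B \<in> ?E. g ` B = B} mod s"
    proof (rule card_fixed_points_prime_order[OF s])
      show "finite ?E" using finite_blocks by simp
      fix B assume B: "B \<in> ?E"
      have "(g ^^ s) x = x" if "x \<in> B" for x using gs B block_subset that by blast
      then show "(((`) g) ^^ s) B = B" by (simp add: gB)
      have "d \<in> g ` B" using B d(3) by (auto intro: rev_image_eqI)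
      moreover have "g ` B \<noteq> L0"
      proof
        assume *: "g ` B = L0"
        then obtain b where b: "b \<in> B" "g b = c" using L0 by auto
        then have "b = c" using inj_onD[OF inj, of b c] B block_subset c by auto
        then show False using join_unique[of B L0 c d] B b L0 d by auto
      qed
      ultimately show "g ` B \<in> ?E" using automorphism_block[OF aut] B by auto
    qed
    moreover have "(q\<^sup>2 - 1) mod s \<noteq> 0"
    proof
      assume "(q\<^sup>2 - 1) mod s = 0"
      then have 1: "s dvd q\<^sup>2 - 1" by auto
      have 2: "s dvd q\<^sup>2" using sq by (simp add: dvd_power_iff power2_eq_square)
      have "s dvd q\<^sup>2 - (q\<^sup>2 - 1)" using dvd_diff_nat[OF 2 1] .
      then show False using q4 s by (simp add: prime_nat_iff)
    qed
    ultimately have "{B \<in> ?E. g ` B = B} \<noteq> {}" using cE by (metis card.empty mod_0)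
    then obtain B where B: "B \<in> Blks" "d \<in> B" "B \<noteq> L0" "g ` B = B" by blast
    have "c \<notin> B" using join_unique[of B L0 c d] B L0 d by auto
    then have BF: "B \<subseteq> F" using step1 B by blast
    then have "B \<subseteq> {d}" using sub join_unique[of B L0 d] B L0 by blast
    then have "card B \<le> 1" using card_mono[of "{d}" B] by simp
    then show False using card_block[OF B(1)] order_ge_2 by simp
  qed
  have dd': "d \<noteq> d'" "d' \<in> Pts" using d' L0 by (auto simp: F_def)
  obtain B where B: "B \<in> Blks" "d \<in> B" "d' \<in> B" using ex_join[OF d(1) dd'(2,1)] by blast
  have cB: "c \<notin> B" using join_unique[of B L0 c d] B L0 d d' by auto
  have BF: "B \<subseteq> F" using step2[OF dF d'(1) dd'(1) B cB] .
  \<comment> \<open>Blocks joining a moved point \<open>v\<close> to distinct points of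
    \<open>F\<close> outside \<open>L\<close> are distinct, because a block with two points of
    \<open>F\<close> and without the center is fixed pointwise.\<close>
  have bound: "card (F - L) \<le> q\<^sup>2 - 1"
    if v: "v \<in> Pts" "g v \<noteq> v" and L: "L \<in> Blks" "c \<in> L" "v \<in> L" for v L
  proof -
    have vc: "v \<noteq> c" using v c by auto
    define J where "J x = (SOME M. M \<in> Blks \<and> v \<in> M \<and> x \<in> M)" for x
    have J: "J x \<in> Blks \<and> v \<in> J x \<and> x \<in> J x" if "x \<in> F" for x
      unfolding J_def by (rule someI_ex) (use ex_join[of v x] that v in \<open>auto simp: F_def\<close>)
    have "inj_on J (F - L)"
    proof (rule inj_onI, rule ccontr)
      fix x y assume x: "x \<in> F - L" and y: "y \<in> F - L" and eq: "J x = J y" and ne: "x \<noteq> y"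
      have "c \<notin> J x" using join_unique[of "J x" L v c] J[of x] x L vc by auto
      then have "J x \<subseteq> F" using step2[of x y "J x"] x y ne J[of x] J[of y] eq by auto
      then show False using J[of x] x v by (auto simp: F_def)
    qed
    moreover have "J ` (F - L) \<subseteq> {M\<in>Blks. v \<in> M} - {L}" using J by force
    moreover have "finite ({M\<in>Blks. v \<in> M} - {L})" using finite_blocks by simp
    ultimately have "card (F - L) \<le> card ({M\<in>Blks. v \<in> M} - {L})" by (metis card_inj_on_le)
    then show ?thesis using card_pencil[OF v(1)] L finite_blocks by simp
  qed
  \<comment> \<open>A further point \<open>y\<close> of \<open>F\<close> would be joined to at least
    q points of \<open>B\<close> off \<open>Ly\<close> by blocks inside \<open>F\<close>, giving q^2
    points of \<open>F\<close> off \<open>Ly\<close>, too many for \<open>bound\<close>. If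
    \<open>Ly\<close> is fixed pointwise, \<open>bound\<close> is applied at the moved point
    \<open>w\<close> instead.\<close>
  have FB: "F = B"
  proof (rule ccontr)
    assume "F \<noteq> B"
    then obtain y where y: "y \<in> F" "y \<notin> B" using BF by blast
    then have yP: "y \<in> Pts" "y \<noteq> c" by (auto simp: F_def)
    obtain Ly where Ly: "Ly \<in> Blks" "c \<in> Ly" "y \<in> Ly" using ex_join[OF c(1) yP(1)] yP by blast
    define J where "J x = (SOME M. M \<in> Blks \<and> y \<in> M \<and> x \<in> M)" for x
    have J: "J z \<in> Blks \<and> y \<in> J z \<and> z \<in> J z" if "z \<in> B" for z
      unfolding J_def
      by (rule someI_ex) (use ex_join[of y z] that y yP BF in \<open>auto simp: F_def\<close>)
    have cJ: "c \<notin> J z" if z: "z \<in> B - Ly" for z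
      using join_unique[of "J z" Ly y c] J[of z] z Ly yP by auto
    have JF: "J z \<subseteq> F" if z: "z \<in> B - Ly" for z
      by (rule step2[of y z]) (use J[of z] z y BF cJ[OF z] in auto)
    have JL: "J z \<inter> Ly \<subseteq> {y}" if z: "z \<in> B - Ly" for z
      using join_unique[of "J z" Ly y] J[of z] z Ly by blast
    have "card (B \<inter> Ly) \<le> 1"
    proof -
      have "B \<inter> Ly \<subseteq> {x}" if "x \<in> B \<inter> Ly" for x
        using join_unique[OF B(1) Ly(1), of x] that Ly cB by blast
      then show ?thesis by (metis all_not_in_conv card.empty card_mono card_insert_le_m1
          finite.emptyI finite_insert le_SucI le_zero_eq nle_le One_nat_def is_singletonI is_singleton_altdef)
    qed
    then have cBL: "card (B - Ly) \<ge> q"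
      using card_block[OF B(1)] card_Diff_subset_Int[of B Ly] finite_block[OF B(1)] by simp
    have "card (\<Union>z\<in>B - Ly. J z - {y}) = (\<Sum>z\<in>B - Ly. card (J z - {y}))"
    proof (rule card_UN_disjoint)
      show "finite (B - Ly)" using finite_block[OF B(1)] by simp
      show "\<forall>z\<in>B - Ly. finite (J z - {y})" using J finite_block by auto
      show "\<forall>z\<in>B - Ly. \<forall>z'\<in>B - Ly. z \<noteq> z' \<longrightarrow> (J z - {y}) \<inter> (J z' - {y}) = {}"
      proof (intro ballI impI, rule ccontr)
        fix z z' assume z: "z \<in> B - Ly" and z': "z' \<in> B - Ly" and ne: "z \<noteq> z'"
          and int: "(J z - {y}) \<inter> (J z' - {y}) \<noteq> {}"
        then have "J z = J z'" using join_unique[of "J z" "J z'" y] J[of z] J[of z'] by blast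
        then have "J z = B" using join_unique[of "J z" B z z'] J[of z] J[of z'] z z' ne B by auto
        then show False using J[of z] z y by auto
      qed
    qed
    also have "\<dots> = card (B - Ly) * q" using J card_block finite_block by simp
    also have "\<dots> \<ge> q\<^sup>2" using cBL by (simp add: power2_eq_square)
    finally have "q\<^sup>2 \<le> card (\<Union>z\<in>B - Ly. J z - {y})" .
    also have "\<dots> \<le> card (F - Ly)"
      by (rule card_mono) (use finF JF JL in auto)
    finally have big: "q\<^sup>2 \<le> card (F - Ly)" .
    show False
    proof (cases "\<exists>v\<in>Ly. g v \<noteq> v")
      case True
      then obtain v where "v \<in> Ly" "g v \<noteq> v" by blast
      then have "card (F - Ly) \<le> q\<^sup>2 - 1" using bound[of v Ly] Ly block_subset by auto
      then show False using big q4 by simp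
    next
      case False
      then have sub: "Ly - {c} \<subseteq> F" using block_subset[OF Ly(1)] by (auto simp: F_def)
      have "card F = card (F - Ly) + card (F \<inter> Ly)"
        using card_Un_disjoint[of "F - Ly" "F \<inter> Ly"] finF
        by (auto simp: Un_Diff_Int)
      moreover have "card (F \<inter> Ly) \<ge> card (Ly - {c})"
        by (rule card_mono) (use sub finF in auto)
      ultimately have ge: "card F \<ge> q\<^sup>2 + q"
        using big card_block[OF Ly(1)] finite_block[OF Ly(1)] Ly by simp
      have wc: "w \<noteq> c" using gw c by auto
      obtain L where L: "L \<in> Blks" "c \<in> L" "w \<in> L" using ex_join[OF c(1) w] wc by blast
      have "card (F \<inter> L) \<le> card (L - {c} - {w})"
        by (rule card_mono) (use finite_block[OF L(1)] gw in \<open>auto simp: F_def\<close>)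
      also have "\<dots> = q - 1" using card_block[OF L(1)] finite_block[OF L(1)] L wc by simp
      finally have "card (F \<inter> L) \<le> q - 1" .
      moreover have "card F = card (F - L) + card (F \<inter> L)"
        using card_Un_disjoint[of "F - L" "F \<inter> L"] finF
        by (auto simp: Un_Diff_Int)
      ultimately show False using ge bound[OF w gw L] order_ge_2 by linarith
    qed
  qed
  \<comment> \<open>\<open>L0\<close> meets \<open>B\<close> in d only, whereas some block through
    the center misses \<open>B\<close>; the two counts modulo s disagree.\<close>
  have "L0 \<inter> F = {d}" using join_unique[of L0 B d] L0 B cB FB by blast
  then have q1: "q mod s = 1 mod s" using count[OF L0(1,2)] by simp
  have "\<exists>L\<in>Blks. c \<in> L \<and> L \<inter> B = {}"
  proof (rule ccontr)
    assume neg: "\<not> ?thesis"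
    define J where "J x = (SOME M. M \<in> Blks \<and> c \<in> M \<and> x \<in> M)" for x
    have "{L\<in>Blks. c \<in> L} \<subseteq> J ` B"
    proof
      fix L assume L: "L \<in> {L\<in>Blks. c \<in> L}"
      then obtain x where x: "x \<in> L" "x \<in> B" using neg by blast
      have "J x \<in> Blks \<and> c \<in> J x \<and> x \<in> J x" unfolding J_def by (rule someI[of _ L]) (use L x in auto)
      then have "J x = L" using join_unique[of "J x" L c x] L x cB by auto
      then show "L \<in> J ` B" using x by auto
    qed
    then have "q\<^sup>2 \<le> card B"
      using card_pencil[OF c(1)] finite_block[OF B(1)] by (metis card_image_le card_mono finite_imageI le_trans)
    then show False using card_block[OF B(1)] q4 by simp
  qed
  then have "q mod s = 0" using count FB by force
  then show False using q1 s by (metis One_nat_def mod_less one_neq_zero prime_gt_1_nat)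
qed

text \<open>Passing to a power of prime order makes it possible to count fixed points modulo a prime.\<close>

lemma translation_fixed_point:
  assumes tr: "translation Pts Blks c f" and nt: "nontrivial_on Pts f" and d: "d \<in> Pts" "d \<noteq> c"
  shows "f d \<noteq> d"
proof
  assume fd: "f d = d"
  \<comment> \<open>\<open>f\<close> is arbitrary off the points; the identity there makes it a
    permutation, which has finite order.\<close>
  define g where "g x = (if x \<in> Pts then f x else x)" for x
  have bij: "bij_betw f Pts Pts" using tr by (auto simp: translation_def automorphism_def)
  have "g permutes Pts"
    by (rule bij_imp_permutes) (use bij in \<open>auto simp: g_def cong: bij_betw_cong\<close>)
  then have "permutation g" using finite_points permutation_permutes by blast
  then obtain N where N: "g ^^ N = id" "N > 0" using permutation_is_nilpotent by blast
  have fP: "f x \<in> Pts" if "x \<in> Pts" for x using bij that by (auto simp: bij_betw_def)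
  have fg: "(f ^^ k) x = (g ^^ k) x \<and> (f ^^ k) x \<in> Pts" if "x \<in> Pts" for k x
    using that by (induction k) (auto simp: g_def fP)
  define n where "n = (LEAST n. n > 0 \<and> (\<forall>x\<in>Pts. (f ^^ n) x = x))"
  have ex: "N > 0 \<and> (\<forall>x\<in>Pts. (f ^^ N) x = x)" using fg N by auto
  have n: "n > 0" "\<And>x. x \<in> Pts \<Longrightarrow> (f ^^ n) x = x"
    unfolding n_def using LeastI[of "\<lambda>n. n > 0 \<and> (\<forall>x\<in>Pts. (f ^^ n) x = x)", OF ex] by auto
  have "n \<noteq> 1" using nt n(2) by (auto simp: nontrivial_on_def)
  then obtain s where s: "Factorial_Ring.prime s" "s dvd n" using prime_factor_nat by blast
  then obtain m where m: "n = s * m" by auto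
  have "0 < m" "m < n" using n(1) m s(1) prime_gt_1_nat by (auto simp: zero_less_mult_iff)
  then obtain w where w: "w \<in> Pts" "(f ^^ m) w \<noteq> w"
    using not_less_Least[of m "\<lambda>n. n > 0 \<and> (\<forall>x\<in>Pts. (f ^^ n) x = x)"] unfolding n_def[symmetric] by auto
  have "(f ^^ k) d = d" for k using fd by (induction k) auto
  then have "(f ^^ m) w = w"
    by (intro translation_prime_order_fixed_point[OF translation_funpow[OF tr] s(1) _ d _ w(1)])
      (use n(2) m in \<open>auto simp: funpow_mult mult.commute\<close>)
  then show False using w by simp
qed

end

subsection \<open>Matrices of size 2\<close>

lemma mat2_eq_iff: "(A :: 'a mat2) = B \<longleftrightarrow>
    A $ 1 $ 1 = B $ 1 $ 1 \<and> A $ 1 $ 2 = B $ 1 $ 2 \<and> A $ 2 $ 1 = B $ 2 $ 1 \<and> A $ 2 $ 2 = B $ 2 $ 2"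
  by (auto simp: vec_eq_iff forall_2)

lemma vec2_eq_iff: "(v :: 'a ^ 2) = w \<longleftrightarrow> v $ 1 = w $ 1 \<and> v $ 2 = w $ 2"
  by (simp add: vec_eq_iff forall_2)

lemma mat2_mult [simp]:
  fixes A B :: "'a::comm_ring_1 mat2"
  shows "(A ** B) $ i $ j = A $ i $ 1 * B $ 1 $ j + A $ i $ 2 * B $ 2 $ j"
  by (simp add: matrix_matrix_mult_def sum_2)

lemma vec2_mult [simp]:
  fixes A :: "'a::comm_ring_1 mat2"
  shows "(v v* A) $ j = v $ 1 * A $ 1 $ j + v $ 2 * A $ 2 $ j"
  by (simp add: vector_matrix_mult_def sum_2 mult.commute)

lemma mat2_one [simp]: "(mat 1 :: 'a::comm_ring_1 mat2) $ i $ j = (if i = j then 1 else 0)"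
  by (simp add: mat_def)

definition mk2 :: "'a::zero \<Rightarrow> 'a \<Rightarrow> 'a \<Rightarrow> 'a \<Rightarrow> 'a mat2" where
  "mk2 a b c d = vector [vector [a, b], vector [c, d]]"

lemma mk2_nth [simp]:
  "mk2 a b c d $ 1 $ 1 = a" "mk2 a b c d $ 1 $ 2 = b" "mk2 a b c d $ 2 $ 1 = c" "mk2 a b c d $ 2 $ 2 = d"
  by (simp_all add: mk2_def)

text \<open>The adjugate: on SL(2,q) the inverse, and a formula without division, so that matrix
  identities reduce to ring identities between entries.\<close>

definition adj2 :: "'a::comm_ring_1 mat2 \<Rightarrow> 'a mat2" where
  "adj2 A = mk2 (A $ 2 $ 2) (- A $ 1 $ 2) (- A $ 2 $ 1) (A $ 1 $ 1)"

lemma adj2_nth [simp]: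
  "adj2 A $ 1 $ 1 = A $ 2 $ 2" "adj2 A $ 1 $ 2 = - A $ 1 $ 2"
  "adj2 A $ 2 $ 1 = - A $ 2 $ 1" "adj2 A $ 2 $ 2 = A $ 1 $ 1"
  by (simp_all add: adj2_def)

interpretation SL2: group "SL2 :: ('a::field) mat2 monoid" by (rule group_SL2)

lemma SL2_mult [simp]: "A \<otimes>\<^bsub>SL2\<^esub> B = A ** B"
  by (simp add: SL2_def)

lemma SL2_one [simp]: "\<one>\<^bsub>SL2\<^esub> = mat 1"
  by (simp add: SL2_def)

lemma SL2_carrier: "A \<in> carrier SL2 \<longleftrightarrow> A $ 1 $ 1 * A $ 2 $ 2 - A $ 1 $ 2 * A $ 2 $ 1 = 1"
  by (simp add: SL2_def det_2)

lemma SL2_det: "A \<in> carrier SL2 \<Longrightarrow> A $ 1 $ 1 * A $ 2 $ 2 = 1 + A $ 1 $ 2 * A $ 2 $ 1"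
  by (simp add: SL2_carrier algebra_simps)

lemma SL2_closed [simp, intro]: "A \<in> carrier SL2 \<Longrightarrow> B \<in> carrier SL2 \<Longrightarrow> A ** B \<in> carrier SL2"
  using SL2.m_closed by auto

lemma mat_1_in_SL2 [simp]: "mat 1 \<in> carrier (SL2 :: ('a::field) mat2 monoid)"
  using SL2.one_closed by auto

lemma inv_SL2: "A \<in> carrier SL2 \<Longrightarrow> inv\<^bsub>SL2\<^esub> A = adj2 A"
  by (rule SL2.inv_equality) (auto simp: SL2_carrier mat2_eq_iff algebra_simps)

lemma adj2_in_SL2 [simp]: "A \<in> carrier SL2 \<Longrightarrow> adj2 A \<in> carrier SL2"
  by (simp add: SL2_carrier algebra_simps)

lemma adj2_mult_left [simp]: "A \<in> carrier SL2 \<Longrightarrow> adj2 A ** A = mat 1"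
  by (auto simp: SL2_carrier mat2_eq_iff algebra_simps)

lemma adj2_mult_right [simp]: "A \<in> carrier SL2 \<Longrightarrow> A ** adj2 A = mat 1"
  by (auto simp: SL2_carrier mat2_eq_iff algebra_simps)

lemma adj2_adj2 [simp]: "adj2 (adj2 A) = A"
  by (simp add: mat2_eq_iff)

lemma adj2_mult: "adj2 (A ** B) = adj2 B ** adj2 A"
  by (simp add: mat2_eq_iff algebra_simps)

lemma adj2_cancel [simp]:
  assumes "A \<in> carrier SL2"
  shows "adj2 A ** (A ** B) = B" "A ** (adj2 A ** B) = B" "(B ** A) ** adj2 A = B" "(B ** adj2 A) ** A = B"
proof -
  show "adj2 A ** (A ** B) = B" "A ** (adj2 A ** B) = B"
    by (simp_all only: matrix_mul_assoc adj2_mult_left[OF assms] adj2_mult_right[OF assms] matrix_mul_lid)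
  show "(B ** A) ** adj2 A = B" "(B ** adj2 A) ** A = B"
    by (simp_all only: matrix_mul_assoc[symmetric] adj2_mult_left[OF assms] adj2_mult_right[OF assms] matrix_mul_rid)
qed

lemma mult_eq_iff_right: "g \<in> carrier SL2 \<Longrightarrow> (A :: 'a::field mat2) ** g = B \<longleftrightarrow> A = B ** adj2 g"
  by auto

lemma r_coset_SL2: "H #>\<^bsub>SL2\<^esub> g = (\<lambda>h. h ** g) ` H"
  by (auto simp: r_coset_def)

lemma l_coset_SL2: "g <#\<^bsub>SL2\<^esub> H = (\<lambda>h. g ** h) ` H"
  by (auto simp: l_coset_def)

subsection \<open>The Sylow subgroups\<close>

text \<open>The determinant with rows \<open>v\<close> and \<open>w\<close>, that is, the symplectic
  form preserved by SL(2,q).\<close>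

definition cross2 :: "'a::comm_ring_1 ^ 2 \<Rightarrow> 'a ^ 2 \<Rightarrow> 'a" where
  "cross2 v w = v $ 1 * w $ 2 - v $ 2 * w $ 1"

lemma cross2_mult:
  assumes "g \<in> carrier SL2"
  shows "cross2 (v v* g) (w v* g) = cross2 v w"
proof -
  have "cross2 (v v* g) (w v* g) = (g $ 1 $ 1 * g $ 2 $ 2 - g $ 1 $ 2 * g $ 2 $ 1) * cross2 v w"
    unfolding cross2_def vec2_mult by (simp add: algebra_simps)
  then show ?thesis using assms by (simp add: SL2_carrier)
qed

definition rstab :: "('a::field) ^ 2 \<Rightarrow> 'a mat2 set" where
  "rstab v = {g \<in> carrier SL2. v v* g = v}"

text \<open>The matrix of the linear map taking \<open>u\<close> to
  \<open>u + t * cross2 u v * v\<close>.\<close>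

definition transvection :: "('a::field) ^ 2 \<Rightarrow> 'a \<Rightarrow> 'a mat2" where
  "transvection v t = mk2 (1 + t * v $ 1 * v $ 2) (t * (v $ 2)\<^sup>2) (- t * (v $ 1)\<^sup>2) (1 - t * v $ 1 * v $ 2)"

lemma transvection_in_rstab: "transvection v t \<in> rstab v"
  by (auto simp: rstab_def transvection_def SL2_carrier vec2_eq_iff algebra_simps power2_eq_square)

text \<open>Cramer's rule for the two row equations; multiples by x replace divisions, so x may be
  zero.\<close>

lemma fixed_row_entries:
  fixes a b c d x y :: "'a::field"
  assumes "a * d - b * c = 1" "x * a + y * c = x" "x * b + y * d = y"
  shows "x * d = x + y * c" "x * (x * b) = - (y * (y * c))"
proof -
  have "(x * a + y * c) * d - (x * b + y * d) * c = x * (a * d - b * c)" by (simp add: algebra_simps)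
  then have "x * d - y * c = x" unfolding assms by simp
  then show *: "x * d = x + y * c" by (simp add: algebra_simps)
  have "x * (x * b) = x * (x * b + y * d) - y * (x * d)" by (simp add: algebra_simps)
  then show "x * (x * b) = - (y * (y * c))" unfolding * assms by (simp add: algebra_simps)
qed

lemma rstab_eq:
  assumes "v \<noteq> 0"
  shows "rstab v = range (transvection v)"
proof
  show "range (transvection v) \<subseteq> rstab v" using transvection_in_rstab by auto
  show "rstab v \<subseteq> range (transvection v)"
  proof
    fix g assume "g \<in> rstab v"
    then have g: "g $ 1 $ 1 * g $ 2 $ 2 - g $ 1 $ 2 * g $ 2 $ 1 = 1"
      "v $ 1 * g $ 1 $ 1 + v $ 2 * g $ 2 $ 1 = v $ 1" "v $ 1 * g $ 1 $ 2 + v $ 2 * g $ 2 $ 2 = v $ 2"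
      by (auto simp: rstab_def SL2_carrier vec2_eq_iff)
    show "g \<in> range (transvection v)"
    proof (cases "v $ 1 = 0")
      case False
      have 1: "v $ 1 * g $ 2 $ 2 = v $ 1 + v $ 2 * g $ 2 $ 1"
      and 2: "v $ 1 * (v $ 1 * g $ 1 $ 2) = - (v $ 2 * (v $ 2 * g $ 2 $ 1))"
        by (rule fixed_row_entries[OF g])+
      have "g = transvection v (- g $ 2 $ 1 / (v $ 1)\<^sup>2)"
        using False g 1 2 unfolding mat2_eq_iff transvection_def mk2_nth
        by (simp add: field_simps power2_eq_square)
      then show ?thesis by blast
    next
      case True
      then have "v $ 2 \<noteq> 0" using assms by (auto simp: vec2_eq_iff)
      then have "g = transvection v (g $ 1 $ 2 / (v $ 2)\<^sup>2)"
        using True g unfolding mat2_eq_iff transvection_def mk2_nth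
        by (simp add: field_simps power2_eq_square)
      then show ?thesis by blast
    qed
  qed
qed

lemma transvection_inject:
  assumes "v \<noteq> 0"
  shows "transvection v s = transvection v t \<longleftrightarrow> s = t"
proof
  assume "transvection v s = transvection v t"
  then have "s * (v $ 2)\<^sup>2 = t * (v $ 2)\<^sup>2" "s * (v $ 1)\<^sup>2 = t * (v $ 1)\<^sup>2"
    unfolding mat2_eq_iff transvection_def mk2_nth by simp_all
  moreover have "v $ 1 \<noteq> 0 \<or> v $ 2 \<noteq> 0" using assms by (simp add: vec2_eq_iff)
  ultimately show "s = t" by auto
qed simp

lemma transvection_add: "transvection v s ** transvection v t = transvection v (s + t)"
  unfolding mat2_eq_iff transvection_def mk2_nth mat2_mult by (simp add: algebra_simps power2_eq_square)

lemma transvection_0: "transvection v 0 = mat 1"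
  by (simp add: transvection_def mat2_eq_iff)

lemma card_rstab: "(v :: ('a::{field,finite}) ^ 2) \<noteq> 0 \<Longrightarrow> card (rstab v) = CARD('a)"
  by (simp add: rstab_eq card_image inj_def transvection_inject)

lemma vm_assoc:
  fixes A B :: "'a::comm_ring_1 mat2"
  shows "(v v* A) v* B = v v* (A ** B)"
  by (simp add: vec2_eq_iff algebra_simps)

lemma vm_one [simp]: "v v* (mat 1 :: 'a::comm_ring_1 mat2) = v"
  by (simp add: vec2_eq_iff)

lemma vm_cancel [simp]:
  assumes "g \<in> carrier SL2"
  shows "(v v* g) v* adj2 g = v" "(v v* adj2 g) v* g = v"
  by (simp_all only: vm_assoc adj2_mult_left[OF assms] adj2_mult_right[OF assms] vm_one)

lemma vm_eq_0_iff [simp]: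
  assumes "g \<in> carrier SL2"
  shows "v v* g = 0 \<longleftrightarrow> v = 0"
proof
  assume "v v* g = 0"
  then have "(v v* g) v* adj2 g = 0" by simp
  then show "v = 0" using vm_cancel(1)[OF assms, of v] by simp
qed simp

lemma subgroup_rstab: "subgroup (rstab v) SL2"
proof (rule SL2.subgroupI)
  show "rstab v \<noteq> {}" by (auto simp: rstab_def)
  fix a assume "a \<in> rstab v"
  then show "inv\<^bsub>SL2\<^esub> a \<in> rstab v"
    using vm_cancel(1)[of a v] by (auto simp: rstab_def inv_SL2)
qed (auto simp: rstab_def simp flip: vm_assoc)

lemma rstab_coset:
  assumes "g \<in> carrier SL2"
  shows "rstab v #>\<^bsub>SL2\<^esub> g = {h \<in> carrier SL2. v v* h = v v* g}"
proof -
  have "h \<in> (\<lambda>h. h ** g) ` rstab v" if h: "h \<in> carrier SL2" "v v* h = v v* g" for h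
  proof (rule image_eqI)
    show "h = (h ** adj2 g) ** g" using assms by simp
    have "v v* (h ** adj2 g) = v" using h(2) assms by (simp flip: vm_assoc)
    then show "h ** adj2 g \<in> rstab v" using h assms by (simp add: rstab_def)
  qed
  then show ?thesis unfolding r_coset_SL2 using assms by (auto simp: rstab_def simp flip: vm_assoc)
qed

text \<open>The vector (0,1) reaches any non-zero vector through a matrix having it as second row;
  the general case composes two such matrices.\<close>

lemma ex_SL2_row:
  assumes "v \<noteq> 0" "w \<noteq> (0 :: 'a::field ^ 2)"
  shows "\<exists>g\<in>carrier SL2. v v* g = w"
proof -
  have base: "\<exists>g\<in>carrier SL2. vector [0,1] v* g = w" if "w \<noteq> 0" for w :: "'a ^ 2"
  proof (cases "w $ 1 = 0")
    case True
    then have "w $ 2 \<noteq> 0" using that by (auto simp: vec2_eq_iff)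
    then show ?thesis using True
      by (intro bexI[of _ "mk2 (1 / w $ 2) 0 0 (w $ 2)"]) (auto simp: vec2_eq_iff SL2_carrier)
  next
    case False
    then show ?thesis
      by (intro bexI[of _ "mk2 0 (- 1 / w $ 1) (w $ 1) (w $ 2)"]) (auto simp: vec2_eq_iff SL2_carrier)
  qed
  obtain g h where g: "g \<in> carrier SL2" "vector [0,1] v* g = v" and h: "h \<in> carrier SL2" "vector [0,1] v* h = w"
    using base assms by blast
  have "v v* (adj2 g ** h) = w"
    using g h vm_cancel(1)[OF g(1), of "vector [0,1]"] by (simp flip: vm_assoc)
  then show ?thesis using g h by (intro bexI[of _ "adj2 g ** h"]) auto
qed

lemma card_vec2: "card (UNIV :: ('a::finite ^ 2) set) = CARD('a)\<^sup>2"
  by (simp add: CARD_vec)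

text \<open>The vectors \<open>v h\<close> run through the q^2 - 1 non-zero ones, each attained on a
  coset of \<open>rstab v\<close>, which has q elements.\<close>

lemma card_SL2: "card (carrier (SL2 :: ('a::{field,finite}) mat2 monoid)) = CARD('a) * (CARD('a)\<^sup>2 - 1)"
proof -
  let ?v = "vector [0,1] :: 'a ^ 2"
  have v: "?v \<noteq> 0" by (simp add: vec2_eq_iff)
  have "(\<Union>w\<in>UNIV - {0}. {h \<in> carrier SL2. ?v v* h = w}) = carrier (SL2 :: 'a mat2 monoid)"
    using v by auto
  then have "card (carrier (SL2 :: 'a mat2 monoid)) = card (\<Union>w\<in>UNIV - {0}. {h \<in> carrier SL2. ?v v* h = w})"
    by simp
  also have "\<dots> = (\<Sum>w\<in>UNIV - {0}. card {h \<in> carrier SL2. ?v v* h = w})"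
    by (rule card_UN_disjoint) auto
  also have "\<dots> = (\<Sum>w\<in>UNIV - {0 :: 'a ^ 2}. CARD('a))"
  proof (rule sum.cong[OF refl])
    fix w :: "'a ^ 2" assume "w \<in> UNIV - {0}"
    then obtain g where g: "g \<in> carrier SL2" "?v v* g = w" using ex_SL2_row[OF v] by auto
    have "card {h \<in> carrier SL2. ?v v* h = w} = card (rstab ?v #>\<^bsub>SL2\<^esub> g)"
      using rstab_coset[OF g(1), of ?v] g by simp
    also have "\<dots> = card (rstab ?v)"
      unfolding r_coset_SL2 by (rule card_image) (auto intro!: inj_onI simp: mult_eq_iff_right[OF g(1)] g(1))
    finally show "card {h \<in> carrier SL2. ?v v* h = w} = CARD('a)" using card_rstab[OF v] by simp
  qed
  also have "\<dots> = CARD('a) * (CARD('a)\<^sup>2 - 1)"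
    by (simp add: card_Diff_singleton card_vec2)
  finally show ?thesis .
qed

text \<open>For non-zero \<open>v\<close> and \<open>z\<close> this is a right coset of
  \<open>rstab v\<close> and also a left coset of \<open>rstab z\<close>. The symmetric form makes
  images under inversion and under multiplication on either side explicit.\<close>

definition row_fiber :: "('a::field) ^ 2 \<Rightarrow> 'a ^ 2 \<Rightarrow> 'a mat2 set" where
  "row_fiber v z = {h \<in> carrier SL2. v v* h = z}"

lemma card_row_fiber:
  fixes v z :: "('a::{field,finite}) ^ 2"
  assumes "v \<noteq> 0" "z \<noteq> 0"
  shows "card (row_fiber v z) = CARD('a)"
proof -
  obtain g where g: "g \<in> carrier SL2" "v v* g = z" using ex_SL2_row[OF assms] by blast
  have "card (row_fiber v z) = card (rstab v #>\<^bsub>SL2\<^esub> g)"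
    using rstab_coset[OF g(1), of v] g by (simp add: row_fiber_def)
  also have "\<dots> = card (rstab v)"
    unfolding r_coset_SL2 by (rule card_image) (auto intro!: inj_onI simp: mult_eq_iff_right[OF g(1)] g(1))
  finally show ?thesis using card_rstab[OF assms(1)] by simp
qed

lemma multiplicity_order_SL2:
  assumes p: "Factorial_Ring.prime (p::nat)" and q: "CARD('a::{field,finite}) = p ^ e" and e: "e > 0"
  shows "multiplicity p (Coset.order (SL2 :: 'a mat2 monoid)) = e"
proof -
  have q2: "CARD('a) \<ge> 2" using card_mono[of "UNIV :: 'a set" "{0,1}"] by simp
  have "p dvd CARD('a)\<^sup>2" using q e by (simp add: dvd_power power2_eq_square)
  moreover have "\<not> p dvd 1" using p by (simp add: prime_nat_iff)
  ultimately have "\<not> p dvd CARD('a)\<^sup>2 - 1" using q2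
    by (metis dvd_diffD1 one_le_power le_trans one_le_numeral)
  moreover have "CARD('a)\<^sup>2 - 1 \<noteq> 0" using calculation by auto
  ultimately have "multiplicity p (CARD('a) * (CARD('a)\<^sup>2 - 1)) = multiplicity p (CARD('a))"
    using p q2 by (subst prime_elem_multiplicity_mult_distrib) (auto simp: not_dvd_imp_multiplicity_0)
  also have "\<dots> = e" using p q by (simp add: prime_nat_iff)
  finally show ?thesis by (simp add: Coset.order_def card_SL2)
qed

text \<open>A subgroup of order q fixes one of the q^2 - 1 non-zero vectors, because p does not
  divide this number. It lies in the stabilizer of that vector and has the same order.\<close>

lemma sylow_subgroups_SL2:
  assumes p: "Factorial_Ring.prime (p::nat)" and q: "CARD('a::{field,finite}) = p ^ e" and e: "e > 0"
  shows "sylow_subgroups p (SL2 :: 'a mat2 monoid) = {rstab v | v. v \<noteq> 0}"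
proof -
  have "\<exists>v. v \<noteq> 0 \<and> P = rstab v" if P: "subgroup P (SL2 :: 'a mat2 monoid)" "card P = p ^ e" for P
  proof -
    let ?E = "UNIV - {0 :: 'a ^ 2}" and ?G = "SL2\<lparr>carrier := P\<rparr>"
    have sub: "P \<subseteq> carrier SL2" using subgroup.subset[OF P(1)] .
    \<comment> \<open>Row vectors carry a right action; \<open>adj2 g\<close> turns it into a left
      action.\<close>
    have "card ?E mod p = card {v\<in>?E. \<forall>g\<in>carrier ?G. v v* adj2 g = v} mod p"
    proof (rule card_fixed_points_p_group[OF _ p])
      show "group ?G" using SL2.subgroup_imp_group[OF P(1)] .
      show "card (carrier ?G) = p ^ e" using P by simp
      fix g h :: "'a mat2" and v :: "'a ^ 2"
      assume "g \<in> carrier ?G"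
      then have "g \<in> carrier SL2" using sub by auto
      then show "v \<in> ?E \<Longrightarrow> v v* adj2 g \<in> ?E" by auto
      show "v v* adj2 (g \<otimes>\<^bsub>?G\<^esub> h) = (v v* adj2 h) v* adj2 g"
        by (simp add: vm_assoc adj2_mult)
    qed (auto simp: mat2_eq_iff[of "adj2 (mat 1)" "mat 1"] vec2_eq_iff)
    moreover have "card ?E mod p \<noteq> 0"
    proof
      assume "card ?E mod p = 0"
      then have 1: "p dvd CARD('a)\<^sup>2 - 1" by (simp add: card_Diff_singleton card_vec2 mod_eq_0_iff_dvd)
      have "p dvd CARD('a)\<^sup>2" using q e by (simp add: dvd_power power2_eq_square)
      then have "p dvd CARD('a)\<^sup>2 - (CARD('a)\<^sup>2 - 1)" using 1 dvd_diff_nat by blast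
      then show False using p by (simp add: prime_nat_iff)
    qed
    ultimately have "{v\<in>?E. \<forall>g\<in>carrier ?G. v v* adj2 g = v} \<noteq> {}" by (metis card.empty mod_0)
    then obtain v where v: "v \<noteq> 0" "\<And>g. g \<in> P \<Longrightarrow> v v* adj2 g = v" by auto
    have "P \<subseteq> rstab v"
    proof
      fix g assume g: "g \<in> P"
      then show "g \<in> rstab v" using v(2)[OF g] sub vm_cancel(2)[of g v] by (auto simp: rstab_def)
    qed
    then have "P = rstab v" using card_rstab[OF v(1)] P q card_subset_eq[of "rstab v" P] by simp
    then show ?thesis using v by blast
  qed
  then show ?thesis
    using subgroup_rstab card_rstab q
    unfolding sylow_subgroups_def multiplicity_order_SL2[OF assms] by fastforce
qed

lemma short_blocks_eq:
  assumes p: "Factorial_Ring.prime (p::nat)" and q: "CARD('a::{field,finite}) = p ^ e" and e: "e > 0"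
  shows "short_blocks p = {row_fiber v z | v z :: 'a ^ 2. v \<noteq> 0 \<and> z \<noteq> 0}"
proof -
  have "rstab v #>\<^bsub>SL2\<^esub> g = row_fiber v (v v* g) \<and> (v \<noteq> 0 \<longrightarrow> v v* g \<noteq> 0)"
    if "g \<in> carrier SL2" for g and v :: "'a ^ 2"
    using that rstab_coset[OF that, of v] by (simp add: row_fiber_def)
  then show ?thesis
    unfolding short_blocks_def sylow_subgroups_SL2[OF assms]
    using ex_SL2_row by (auto; metis)
qed

lemma row_fiber_mult:
  assumes "h \<in> carrier SL2" "k \<in> carrier SL2"
  shows "(\<lambda>x. h ** x ** k) ` row_fiber v z = row_fiber (v v* adj2 h) (z v* k)"
proof (intro equalityI subsetI)
  fix y assume y: "y \<in> row_fiber (v v* adj2 h) (z v* k)"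
  show "y \<in> (\<lambda>x. h ** x ** k) ` row_fiber v z"
  proof (rule image_eqI)
    show "y = h ** (adj2 h ** y ** adj2 k) ** k" using assms by (simp add: matrix_mul_assoc)
    show "adj2 h ** y ** adj2 k \<in> row_fiber v z"
      using y assms by (simp add: row_fiber_def flip: vm_assoc)
  qed
qed (use assms in \<open>auto simp: row_fiber_def simp flip: vm_assoc\<close>)

lemma row_fiber_inv: "adj2 ` row_fiber v z = row_fiber z v"
proof (intro equalityI subsetI)
  fix y assume y: "y \<in> row_fiber z v"
  show "y \<in> adj2 ` row_fiber v z"
    by (rule image_eqI[of _ _ "adj2 y"]) (use y vm_cancel(1)[of y z] in \<open>auto simp: row_fiber_def\<close>)
qed (auto simp: row_fiber_def)

text \<open>With \<open>v $ 1 = 1\<close> the row equations eliminate the first row, and the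
  determinant becomes linear in the second. The block is thus parametrized by its lower left
  entry.\<close>

lemma row_fiber_normal_form:
  assumes "v $ 1 = 1" "z $ 1 \<noteq> 0"
  shows "x \<in> row_fiber v z \<longleftrightarrow> x $ 1 $ 1 = z $ 1 - v $ 2 * x $ 2 $ 1 \<and>
    x $ 2 $ 2 = 1 / z $ 1 + z $ 2 / z $ 1 * x $ 2 $ 1 \<and>
    x $ 1 $ 2 = z $ 2 - v $ 2 * x $ 2 $ 2"
proof -
  have *: "(a = z $ 1 - v $ 2 * c \<and> d = 1 / z $ 1 + z $ 2 / z $ 1 * c \<and> b = z $ 2 - v $ 2 * d)
    \<longleftrightarrow> (a * d - b * c = 1 \<and> a + v $ 2 * c = z $ 1 \<and> b + v $ 2 * d = z $ 2)" (is "?L \<longleftrightarrow> ?R") for a b c d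
  proof -
    have "(a * d - b * c = 1) \<longleftrightarrow> d = 1 / z $ 1 + z $ 2 / z $ 1 * c"
      if "a = z $ 1 - v $ 2 * c" "b = z $ 2 - v $ 2 * d"
    proof -
      have "a * d - b * c = z $ 1 * d - z $ 2 * c" unfolding that by (simp add: algebra_simps)
      moreover have "z $ 1 * d - z $ 2 * c = 1 \<longleftrightarrow> d = 1 / z $ 1 + z $ 2 / z $ 1 * c"
        using assms(2) by (simp add: field_simps)
      ultimately show ?thesis by simp
    qed
    then show ?thesis by (auto simp: algebra_simps)
  qed
  show ?thesis unfolding row_fiber_def mem_Collect_eq SL2_carrier vec2_eq_iff vec2_mult
    using *[of "x $ 1 $ 1" "x $ 2 $ 1" "x $ 2 $ 2" "x $ 1 $ 2"] assms(1) by auto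
qed

text \<open>The base class only controls the level sets of the lower left entry. Short blocks of the form
  \<open>row_fiber (1, -m) (a, a * n)\<close> meet every level set exactly once. The image of such a block has
  the same \<open>n\<close> because of a level in \<open>K - {0}\<close>, and the same \<open>m\<close> because of a level outside \<open>K\<close>.\<close>

lemma fixes_levels_imp_id:
  fixes f :: "('a::field) mat2 \<Rightarrow> 'a mat2" and K :: "'a set"
  assumes K: "0 \<in> K" "k \<in> K" "k \<noteq> 0" "l \<notin> K"
    and fib: "\<And>v z. v \<noteq> 0 \<Longrightarrow> z \<noteq> 0 \<Longrightarrow> \<exists>w y. w \<noteq> 0 \<and> y \<noteq> 0 \<and> f ` row_fiber v z \<subseteq> row_fiber w y"
    and inK: "\<And>x. x \<in> carrier SL2 \<Longrightarrow> x $ 2 $ 1 \<in> K \<Longrightarrow> f x $ 2 $ 1 = x $ 2 $ 1 \<and> f x $ 2 $ 2 = x $ 2 $ 2"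
    and notK: "\<And>x. x \<in> carrier SL2 \<Longrightarrow> x $ 2 $ 1 \<notin> K \<Longrightarrow> f x $ 2 $ 1 = x $ 2 $ 1 \<and> f x $ 1 $ 1 = x $ 1 $ 1"
    and x: "x \<in> carrier SL2"
  shows "f x = x"
proof -
  have level: "f x $ 2 $ 1 = x $ 2 $ 1" if "x \<in> carrier SL2" for x
    using inK notK that by blast
  have main: "f x = x" if x: "x \<in> row_fiber v z" and v: "v $ 1 = 1" and z: "z $ 1 \<noteq> 0" for x v z
  proof -
    have v0: "v \<noteq> 0" and z0: "z \<noteq> 0" using v z by (auto simp: vec2_eq_iff)
    obtain w y where wy: "w \<noteq> 0" "y \<noteq> 0" "f ` row_fiber v z \<subseteq> row_fiber w y"
      using fib[OF v0 z0] by blast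
    \<comment> \<open>The point of the block on level \<open>c\<close>, read off from the normal
      form.\<close>
    define pt where "pt c = mk2 (z $ 1 - v $ 2 * c) (z $ 2 - v $ 2 * (1 / z $ 1 + z $ 2 / z $ 1 * c))
      c (1 / z $ 1 + z $ 2 / z $ 1 * c)" for c
    have pt: "pt c \<in> row_fiber v z" for c
      unfolding row_fiber_normal_form[OF v z] by (simp add: pt_def)
    then have ptS: "pt c \<in> carrier SL2" for c by (simp add: row_fiber_def)
    have fpt: "f (pt c) \<in> row_fiber w y" for c using pt wy by blast
    have fptl: "f (pt c) $ 2 $ 1 = c" for c using level[OF ptS] by (simp add: pt_def)
    have eqs: "w $ 1 * f (pt c) $ 1 $ 1 + w $ 2 * c = y $ 1"
      "w $ 1 * f (pt c) $ 1 $ 2 + w $ 2 * f (pt c) $ 2 $ 2 = y $ 2"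
      "f (pt c) $ 1 $ 1 * f (pt c) $ 2 $ 2 - f (pt c) $ 1 $ 2 * c = 1" for c
      using fpt[of c] fptl[of c] unfolding row_fiber_def mem_Collect_eq vec2_eq_iff vec2_mult SL2_carrier
      by simp_all
    \<comment> \<open>Otherwise the lower left entry would be constant along the image block, but
      levels 0 and k both occur.\<close>
    have w1: "w $ 1 \<noteq> 0"
    proof
      assume 0: "w $ 1 = 0"
      then have "w $ 2 * k = w $ 2 * 0" using eqs(1)[of k] eqs(1)[of 0] by simp
      then show False using wy(1) 0 K by (auto simp: vec2_eq_iff)
    qed
    \<comment> \<open>Otherwise the determinant relation at level 0 would give
      \<open>w $ 1 = 0\<close>.\<close>
    have y1: "y $ 1 \<noteq> 0"
    proof
      assume 0: "y $ 1 = 0"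
      have "w $ 1 = - y $ 2 * c" for c
      proof -
        have "w $ 1 = w $ 1 * (f (pt c) $ 1 $ 1 * f (pt c) $ 2 $ 2 - f (pt c) $ 1 $ 2 * c)"
          using eqs(3)[of c] by simp
        also have "\<dots> = (w $ 1 * f (pt c) $ 1 $ 1 + w $ 2 * c) * f (pt c) $ 2 $ 2
          - (w $ 1 * f (pt c) $ 1 $ 2 + w $ 2 * f (pt c) $ 2 $ 2) * c" by (simp add: algebra_simps)
        also have "\<dots> = - y $ 2 * c" unfolding eqs(1,2) 0 by simp
        finally show ?thesis .
      qed
      from this[of 0] show False using w1 by simp
    qed
    define v' where "v' = (\<chi> i. w $ i / w $ 1)"
    define z' where "z' = (\<chi> i. y $ i / w $ 1)"
    have v'1: "v' $ 1 = 1" and z'1: "z' $ 1 \<noteq> 0" using w1 y1 by (simp_all add: v'_def z'_def)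
    have "row_fiber w y = row_fiber v' z'"
      using w1 unfolding row_fiber_def vec2_eq_iff vec2_mult v'_def z'_def by (simp add: field_simps)
    then have nf: "f (pt c) $ 1 $ 1 = z' $ 1 - v' $ 2 * c"
      "f (pt c) $ 2 $ 2 = 1 / z' $ 1 + z' $ 2 / z' $ 1 * c"
      "f (pt c) $ 1 $ 2 = z' $ 2 - v' $ 2 * f (pt c) $ 2 $ 2" for c
      using fpt[of c] row_fiber_normal_form[OF v'1 z'1, of "f (pt c)"] fptl[of c] by auto
    \<comment> \<open>Level 0 settles \<open>z $ 1\<close>, then level k settles
      \<open>z $ 2\<close>, and level l settles \<open>v $ 2\<close>.\<close>
    have "1 / z' $ 1 = 1 / z $ 1"
      using nf(2)[of 0] inK[OF ptS, of 0] K(1) by (simp add: pt_def)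
    then have e1: "z' $ 1 = z $ 1" by simp
    have "z' $ 2 / z $ 1 * k = z $ 2 / z $ 1 * k"
      using nf(2)[of k] inK[OF ptS, of k] K(2) e1 by (simp add: pt_def)
    then have e2: "z' $ 2 = z $ 2" using K(3) z by simp
    have l0: "l \<noteq> 0" using K by auto
    have "v' $ 2 * l = v $ 2 * l"
      using nf(1)[of l] notK[OF ptS, of l] K(4) e1 by (simp add: pt_def)
    then have e3: "v' $ 2 = v $ 2" using l0 by simp
    have "x = pt (x $ 2 $ 1)"
      using x unfolding row_fiber_normal_form[OF v z] mat2_eq_iff by (simp add: pt_def)
    moreover have "f (pt c) = pt c" for c
      unfolding mat2_eq_iff using nf[of c] fptl[of c] by (simp add: e1 e2 e3 pt_def)
    ultimately show ?thesis by metis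
  qed
  show ?thesis
  proof (cases "x $ 2 $ 1 = 0")
    case False
    show ?thesis
    proof (rule main)
      let ?c = "x $ 2 $ 1"
      \<comment> \<open>The second coordinate is chosen so that \<open>?z $ 1\<close> becomes
        1.\<close>
      let ?v = "vector [1, (1 - x $ 1 $ 1) / ?c] :: 'a ^ 2"
      let ?z = "vector [1, x $ 1 $ 2 + (1 - x $ 1 $ 1) / ?c * x $ 2 $ 2] :: 'a ^ 2"
      show "x \<in> row_fiber ?v ?z"
        using x False by (simp add: row_fiber_def vec2_eq_iff)
      show "?v $ 1 = 1" "?z $ 1 \<noteq> 0" by simp_all
    qed
  next
    case True
    show ?thesis
    proof (rule main)
      show "x \<in> row_fiber (vector [1, 0]) (vector [x $ 1 $ 1, x $ 1 $ 2])"
        using x by (simp add: row_fiber_def vec2_eq_iff)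
      show "vector [x $ 1 $ 1, x $ 1 $ 2] $ (1::2) \<noteq> (0 :: 'a)" using x True by (auto simp: SL2_carrier)
    qed simp
  qed
qed

subsection \<open>Blocks and parallel classes\<close>

lemma mem_r_coset_SL2:
  assumes "h \<in> carrier SL2"
  shows "g \<in> H #>\<^bsub>SL2\<^esub> h \<longleftrightarrow> g ** adj2 h \<in> H"
proof
  assume "g ** adj2 h \<in> H"
  then have "(g ** adj2 h) ** h \<in> (\<lambda>x. x ** h) ` H" by (rule imageI)
  then show "g \<in> H #>\<^bsub>SL2\<^esub> h"
    unfolding r_coset_SL2 adj2_cancel(4)[OF assms] .
qed (use assms in \<open>auto simp: r_coset_SL2\<close>)

section \<open>The affine unital, and its closure as a unital\<close>

locale sl2_unital =
  fixes p e :: nat and S :: "('a::{field,finite}) mat2 set" and \<D> :: "'a mat2 set set"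
    and \<pi> :: "'a mat2 set set set"
  assumes prime_p: "Factorial_Ring.prime p" and e_pos: "e > 0" and card_field: "CARD('a) = p ^ e"
    and SL2_unital: "SL2_unital p S \<D> \<pi>"
begin

abbreviation "Pts \<equiv> unital_points \<pi>"
abbreviation "Blks \<equiv> unital_blocks S \<D> \<pi>"

lemma card_field_ge_2: "CARD('a) \<ge> 2"
  using card_mono[of "UNIV :: 'a set" "{0,1}"] by simp

lemma sylow_iff: "P \<in> sylow_subgroups p (SL2 :: 'a mat2 monoid) \<longleftrightarrow> (\<exists>v. v \<noteq> 0 \<and> P = rstab v)"
  unfolding sylow_subgroups_SL2[OF prime_p card_field e_pos] by auto

lemma short_iff: "Y \<in> short_blocks p \<longleftrightarrow> (\<exists>v z :: 'a ^ 2. v \<noteq> 0 \<and> z \<noteq> 0 \<and> Y = row_fiber v z)"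
  unfolding short_blocks_eq[OF prime_p card_field e_pos] by auto

lemma short_subset: "Y \<in> short_blocks p \<Longrightarrow> Y \<subseteq> carrier (SL2 :: 'a mat2 monoid)"
  by (auto simp: short_iff row_fiber_def)

lemma card_short: "Y \<in> short_blocks p \<Longrightarrow> card (Y :: 'a mat2 set) = CARD('a)"
  by (auto simp: short_iff card_row_fiber)

lemma subgroup_S: "subgroup S SL2" and card_S: "card S = CARD('a) + 1"
  using SL2_unital by (auto simp: SL2_unital_def affine_unital_data_def)

lemma S_subset: "S \<subseteq> carrier SL2"
  using subgroup_S subgroup.subset by blast

lemma S_one [simp]: "mat 1 \<in> S"
  using subgroup.one_closed[OF subgroup_S] by simp

lemma S_mult: "s \<in> S \<Longrightarrow> t \<in> S \<Longrightarrow> s ** t \<in> S"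
  using subgroup.m_closed[OF subgroup_S] by simp

lemma S_inv:
  assumes "s \<in> S"
  shows "adj2 s \<in> S"
  using subgroup.m_inv_closed[OF subgroup_S assms] inv_SL2[of s] S_subset assms by auto

lemma D_subset: "D \<in> \<D> \<Longrightarrow> D \<subseteq> carrier SL2" and card_D: "D \<in> \<D> \<Longrightarrow> card D = CARD('a) + 1"
  and D_one: "D \<in> \<D> \<Longrightarrow> mat 1 \<in> D"
  and card_quotient_set: "D \<in> \<D> \<Longrightarrow> card (quotient_set D) = CARD('a) * (CARD('a) + 1)"
  and inj_quotient_set: "inj_on quotient_set \<D>"
  using SL2_unital by (auto simp: SL2_unital_def affine_unital_data_def)

lemma affine_partition: "partition_on (carrier SL2 - {mat 1})
    ({S - {mat 1}} \<union> {P - {mat 1} | P. P \<in> sylow_subgroups p SL2} \<union> quotient_set ` \<D>)"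
  using SL2_unital by (auto simp: SL2_unital_def affine_unital_data_def)

lemma par_partition: "partition_on (short_blocks p) \<pi>" and card_par: "card \<pi> = CARD('a) + 1"
  and card_class: "C \<in> \<pi> \<Longrightarrow> card C = (CARD('a))\<^sup>2 - 1" and disjoint_class: "C \<in> \<pi> \<Longrightarrow> disjoint C"
  using SL2_unital by (auto simp: SL2_unital_def parallelism_def)

lemma class_short: "C \<in> \<pi> \<Longrightarrow> Y \<in> C \<Longrightarrow> Y \<in> short_blocks p"
  using partition_onD1[OF par_partition] by auto

lemma class_unique: "C \<in> \<pi> \<Longrightarrow> C' \<in> \<pi> \<Longrightarrow> Y \<in> C \<Longrightarrow> Y \<in> C' \<Longrightarrow> C = C'"
  using partition_onD2[OF par_partition] by (meson disjnt_iff pairwiseD)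

lemma short_class: "Y \<in> short_blocks p \<Longrightarrow> \<exists>C\<in>\<pi>. Y \<in> C"
  using partition_onD1[OF par_partition] by auto

text \<open>Condition (Q) as a count: the q(q+1) ordered pairs of distinct elements have as many
  quotients, so no quotient arises twice.\<close>

lemma D_quotient_inj:
  assumes D: "D \<in> \<D>" and "x \<in> D" "y \<in> D" "x \<noteq> y" "x' \<in> D" "y' \<in> D" "x' \<noteq> y'" "x ** adj2 y = x' ** adj2 y'"
  shows "x = x'" "y = y'"
proof -
  let ?A = "D \<times> D - (\<lambda>x. (x, x)) ` D"
  have sub: "D \<subseteq> carrier SL2" using D_subset[OF D] .
  have "quotient_set D = (\<lambda>(x,y). x ** adj2 y) ` ?A"
  proof -
    have inv: "inv\<^bsub>SL2\<^esub> y = adj2 y" if "y \<in> D" for y using that sub inv_SL2 by blast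
    show ?thesis
    proof (intro equalityI subsetI)
      fix z assume "z \<in> quotient_set D"
      then obtain x y where "x \<in> D" "y \<in> D" "x \<noteq> y" "z = x ** adj2 y"
        using inv by (auto simp: quotient_set_def)
      then show "z \<in> (\<lambda>(x,y). x ** adj2 y) ` ?A" by (intro image_eqI[of _ _ "(x, y)"]) auto
    next
      fix z assume "z \<in> (\<lambda>(x,y). x ** adj2 y) ` ?A"
      then obtain x y where "x \<in> D" "y \<in> D" "x \<noteq> y" "z = x ** adj2 y" by auto
      then show "z \<in> quotient_set D" using inv by (force simp: quotient_set_def)
    qed
  qed
  then have "card ((\<lambda>(x,y). x ** adj2 y) ` ?A) = CARD('a) * (CARD('a) + 1)"
    using card_quotient_set[OF D] by simp
  moreover have "card ?A = CARD('a) * (CARD('a) + 1)"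
  proof -
    have "card ?A = card (D \<times> D) - card ((\<lambda>x. (x, x)) ` D)"
      by (rule card_Diff_subset) auto
    also have "card ((\<lambda>x. (x, x)) ` D) = card D" by (rule card_image) (auto simp: inj_on_def)
    finally show ?thesis using card_D[OF D] by (simp add: card_cartesian_product algebra_simps)
  qed
  ultimately have "inj_on (\<lambda>(x,y). x ** adj2 y) ?A"
    by (intro eq_card_imp_inj_on) auto
  moreover have "(x, y) \<in> ?A" "(x', y') \<in> ?A" using assms by auto
  ultimately have "(x, y) = (x', y')" using assms(8) by (metis (no_types, lifting) case_prod_conv inj_onD)
  then show "x = x'" "y = y'" by auto
qed

text \<open>The quotient g h^-1 reveals the type of a block through g and h. The block is then
  recovered from h and, for \<open>D\<close>, from the pair representing the quotient.\<close>

lemma affine_block_cases: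
  assumes W: "W \<in> long_blocks S \<D> \<union> short_blocks p" and gh: "g \<in> W" "h \<in> W" "g \<noteq> h"
  obtains (S) "g ** adj2 h \<in> S - {mat 1}" "W = S #>\<^bsub>SL2\<^esub> h"
  | (P) P where "P \<in> sylow_subgroups p SL2" "g ** adj2 h \<in> P - {mat 1}" "W = P #>\<^bsub>SL2\<^esub> h"
  | (D) D x y where "D \<in> \<D>" "x \<in> D" "y \<in> D" "x \<noteq> y" "g ** adj2 h = x ** adj2 y"
      "g ** adj2 h \<in> quotient_set D" "W = D #>\<^bsub>SL2\<^esub> (adj2 y ** h)"
proof -
  have coset: "g ** adj2 h \<in> H - {mat 1}" "H #>\<^bsub>SL2\<^esub> k = H #>\<^bsub>SL2\<^esub> h"
    if H: "subgroup H SL2" and k: "k \<in> carrier SL2" and "g \<in> H #>\<^bsub>SL2\<^esub> k" "h \<in> H #>\<^bsub>SL2\<^esub> k" for H k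
  proof -
    show eq: "H #>\<^bsub>SL2\<^esub> k = H #>\<^bsub>SL2\<^esub> h"
      using SL2.repr_independence[OF that(4) k H] .
    have hS: "h \<in> carrier SL2" using that(4) subgroup.subset[OF H] k by (auto simp: r_coset_SL2)
    have "g \<in> (\<lambda>x. x ** h) ` H" using that(3) eq by (simp add: r_coset_SL2)
    then obtain x where "x \<in> H" "g = x ** h" by blast
    then show "g ** adj2 h \<in> H - {mat 1}" using hS gh(3) by auto
  qed
  from W consider k where "k \<in> carrier SL2" "W = S #>\<^bsub>SL2\<^esub> k"
    | P k where "k \<in> carrier SL2" "P \<in> sylow_subgroups p SL2" "W = P #>\<^bsub>SL2\<^esub> k"
    | D k where "k \<in> carrier SL2" "D \<in> \<D>" "W = D #>\<^bsub>SL2\<^esub> k"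
    by (auto simp: long_blocks_def short_blocks_def)
  then show thesis
  proof cases
    case 1
    then show thesis using S coset[OF subgroup_S 1(1)] gh by auto
  next
    case 2
    then have "subgroup P SL2" by (auto simp: sylow_iff subgroup_rstab)
    then show thesis using P[OF 2(2)] coset[of P k] 2 gh by auto
  next
    case 3
    then obtain x y where xy: "x \<in> D" "y \<in> D" "g = x ** k" "h = y ** k" using gh by (auto simp: r_coset_SL2)
    have y: "y \<in> carrier SL2" "x \<in> carrier SL2" using D_subset[OF 3(2)] xy by auto
    have "adj2 y ** h = k" using xy y by simp
    moreover have q: "g ** adj2 h = x ** adj2 y"
      using xy y 3(1) by (simp add: adj2_mult matrix_mul_assoc)
    moreover have "g ** adj2 h \<in> quotient_set D"
    proof -
      have "g ** adj2 h = x \<otimes>\<^bsub>SL2\<^esub> inv\<^bsub>SL2\<^esub> y" using q inv_SL2[OF y(1)] by simp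
      moreover have "x \<noteq> y" using xy gh by auto
      ultimately show ?thesis unfolding quotient_set_def using xy by blast
    qed
    ultimately show thesis using D[OF 3(2) xy(1,2)] xy gh 3(3) by auto
  qed
qed

lemma family_unique:
  assumes "M \<in> {S - {mat 1}} \<union> {P - {mat 1} | P. P \<in> sylow_subgroups p SL2} \<union> quotient_set ` \<D>"
    and "M' \<in> {S - {mat 1}} \<union> {P - {mat 1} | P. P \<in> sylow_subgroups p SL2} \<union> quotient_set ` \<D>"
    and "x \<in> M" "x \<in> M'"
  shows "M = M'"
  using partition_onD2[OF affine_partition] assms by (meson disjnt_iff pairwiseD)

lemma card_sylow: "P \<in> sylow_subgroups p (SL2 :: 'a mat2 monoid) \<Longrightarrow> card P = CARD('a)"
  by (auto simp: sylow_iff card_rstab)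

lemma sylow_one: "P \<in> sylow_subgroups p (SL2 :: 'a mat2 monoid) \<Longrightarrow> mat 1 \<in> P"
  by (auto simp: sylow_iff rstab_def)

lemma sylow_unique:
  assumes "P \<in> sylow_subgroups p SL2" "Q \<in> sylow_subgroups p SL2" "x \<in> P" "x \<in> Q" "x \<noteq> (mat 1 :: 'a mat2)"
  shows "P = Q"
proof -
  have "P - {mat 1} = Q - {mat 1}" by (rule family_unique[of _ _ x]) (use assms in auto)
  then show ?thesis using sylow_one[OF assms(1)] sylow_one[OF assms(2)] by blast
qed

text \<open>Overlapping members of the partition coincide, but here their sizes would be q - 1 and
  q.\<close>

lemma S_inter_sylow:
  assumes "P \<in> sylow_subgroups p SL2" "x \<in> P" "x \<in> S"
  shows "x = mat 1"
proof (rule ccontr)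
  assume "x \<noteq> mat 1"
  then have "P - {mat 1} = S - {mat 1}" by (intro family_unique[of _ _ x]) (use assms in auto)
  then have "card (P - {mat 1}) = card (S - {mat 1})" by simp
  then show False using card_sylow[OF assms(1)] sylow_one[OF assms(1)] card_S card_field_ge_2 by simp
qed

lemma quotient_set_S: "D \<in> \<D> \<Longrightarrow> quotient_set D \<inter> S \<subseteq> {mat 1}"
proof (rule ccontr)
  assume D: "D \<in> \<D>" and "\<not> quotient_set D \<inter> S \<subseteq> {mat 1}"
  then obtain x where "x \<in> quotient_set D" "x \<in> S - {mat 1}" by blast
  then have "quotient_set D = S - {mat 1}" by (intro family_unique[of _ _ x]) (use D in auto)
  then have "card (quotient_set D) = card (S - {mat 1})" by simp
  then show False using card_quotient_set[OF D] card_S card_field_ge_2 by simp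
qed

lemma quotient_set_sylow:
  "D \<in> \<D> \<Longrightarrow> P \<in> sylow_subgroups p SL2 \<Longrightarrow> quotient_set D \<inter> P \<subseteq> {mat 1}"
proof (rule ccontr)
  assume D: "D \<in> \<D>" and P: "P \<in> sylow_subgroups p SL2" and "\<not> quotient_set D \<inter> P \<subseteq> {mat 1}"
  then obtain x where "x \<in> quotient_set D" "x \<in> P - {mat 1}" by blast
  then have "quotient_set D = P - {mat 1}" by (intro family_unique[of _ _ x]) (use D P in auto)
  then have "card (quotient_set D) = card (P - {mat 1})" by simp
  then have "CARD('a) * (CARD('a) + 1) = CARD('a) - 1"
    using card_quotient_set[OF D] card_sylow[OF P] sylow_one[OF P] by simp
  moreover have "CARD('a) - 1 < CARD('a) * (CARD('a) + 1)" using card_field_ge_2 by simp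
  ultimately show False by simp
qed

text \<open>The quotient of g and h lies in one member of the partition, which fixes the type of the
  block; for a given \<open>D\<close>, injectivity of quotients does the rest.\<close>

lemma affine_block_unique:
  assumes W: "W \<in> long_blocks S \<D> \<union> short_blocks p" and Y: "Y \<in> long_blocks S \<D> \<union> short_blocks p"
    and gh: "g \<in> W" "h \<in> W" "g \<in> Y" "h \<in> Y" "g \<noteq> h"
  shows "W = Y"
proof (cases rule: affine_block_cases[OF W gh(1,2,5)])
  case 1: 1
  show ?thesis
  proof (cases rule: affine_block_cases[OF Y gh(3,4,5)])
    case 1 with \<open>W = S #>\<^bsub>SL2\<^esub> h\<close> show ?thesis by simp
  next
    case (2 P) then show ?thesis using 1 S_inter_sylow by auto
  next
    case (3 D x y) then show ?thesis using 1 quotient_set_S by blast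
  qed
next
  case P: (2 P)
  show ?thesis
  proof (cases rule: affine_block_cases[OF Y gh(3,4,5)])
    case 1 then show ?thesis using P S_inter_sylow by auto
  next
    case (2 Q) then show ?thesis using P sylow_unique by auto
  next
    case (3 D x y) then show ?thesis using P quotient_set_sylow by blast
  qed
next
  case D: (3 D x y)
  show ?thesis
  proof (cases rule: affine_block_cases[OF Y gh(3,4,5)])
    case 1 then show ?thesis using D quotient_set_S by blast
  next
    case (2 P) then show ?thesis using D quotient_set_sylow by blast
  next
    case (3 D' x' y')
    have "quotient_set D = quotient_set D'"
      by (rule family_unique[of _ _ "g ** adj2 h"]) (use D 3 in auto)
    then have "D = D'" using inj_quotient_set D(1) 3(1) by (auto dest: inj_onD)
    then show ?thesis using D_quotient_inj[of D x y x' y'] D 3 by metis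
  qed
qed

lemma affine_block_ex:
  assumes "g \<in> carrier SL2" "h \<in> carrier SL2" "g \<noteq> h"
  shows "\<exists>W \<in> long_blocks S \<D> \<union> short_blocks p. g \<in> W \<and> h \<in> W"
proof -
  have "g ** adj2 h \<noteq> mat 1" using assms by (metis adj2_cancel(4) matrix_mul_lid)
  then have "g ** adj2 h \<in> carrier SL2 - {mat 1}" using assms by auto
  then have "g ** adj2 h \<in> \<Union>({S - {mat 1}} \<union> {P - {mat 1} | P. P \<in> sylow_subgroups p SL2} \<union> quotient_set ` \<D>)"
    using partition_onD1[OF affine_partition] by simp
  then consider "g ** adj2 h \<in> S" | P where "P \<in> sylow_subgroups p SL2" "g ** adj2 h \<in> P"
    | D where "D \<in> \<D>" "g ** adj2 h \<in> quotient_set D" by blast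
  then show ?thesis
  proof cases
    case 1
    then have "g \<in> S #>\<^bsub>SL2\<^esub> h" "h \<in> S #>\<^bsub>SL2\<^esub> h" 
      using assms S_one by (auto simp: mem_r_coset_SL2)
    then show ?thesis using assms by (auto simp: long_blocks_def)
  next
    case 2
    then have "g \<in> P #>\<^bsub>SL2\<^esub> h" "h \<in> P #>\<^bsub>SL2\<^esub> h" 
      using assms sylow_one by (auto simp: mem_r_coset_SL2)
    then show ?thesis using assms 2 by (auto simp: short_blocks_def)
  next
    case 3
    then obtain x y where xy: "x \<in> D" "y \<in> D" "g ** adj2 h = x \<otimes>\<^bsub>SL2\<^esub> inv\<^bsub>SL2\<^esub> y"
      by (auto simp: quotient_set_def)
    then have xy: "x \<in> D" "y \<in> D" "g ** adj2 h = x ** adj2 y"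
      using D_subset[OF 3(1)] inv_SL2[of y] by auto
    have c: "x \<in> carrier SL2" "y \<in> carrier SL2" using xy D_subset[OF 3(1)] by auto
    have "g = x ** (adj2 y ** h)" using xy(3) assms by (metis adj2_cancel(4) matrix_mul_assoc)
    moreover have "h = y ** (adj2 y ** h)" using c by simp
    ultimately have "g \<in> D #>\<^bsub>SL2\<^esub> (adj2 y ** h)" "h \<in> D #>\<^bsub>SL2\<^esub> (adj2 y ** h)"
      unfolding r_coset_SL2 using xy by blast+
    moreover have "D #>\<^bsub>SL2\<^esub> (adj2 y ** h) \<in> long_blocks S \<D>"
      unfolding long_blocks_def using 3(1) SL2_closed[OF adj2_in_SL2[OF c(2)] assms(2)] by blast
    ultimately show ?thesis by blast
  qed
qed

text \<open>A class consists of q^2 - 1 disjoint blocks of size q, and SL(2,q) has q(q^2 - 1)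
  elements.\<close>

lemma class_covers:
  assumes "C \<in> \<pi>" "g \<in> carrier SL2"
  shows "\<exists>Y\<in>C. g \<in> Y"
proof -
  have "card (\<Union>C) = (\<Sum>Y\<in>C. card Y)"
    by (rule card_Union_disjoint) (use disjoint_class[OF assms(1)] in \<open>auto simp: disjoint_def pairwise_def disjnt_def\<close>)
  also have "\<dots> = (\<Sum>Y\<in>C. CARD('a))" using card_short class_short[OF assms(1)] by (intro sum.cong) auto
  also have "\<dots> = card (carrier (SL2 :: 'a mat2 monoid))"
    using card_class[OF assms(1)] by (simp add: card_SL2)
  finally have "\<Union>C = carrier SL2"
    using short_subset class_short[OF assms(1)] by (intro card_subset_eq) auto
  then show ?thesis using assms by blast
qed

lemma long_subset: "W \<in> long_blocks S \<D> \<Longrightarrow> W \<subseteq> carrier SL2"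
  unfolding long_blocks_def using SL2.r_coset_subset_G[OF S_subset] SL2.r_coset_subset_G[OF D_subset] by blast

lemma card_r_coset:
  assumes "g \<in> carrier SL2"
  shows "card (H #>\<^bsub>SL2\<^esub> g) = card (H :: 'a mat2 set)"
  unfolding r_coset_SL2 by (rule card_image) (auto intro!: inj_onI simp: mult_eq_iff_right[OF assms] assms)

lemma card_long: "W \<in> long_blocks S \<D> \<Longrightarrow> card W = CARD('a) + 1"
  using card_S card_D card_r_coset by (auto simp: long_blocks_def)

lemma block_cases:
  assumes "B \<in> Blks"
  obtains (long) W where "W \<in> long_blocks S \<D>" "B = Aff ` W"
  | (short) C Y where "C \<in> \<pi>" "Y \<in> C" "B = insert (Inf_pt C) (Aff ` Y)"
  | (infinity) "B = infinity_block \<pi>"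
  using assms by (auto simp: unital_blocks_def)

lemma finite_par: "finite \<pi>"
  using card_par card_ge_0_finite by fastforce

lemma card_infinity_block: "card (infinity_block \<pi>) = CARD('a) + 1"
  unfolding infinity_block_def using card_par by (simp add: card_image inj_on_def)

lemma long_block_mem: "W \<in> long_blocks S \<D> \<Longrightarrow> Aff ` W \<in> Blks"
  unfolding unital_blocks_def by (intro UnI1 CollectI exI[of _ W]) simp

lemma short_block_mem: "C \<in> \<pi> \<Longrightarrow> Y \<in> C \<Longrightarrow> insert (Inf_pt C) (Aff ` Y) \<in> Blks"
  unfolding unital_blocks_def by (intro UnI1[OF UnI2] CollectI exI[of _ C] exI[of _ Y]) simp

lemma infinity_block_mem: "infinity_block \<pi> \<in> Blks"
  by (simp add: unital_blocks_def)

text \<open>Pairs of affine points are handled by the partition condition, mixed pairs by the fact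
  that a class covers the group without overlap, and pairs at infinity by [\<infinity>].\<close>

sublocale unital Pts Blks "CARD('a)"
proof
  show "finite Pts" using finite_par by (simp add: unital_points_def infinity_block_def)
  have "card Pts = card (Aff ` carrier (SL2 :: 'a mat2 monoid)) + card (infinity_block \<pi>)"
    unfolding unital_points_def
    by (rule card_Un_disjoint) (use finite_par in \<open>auto simp: infinity_block_def\<close>)
  also have "\<dots> = CARD('a) * ((CARD('a))\<^sup>2 - 1) + CARD('a) + 1"
    by (simp add: card_infinity_block card_image inj_on_def card_SL2)
  also have "\<dots> = CARD('a) ^ 3 + 1"
    using card_field_ge_2 by (simp add: power2_eq_square power3_eq_cube algebra_simps)
  finally show "card Pts = CARD('a) ^ 3 + 1" .
  show "CARD('a) \<ge> 2" by (rule card_field_ge_2)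
  show "B \<subseteq> Pts" if "B \<in> Blks" for B
    using that
  proof (cases rule: block_cases)
    case (long W) then show ?thesis using long_subset by (auto simp: unital_points_def)
  next
    case (short C Y) then show ?thesis using short_subset[OF class_short]
      by (auto simp: unital_points_def infinity_block_def)
  qed (simp add: unital_points_def)
  show "card B = CARD('a) + 1" if "B \<in> Blks" for B
    using that
  proof (cases rule: block_cases)
    case (long W) then show ?thesis using card_long by (simp add: card_image inj_on_def)
  next
    case (short C Y) 
    have "card (insert (Inf_pt C) (Aff ` Y)) = Suc (card (Aff ` Y))" by (rule card_insert_disjoint) auto
    then show ?thesis using short card_short[OF class_short] by (simp add: card_image inj_on_def)
  qed (simp add: card_infinity_block)
  show "\<exists>B\<in>Blks. x \<in> B \<and> y \<in> B" if xy: "x \<in> Pts" "y \<in> Pts" "x \<noteq> y" for x y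
  proof -
    have mixed: "\<exists>B\<in>Blks. Aff g \<in> B \<and> Inf_pt C \<in> B" if gC: "g \<in> carrier SL2" "C \<in> \<pi>" for g C
    proof -
      obtain Y where "Y \<in> C" "g \<in> Y" using class_covers[OF gC(2,1)] by blast
      then show ?thesis by (intro bexI[OF _ short_block_mem[OF gC(2)]]) auto
    qed
    show ?thesis
    proof (cases x; cases y)
      fix g h assume gh: "x = Aff g" "y = Aff h"
      then have g: "g \<in> carrier SL2" "h \<in> carrier SL2" "g \<noteq> h" using xy
        by (auto simp: unital_points_def infinity_block_def)
      obtain W where W: "W \<in> long_blocks S \<D> \<union> short_blocks p" "g \<in> W" "h \<in> W"
        using affine_block_ex[OF g] by blast
      show ?thesis
      proof (cases "W \<in> long_blocks S \<D>")
        case True then show ?thesis using W gh by (intro bexI[OF _ long_block_mem[OF True]]) auto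
      next
        case False
        then obtain C where "C \<in> \<pi>" "W \<in> C" using W short_class by blast
        then have "insert (Inf_pt C) (Aff ` W) \<in> Blks" by (rule short_block_mem)
        then show ?thesis using W gh by (intro bexI[of _ "insert (Inf_pt C) (Aff ` W)"]) auto
      qed
    next
      fix g C assume gh: "x = Aff g" "y = Inf_pt C"
      then show ?thesis using mixed[of g C] xy by (auto simp: unital_points_def infinity_block_def)
    next
      fix g C assume gh: "x = Inf_pt C" "y = Aff g"
      then show ?thesis using mixed[of g C] xy by (auto simp: unital_points_def infinity_block_def)
    next
      fix C C' assume "x = Inf_pt C" "y = Inf_pt C'"
      then show ?thesis using xy 
        by (intro bexI[OF _ infinity_block_mem]) (auto simp: unital_points_def infinity_block_def)
    qed
  qed
  show "B = B'" if B: "B \<in> Blks" "B' \<in> Blks" and xy: "x \<in> B" "y \<in> B" "x \<in> B'" "y \<in> B'" "x \<noteq> y" for B B' x y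
  proof -
    have mixed: "\<exists>Y\<in>C. g \<in> Y \<and> B = insert (Inf_pt C) (Aff ` Y) \<and> C \<in> \<pi>"
      if "Aff g \<in> B" "Inf_pt C \<in> B" "B \<in> Blks" for g C B
      using that(3) by (cases rule: block_cases) (use that in \<open>auto simp: infinity_block_def\<close>)
    have mixed': "B = B'" if pts: "Aff g \<in> B" "Inf_pt C \<in> B" "Aff g \<in> B'" "Inf_pt C \<in> B'" for g C
    proof -
      obtain Y Y' where "Y \<in> C" "g \<in> Y" "B = insert (Inf_pt C) (Aff ` Y)" "C \<in> \<pi>"
         "Y' \<in> C" "g \<in> Y'" "B' = insert (Inf_pt C) (Aff ` Y')"
        using mixed[of g B C] mixed[of g B' C] pts B by blast
      moreover from this have "Y = Y'" using disjoint_class[of C] unfolding disjoint_def by blast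
      ultimately show ?thesis by simp
    qed
    have inf: "B = infinity_block \<pi>" if "Inf_pt C \<in> B" "Inf_pt C' \<in> B" "C \<noteq> C'" "B \<in> Blks" for C C' B
      using that(4) by (cases rule: block_cases) (use that in auto)
    have aff: "\<exists>W \<in> long_blocks S \<D> \<union> short_blocks p. g \<in> W \<and> h \<in> W \<and>
        (W \<in> long_blocks S \<D> \<and> B = Aff ` W \<or> (\<exists>C\<in>\<pi>. W \<in> C \<and> B = insert (Inf_pt C) (Aff ` W)))"
      if "Aff g \<in> B" "Aff h \<in> B" "B \<in> Blks" for g h B
      using that(3)
    proof (cases rule: block_cases)
      case (short C Y)
      then show ?thesis using that class_short by blast
    qed (use that in \<open>auto simp: infinity_block_def\<close>)
    show ?thesis
    proof (cases x; cases y)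
      fix g h assume gh: "x = Aff g" "y = Aff h"
      obtain W W' where W: "W \<in> long_blocks S \<D> \<union> short_blocks p" "g \<in> W" "h \<in> W"
         "W \<in> long_blocks S \<D> \<and> B = Aff ` W \<or> (\<exists>C\<in>\<pi>. W \<in> C \<and> B = insert (Inf_pt C) (Aff ` W))"
        and W': "W' \<in> long_blocks S \<D> \<union> short_blocks p" "g \<in> W'" "h \<in> W'"
         "W' \<in> long_blocks S \<D> \<and> B' = Aff ` W' \<or> (\<exists>C\<in>\<pi>. W' \<in> C \<and> B' = insert (Inf_pt C) (Aff ` W'))"
        using aff[of g B h] aff[of g B' h] gh xy B by metis
      have eq: "W = W'" using affine_block_unique[OF W(1) W'(1) W(2,3) W'(2,3)] gh xy by auto
      \<comment> \<open>The sizes q + 1 and q separate long blocks from short ones.\<close>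
      have "\<not> (W \<in> long_blocks S \<D> \<and> C \<in> \<pi> \<and> W \<in> C)" for C
        using card_long card_short class_short by fastforce
      then show ?thesis using W(4) W'(4) eq class_unique by metis
    next
      fix g C assume "x = Aff g" "y = Inf_pt C"
      then show ?thesis using mixed'[of g C] xy by auto
    next
      fix g C assume "x = Inf_pt C" "y = Aff g"
      then show ?thesis using mixed'[of g C] xy by auto
    next
      fix C C' assume "x = Inf_pt C" "y = Inf_pt C'"
      then show ?thesis using inf[of C B C'] inf[of C B' C'] xy B by auto
    qed
  qed
qed

end

subsection \<open>Squares and subfields\<close>

text \<open>Multiplication by \<open>x\<close> permutes \<open>K\<close>; compare the products over
  \<open>K\<close>.\<close>

lemma power_card_mult_closed:
  fixes K :: "'a::field set"
  assumes fin: "finite K" and "0 \<notin> K" and cl: "\<And>x y. x \<in> K \<Longrightarrow> y \<in> K \<Longrightarrow> x * y \<in> K" and x: "x \<in> K"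
  shows "x ^ card K = 1"
proof -
  have inj: "inj_on ((*) x) K" using assms by (auto intro!: inj_onI)
  have "(*) x ` K = K"
    by (rule card_subset_eq[OF fin]) (use cl x inj in \<open>auto simp: card_image\<close>)
  then have "prod id K = prod id ((*) x ` K)" by simp
  also have "\<dots> = (\<Prod>y\<in>K. x * y)" using inj by (simp add: prod.reindex)
  also have "\<dots> = x ^ card K * prod id K" by (simp add: prod.distrib)
  finally have "x ^ card K * prod id K = 1 * prod id K" by simp
  moreover have "prod id K \<noteq> 0" using assms by (metis fin id_apply prod_zero_iff)
  ultimately show ?thesis by (metis mult_right_cancel)
qed

text \<open>If squaring were onto, it would be injective and 1 = -1; then adding 1 would be an
  involution without fixed points on a set of odd size.\<close>

lemma exists_nonsquare:
  assumes "odd (CARD('a::{field,finite}))"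
  shows "\<exists>l :: 'a. \<forall>y. l \<noteq> y\<^sup>2"
proof (rule ccontr)
  assume "\<not> ?thesis"
  then have "surj (\<lambda>y :: 'a. y\<^sup>2)" by (metis surjI surj_def)
  then have inj: "inj (\<lambda>y :: 'a. y\<^sup>2)" by (simp add: finite_UNIV_surj_inj)
  have "(1 :: 'a) = - 1" by (rule injD[OF inj]) simp
  then have two: "(1 :: 'a) + 1 = 0" by (metis add.right_inverse)
  have "card (UNIV :: 'a set) mod 2 = card {x \<in> UNIV :: 'a set. x + 1 = x} mod 2"
    by (rule card_fixed_points_prime_order) (use two in \<open>auto simp: eval_nat_numeral add.assoc two_is_prime_nat[unfolded numeral_2_eq_2]\<close>)
  then show False using assms by (simp add: odd_iff_mod_2_eq_one)
qed

text \<open>Adding 1 has no fixed points and its order is the characteristic, which therefore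
  divides the number of elements.\<close>

lemma CHAR_eq_prime:
  assumes "Factorial_Ring.prime (p::nat)" "CARD('a::{field,finite}) = p ^ e"
  shows "CHAR('a) = p"
proof -
  have prime: "Factorial_Ring.prime (CHAR('a))"
    by (rule prime_CHAR_semidom) (simp add: finite_imp_CHAR_pos)
  have "((\<lambda>x. x + 1) ^^ n) x = x + of_nat n" for n and x :: 'a
    by (induction n) (auto simp: algebra_simps)
  then have "card (UNIV :: 'a set) mod CHAR('a) = card {x \<in> UNIV :: 'a set. x + 1 = x} mod CHAR('a)"
    by (intro card_fixed_points_prime_order[OF prime]) auto
  then have "CHAR('a) dvd p ^ e" using assms by (simp add: mod_eq_0_iff_dvd)
  then show ?thesis using assms prime by (metis prime_dvd_power primes_dvd_imp_eq)
qed

lemma subfield_of_type: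
  fixes L :: "'a::field set"
  assumes "0 \<in> L" "1 \<in> L" "\<And>x y. x \<in> L \<Longrightarrow> y \<in> L \<Longrightarrow> x + y \<in> L" "\<And>x. x \<in> L \<Longrightarrow> - x \<in> L"
    "\<And>x y. x \<in> L \<Longrightarrow> y \<in> L \<Longrightarrow> x * y \<in> L" "\<And>x. x \<in> L \<Longrightarrow> inverse x \<in> L"
  shows "subfield L ring_of_type_algebra"
proof -
  interpret F: Ring.field "ring_of_type_algebra :: 'a ring" by (rule field_from_type_algebra)
  have neg: "\<ominus>\<^bsub>ring_of_type_algebra\<^esub> x = - x" for x :: 'a
    by (rule F.minus_equality) (auto simp: ring_of_type_algebra_def)
  have inv: "inv\<^bsub>ring_of_type_algebra\<^esub> x = inverse x" if "x \<noteq> 0" for x :: 'a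
    by (rule F.comm_inv_char) (use that in \<open>auto simp: ring_of_type_algebra_def\<close>)
  show ?thesis
  proof (rule F.subfieldI')
    show "subring L ring_of_type_algebra"
      by (rule F.subringI) (use assms neg in \<open>auto simp: ring_of_type_algebra_def\<close>)
    fix x assume "x \<in> L - {\<zero>\<^bsub>ring_of_type_algebra\<^esub>}"
    then show "inv\<^bsub>ring_of_type_algebra\<^esub> x \<in> L" 
      using assms inv by (auto simp: ring_of_type_algebra_def)
  qed
qed

lemma subfield_card_power:
  fixes K :: "'a::field set"
  assumes K: "subfield K ring_of_type_algebra" "finite K" and x: "x \<in> K"
  shows "x ^ card K = x"
proof (cases "x = 0")
  case True
  then show ?thesis using x K(2) by (auto simp: card_gt_0_iff power_0_left)
next
  case False
  interpret K: subfield K "ring_of_type_algebra :: 'a ring" by fact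
  have 0: "0 \<in> K" using subringE(2)[OF subfieldE(1)[OF K(1)]] by (simp add: ring_of_type_algebra_def)
  have "x ^ card (K - {0}) = 1"
    by (rule power_card_mult_closed)
      (use x False K(2) subringE(6)[OF subfieldE(1)[OF K(1)]] in \<open>auto simp: ring_of_type_algebra_def\<close>)
  moreover have "card K = Suc (card (K - {0}))" using card_Suc_Diff1[OF K(2) 0] by simp
  ultimately show ?thesis by simp
qed

text \<open>At most r because X^r - X has degree r. At least r because the norm x^(r+1) maps the r^2
  - 1 units, with fibers of size at most r + 1, to non-zero solutions.\<close>

lemma card_power_fixed:
  assumes q: "CARD('a::{field,finite}) = r\<^sup>2" and r: "r \<ge> 2"
  shows "card {x :: 'a. x ^ r = x} = r"
proof (rule antisym)
  let ?p = "Polynomial.monom 1 r + [:0, - 1:] :: 'a poly"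
  have deg: "Polynomial.degree ?p = r" using r by (subst degree_add_eq_left) (auto simp: degree_monom_eq)
  then have "?p \<noteq> 0" using r by auto
  then have "card {x. poly ?p x = 0} \<le> Polynomial.degree ?p" by (intro card_poly_roots_bound) auto
  then show "card {x :: 'a. x ^ r = x} \<le> r" using deg by (simp add: poly_monom)
next
  let ?N = "\<lambda>x :: 'a. x ^ (r + 1)"
  let ?E = "UNIV - {0 :: 'a}"
  have E: "card ?E = r\<^sup>2 - 1" using q by (simp add: card_Diff_singleton)
  have sq: "r\<^sup>2 - 1 = (r + 1) * (r - 1)" using r by (simp add: power2_eq_square algebra_simps)
  have fib: "card {x \<in> ?E. ?N x = y} \<le> r + 1" for y
  proof -
    let ?p = "Polynomial.monom 1 (r + 1) + [:- y:] :: 'a poly"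
    have deg: "Polynomial.degree ?p = r + 1" by (subst degree_add_eq_left) (auto simp: degree_monom_eq)
    then have "?p \<noteq> 0" by auto
    then have "card {x. poly ?p x = 0} \<le> r + 1" using deg card_poly_roots_bound[of ?p] by simp
    moreover have "card {x \<in> ?E. ?N x = y} \<le> card {x. poly ?p x = 0}"
      by (rule card_mono) (auto simp: poly_monom)
    ultimately show ?thesis by simp
  qed
  have "?E = (\<Union>y\<in>?N ` ?E. {x \<in> ?E. ?N x = y})" by auto
  then have "card ?E \<le> (\<Sum>y\<in>?N ` ?E. card {x \<in> ?E. ?N x = y})"
    using card_UN_le[of "?N ` ?E" "\<lambda>y. {x \<in> ?E. ?N x = y}"] by simp
  also have "\<dots> \<le> (\<Sum>y\<in>?N ` ?E. r + 1)" by (intro sum_mono fib)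
  also have "\<dots> = card (?N ` ?E) * (r + 1)" by simp
  finally have "(r + 1) * (r - 1) \<le> (r + 1) * card (?N ` ?E)" using E sq by (simp add: mult.commute)
  then have 1: "r - 1 \<le> card (?N ` ?E)" unfolding Suc_eq_plus1[symmetric] Suc_mult_le_cancel1 .
  have "?N ` ?E \<subseteq> {x. x ^ r = x} - {0}"
  proof -
    have "(x ^ (r + 1)) ^ r = x ^ (r + 1)" if "x \<in> ?E" for x
    proof -
      have "x ^ ((r + 1) * (r - 1)) = 1"
        using power_card_mult_closed[of ?E x] that E sq by simp
      then have "(x ^ (r + 1)) ^ (r - 1) = 1" unfolding power_mult .
      then have "(x ^ (r + 1)) ^ Suc (r - 1) = x ^ (r + 1)" by (simp only: power_Suc mult_1_right)
      then show ?thesis using r by simp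
    qed
    then show ?thesis by auto
  qed
  then have "card (?N ` ?E) \<le> card ({x. x ^ r = x} - {0 :: 'a})" by (intro card_mono) auto
  also have "\<dots> = card {x :: 'a. x ^ r = x} - 1" using r by (simp add: card_Diff_singleton)
  finally have "r - 1 \<le> card {x :: 'a. x ^ r = x} - 1" using 1 by linarith
  moreover have "card {x :: 'a. x ^ r = x} > 0" using r by (auto simp: card_gt_0_iff intro!: exI[of _ 0])
  ultimately show "r \<le> card {x :: 'a. x ^ r = x}" by linarith
qed

context
  fixes p e r :: nat
  assumes p: "Factorial_Ring.prime p" and q: "CARD('a::{field,finite}) = p ^ e" and r: "p ^ e = r\<^sup>2"
begin

lemma sqrt_card_ge_2: "r \<ge> 2"
proof -
  have "CARD('a) \<ge> 2" using card_mono[of "UNIV :: 'a set" "{0,1}"] by simp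
  then have "r\<^sup>2 \<ge> 2" using q r by simp
  moreover have "r\<^sup>2 \<le> 1" if "r \<le> 1" using power_mono[OF that, of 2] by simp
  ultimately show ?thesis by linarith
qed

lemma sqrt_power_add: "(x + y :: 'a) ^ r = x ^ r + y ^ r"
proof -
  have "r dvd p ^ e" using r by (simp add: power2_eq_square)
  then obtain k where k: "r = p ^ k" using divides_primepow_nat[OF p] by blast
  show ?thesis by (rule freshmans_dream'[where n = k]) (use p k CHAR_eq_prime[OF p q] in auto)
qed

lemma sqrt_power_uminus: "(- x :: 'a) ^ r = - (x ^ r)"
proof -
  have "(- x) ^ r + x ^ r = 0"
    using sqrt_power_add[of "- x" x] sqrt_card_ge_2 by (simp add: power_0_left)
  then show ?thesis by (simp add: add_eq_0_iff2)
qed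

text \<open>A subfield of order r consists of the roots of X^r - X, so the existential quantifier in
  \<open>Omega_sq\<close> becomes an equation.\<close>

lemma Omega_sq_eq: "Omega_sq r = {g \<in> carrier SL2. (g $ 2 $ 1 :: 'a) \<in> {x. x ^ r = x}}"
proof -
  have "(\<exists>K. subfield K ring_of_type_algebra \<and> card K = r \<and> c \<in> K) \<longleftrightarrow> c ^ r = c" for c :: 'a
  proof
    assume "\<exists>K. subfield K ring_of_type_algebra \<and> card K = r \<and> c \<in> K"
    then show "c ^ r = c" using subfield_card_power by (metis finite)
  next
    assume c: "c ^ r = c"
    have "subfield {x :: 'a. x ^ r = x} ring_of_type_algebra"
      by (rule subfield_of_type)
        (use sqrt_card_ge_2 in \<open>auto simp: sqrt_power_add sqrt_power_uminus power_mult_distrib power_inverse\<close>)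
    moreover have "card {x :: 'a. x ^ r = x} = r"
      using card_power_fixed[where ?'a = 'a] q r sqrt_card_ge_2 by simp
    ultimately show "\<exists>K. subfield K ring_of_type_algebra \<and> card K = r \<and> c \<in> K"
      using c by (intro exI[of _ "{x. x ^ r = x}"]) simp
  qed
  then show ?thesis by (simp add: Omega_sq_def)
qed

lemma exists_not_power_fixed: "\<exists>l :: 'a. l ^ r \<noteq> l"
proof (rule ccontr)
  assume "\<not> ?thesis"
  then have "{x :: 'a. x ^ r = x} = UNIV" by auto
  then have "CARD('a) = r" using card_power_fixed[where ?'a = 'a] q r sqrt_card_ge_2 by simp
  then have "r * r = r * 1" using q r by (simp add: power2_eq_square)
  then show False using sqrt_card_ge_2 by simp
qed

lemma frob_in_SL2:
  assumes "h \<in> carrier SL2"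
  shows "frob r (h :: 'a mat2) \<in> carrier SL2"
proof -
  have "(h $ 1 $ 1 * h $ 2 $ 2) ^ r = (1 + h $ 1 $ 2 * h $ 2 $ 1) ^ r" using SL2_det[OF assms] by simp
  then show ?thesis unfolding SL2_carrier frob_def
    by (simp add: sqrt_power_add power_mult_distrib)
qed

end

subsection \<open>Centers at infinity: the parallelisms twisted by a base class\<close>

context sl2_unital
begin

lemma aff_in_Pts [simp]: "Aff g \<in> Pts \<longleftrightarrow> g \<in> carrier SL2"
  by (auto simp: unital_points_def infinity_block_def)

lemma inf_in_Pts [simp]: "Inf_pt C \<in> Pts \<longleftrightarrow> C \<in> \<pi>"
  by (auto simp: unital_points_def infinity_block_def)

lemma inf_in_infinity_block [simp]: "Inf_pt C \<in> infinity_block \<pi> \<longleftrightarrow> C \<in> \<pi>"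
  by (auto simp: infinity_block_def)

lemma aff_notin_infinity_block [simp]: "Aff g \<notin> infinity_block \<pi>"
  by (auto simp: infinity_block_def)

lemma block_with_inf_point:
  assumes "B \<in> Blks" "Inf_pt C \<in> B" "B \<noteq> infinity_block \<pi>"
  shows "\<exists>Y. C \<in> \<pi> \<and> Y \<in> C \<and> B = insert (Inf_pt C) (Aff ` Y)"
  using assms(1) by (cases rule: block_cases) (use assms in auto)

lemma insert_inf_eq_iff:
  "insert (Inf_pt C) (Aff ` W) = insert (Inf_pt C') (Aff ` W') \<longleftrightarrow> C = C' \<and> W = W'"
proof
  assume eq: "insert (Inf_pt C) (Aff ` W) = insert (Inf_pt C') (Aff ` W')"
  have "V = {x. Aff x \<in> insert (Inf_pt B) (Aff ` V)}" for B and V :: "'b mat2 set" by auto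
  then have "W = W'" using eq by metis
  moreover have "Inf_pt C \<in> insert (Inf_pt C') (Aff ` W')" by (simp flip: eq)
  ultimately show "C = C' \<and> W = W'" by auto
qed simp

lemma image_upoint:
  assumes "\<And>x. x \<in> W \<Longrightarrow> f (Aff x) = Aff (F x)"
  shows "f ` Aff ` W = Aff ` F ` W"
  unfolding image_image using assms by (intro image_cong) auto

lemma automorphism_in_Pts: "automorphism Pts Blks f \<Longrightarrow> x \<in> Pts \<Longrightarrow> f x \<in> Pts"
  by (auto simp: automorphism_def bij_betw_def)

lemma automorphism_inj: "automorphism Pts Blks f \<Longrightarrow> inj_on f Pts"
  by (auto simp: automorphism_def bij_betw_def)

lemma class_nonempty: "C \<in> \<pi> \<Longrightarrow> \<exists>Y. Y \<in> C"
  using partition_onD3[OF par_partition] by (metis all_not_in_conv)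

text \<open>An automorphism preserving [\<infinity>] keeps affine points affine by injectivity. It
  is then handled through a map \<open>F\<close> on the group that carries every class into a
  class.\<close>

lemma affine_part:
  assumes aut: "automorphism Pts Blks f" and inf: "f ` infinity_block \<pi> = infinity_block \<pi>"
  obtains F where "\<And>x. x \<in> carrier SL2 \<Longrightarrow> F x \<in> carrier SL2 \<and> f (Aff x) = Aff (F x)"
    and "\<And>C. C \<in> \<pi> \<Longrightarrow> \<exists>C'\<in>\<pi>. f (Inf_pt C) = Inf_pt C' \<and> (\<forall>Y\<in>C. F ` Y \<in> C')"
proof -
  define F where "F x = (THE y. f (Aff x) = Aff y)" for x
  have F: "F x \<in> carrier SL2 \<and> f (Aff x) = Aff (F x)" if x: "x \<in> carrier SL2" for x
  proof -
    have "f (Aff x) \<in> Pts" using automorphism_in_Pts[OF aut] x by simp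
    moreover have "f (Aff x) \<notin> infinity_block \<pi>"
    proof
      assume "f (Aff x) \<in> infinity_block \<pi>"
      then obtain C where C: "C \<in> \<pi>" "f (Aff x) = f (Inf_pt C)"
        using inf by (metis (no_types, lifting) imageE infinity_block_def)
      then show False using inj_onD[OF automorphism_inj[OF aut] C(2)] x by simp
    qed
    ultimately obtain y where "f (Aff x) = Aff y" "y \<in> carrier SL2" by (auto simp: unital_points_def)
    then show ?thesis by (simp add: F_def)
  qed
  have "\<exists>C'\<in>\<pi>. f (Inf_pt C) = Inf_pt C' \<and> (\<forall>Y\<in>C. F ` Y \<in> C')" if C: "C \<in> \<pi>" for C
  proof -
    have "f (Inf_pt C) \<in> infinity_block \<pi>" using inf C by auto
    then obtain C' where C': "C' \<in> \<pi>" "f (Inf_pt C) = Inf_pt C'" by (auto simp: infinity_block_def)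
    have "F ` Y \<in> C'" if Y: "Y \<in> C" for Y
    proof -
      have sub: "Y \<subseteq> carrier SL2" using short_subset[OF class_short[OF C Y]] .
      have img: "f ` insert (Inf_pt C) (Aff ` Y) = insert (Inf_pt C') (Aff ` F ` Y)"
        unfolding image_insert C'(2) using image_upoint[of Y f F] F sub by (metis subsetD)
      have "insert (Inf_pt C') (Aff ` F ` Y) \<in> Blks"
        using automorphism_block[OF aut short_block_mem[OF C Y]] img by simp
      \<comment> \<open>The image still has affine points.\<close>
      moreover have "insert (Inf_pt C') (Aff ` F ` Y) \<noteq> infinity_block \<pi>"
      proof -
        have "Y \<noteq> {}" using card_short[OF class_short[OF C Y]] card_field_ge_2 by auto
        then show ?thesis using aff_notin_infinity_block by blast
      qed
      ultimately have "\<exists>Z. C' \<in> \<pi> \<and> Z \<in> C' \<and> insert (Inf_pt C') (Aff ` F ` Y) = insert (Inf_pt C') (Aff ` Z)"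
        by (intro block_with_inf_point) auto
      then show ?thesis unfolding insert_inf_eq_iff by blast
    qed
    then show ?thesis using C' by blast
  qed
  then show thesis using that F by blast
qed

lemma translation_infinity_block:
  assumes "translation Pts Blks (Inf_pt C) f" "C \<in> \<pi>"
  shows "f ` infinity_block \<pi> = infinity_block \<pi>"
proof -
  have "Inf_pt C \<in> infinity_block \<pi>" using assms(2) by simp
  then show ?thesis using assms(1) infinity_block_mem unfolding translation_def by blast
qed

lemma translation_fixes_class:
  assumes tr: "translation Pts Blks (Inf_pt C) f" and C: "C \<in> \<pi>"
    and F: "\<And>x. x \<in> carrier SL2 \<Longrightarrow> F x \<in> carrier SL2 \<and> f (Aff x) = Aff (F x)" and Y: "Y \<in> C"
  shows "F ` Y = Y"
proof -
  have sub: "Y \<subseteq> carrier SL2" using short_subset[OF class_short[OF C Y]] .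
  have "f ` insert (Inf_pt C) (Aff ` Y) = insert (Inf_pt C) (Aff ` Y)"
    using tr short_block_mem[OF C Y] unfolding translation_def by blast
  moreover have "f ` insert (Inf_pt C) (Aff ` Y) = insert (f (Inf_pt C)) (Aff ` F ` Y)"
    unfolding image_insert using image_upoint[of Y f F] F sub by (metis subsetD)
  moreover have "f (Inf_pt C) = Inf_pt C" using tr by (simp add: translation_def)
  ultimately show ?thesis by (simp add: insert_inf_eq_iff)
qed

text \<open>A point at infinity is determined by any block of its class.\<close>

lemma trivial_if_affine_trivial:
  assumes aut: "automorphism Pts Blks f" and inf: "f ` infinity_block \<pi> = infinity_block \<pi>"
    and triv: "\<And>x. x \<in> carrier SL2 \<Longrightarrow> f (Aff x) = Aff x"
  shows "\<not> nontrivial_on Pts f"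
proof -
  obtain F where F: "\<And>x. x \<in> carrier SL2 \<Longrightarrow> F x \<in> carrier SL2 \<and> f (Aff x) = Aff (F x)"
    and Fc: "\<And>C. C \<in> \<pi> \<Longrightarrow> \<exists>C'\<in>\<pi>. f (Inf_pt C) = Inf_pt C' \<and> (\<forall>Y\<in>C. F ` Y \<in> C')"
    by (rule affine_part[OF aut inf]) blast
  have Fx: "F x = x" if "x \<in> carrier SL2" for x using F[OF that] triv[OF that] by simp
  have "f (Inf_pt C) = Inf_pt C" if C: "C \<in> \<pi>" for C
  proof -
    obtain C' where C': "C' \<in> \<pi>" "f (Inf_pt C) = Inf_pt C'" "\<And>Y. Y \<in> C \<Longrightarrow> F ` Y \<in> C'" using Fc[OF C] by blast
    obtain Y where Y: "Y \<in> C" using class_nonempty[OF C] by blast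
    have sub: "Y \<subseteq> carrier SL2" using short_subset[OF class_short[OF C Y]] .
    have "F ` Y = (\<lambda>x. x) ` Y" by (rule image_cong[OF refl]) (rule Fx[OF subsetD[OF sub]])
    then have "Y \<in> C'" using C'(3)[OF Y] by simp
    then have "C' = C" using class_unique[OF C'(1) C _ Y] by simp
    then show ?thesis using C' by simp
  qed
  then have "f x = x" if "x \<in> Pts" for x using triv that by (cases x) simp_all
  then show ?thesis unfolding nontrivial_on_def by blast
qed

lemma unitriangular_subset: "(unitriangular :: 'a mat2 set) \<subseteq> carrier SL2"
  by (auto simp: unitriangular_def SL2_carrier)

text \<open>All three parallelisms are covered: \<psi> and \<phi> are mutually inverse, preserve
  short blocks, and \<psi> carries the base class to \<open>C\<close>. The set \<open>K\<close> is
  either the set of squares or the subfield of order r.\<close>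

lemma no_translation_twisted_base_class:
  fixes \<psi> \<phi> :: "'a mat2 \<Rightarrow> 'a mat2"
  assumes tr: "translation Pts Blks (Inf_pt C) f" and C: "C \<in> \<pi>"
    and \<psi>: "\<And>x. x \<in> carrier SL2 \<Longrightarrow> \<psi> x \<in> carrier SL2 \<and> \<phi> (\<psi> x) = x"
    and \<phi>: "\<And>x. x \<in> carrier SL2 \<Longrightarrow> \<phi> x \<in> carrier SL2 \<and> \<psi> (\<phi> x) = x"
    and \<psi>_short: "\<And>Y. Y \<in> short_blocks p \<Longrightarrow> \<psi> ` Y \<in> short_blocks p"
    and \<phi>_short: "\<And>Y. Y \<in> short_blocks p \<Longrightarrow> \<phi> ` Y \<in> short_blocks p"
    and C_eq: "C = {\<psi> ` Y | Y. Y \<in> base_class {g \<in> carrier SL2. g $ 2 $ 1 \<in> K}}"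
    and K: "0 \<in> K" "1 \<in> K" "l \<notin> K"
  shows "\<not> nontrivial_on Pts f"
proof -
  have aut: "automorphism Pts Blks f" using tr by (simp add: translation_def)
  note inf = translation_infinity_block[OF tr C]
  obtain F where F: "\<And>x. x \<in> carrier SL2 \<Longrightarrow> F x \<in> carrier SL2 \<and> f (Aff x) = Aff (F x)"
    and Fc: "\<And>C. C \<in> \<pi> \<Longrightarrow> \<exists>C'\<in>\<pi>. f (Inf_pt C) = Inf_pt C' \<and> (\<forall>Y\<in>C. F ` Y \<in> C')"
    by (rule affine_part[OF aut inf]) blast
  define f' where "f' x = \<phi> (F (\<psi> x))" for x
  have fixed: "f' x \<in> Y" if Y: "Y \<in> base_class {g \<in> carrier SL2. g $ 2 $ 1 \<in> K}" "x \<in> Y" "Y \<subseteq> carrier SL2" for x Y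
  proof -
    have "\<psi> ` Y \<in> C" using C_eq Y(1) by blast
    then have "F ` \<psi> ` Y = \<psi> ` Y" using translation_fixes_class[OF tr C, of F "\<psi> ` Y"] F by blast
    then have "F (\<psi> x) \<in> \<psi> ` Y" using Y(2) by blast
    then obtain y where "y \<in> Y" "F (\<psi> x) = \<psi> y" by blast
    then show ?thesis using \<psi> Y(3) by (auto simp: f'_def)
  qed
  have id: "f' x = x" if "x \<in> carrier SL2" for x
  proof (rule fixes_levels_imp_id[of K 1 l f' x, OF K(1,2) one_neq_zero K(3) _ _ _ that])
    fix v z :: "'a ^ 2" assume "v \<noteq> 0" "z \<noteq> 0"
    then have "row_fiber v z \<in> short_blocks p" unfolding short_iff by blast
    then have 1: "\<psi> ` row_fiber v z \<in> short_blocks p" by (rule \<psi>_short)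
    then obtain C1 where "C1 \<in> \<pi>" "\<psi> ` row_fiber v z \<in> C1" using short_class by blast
    then have "F ` \<psi> ` row_fiber v z \<in> short_blocks p" using Fc class_short by blast
    then have "\<phi> ` F ` \<psi> ` row_fiber v z \<in> short_blocks p" by (rule \<phi>_short)
    then obtain w y where wy: "w \<noteq> 0" "y \<noteq> 0" "\<phi> ` F ` \<psi> ` row_fiber v z = row_fiber w y"
      unfolding short_iff by blast
    have "f' ` row_fiber v z = \<phi> ` F ` \<psi> ` row_fiber v z" unfolding image_image f'_def ..
    then show "\<exists>w y. w \<noteq> 0 \<and> y \<noteq> 0 \<and> f' ` row_fiber v z \<subseteq> row_fiber w y"
      unfolding wy(3) using wy(1,2) by (intro exI[of _ w] exI[of _ y]) simp
  next
    \<comment> \<open>Left multiplication by unitriangular matrices keeps the second row; outside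
      \<open>K\<close>, right multiplication keeps the first column.\<close>
    fix x :: "'a mat2" assume x: "x \<in> carrier SL2" "x $ 2 $ 1 \<in> K"
    have "unitriangular #>\<^bsub>SL2\<^esub> x \<in> base_class {g \<in> carrier SL2. g $ 2 $ 1 \<in> K}"
      unfolding base_class_def using x by blast
    moreover have "x \<in> unitriangular #>\<^bsub>SL2\<^esub> x"
      unfolding r_coset_SL2 by (rule image_eqI[of _ _ "mat 1"]) (auto simp: unitriangular_def)
    moreover have "unitriangular #>\<^bsub>SL2\<^esub> x \<subseteq> carrier SL2"
      using x SL2.r_coset_subset_G[OF unitriangular_subset] by blast
    ultimately have "f' x \<in> unitriangular #>\<^bsub>SL2\<^esub> x" by (rule fixed)
    then show "f' x $ 2 $ 1 = x $ 2 $ 1 \<and> f' x $ 2 $ 2 = x $ 2 $ 2"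
      by (auto simp: r_coset_SL2 unitriangular_def)
  next
    fix x :: "'a mat2" assume x: "x \<in> carrier SL2" "x $ 2 $ 1 \<notin> K"
    have "x <#\<^bsub>SL2\<^esub> unitriangular \<in> base_class {g \<in> carrier SL2. g $ 2 $ 1 \<in> K}"
      unfolding base_class_def using x by blast
    moreover have "x \<in> x <#\<^bsub>SL2\<^esub> unitriangular"
      unfolding l_coset_SL2 by (rule image_eqI[of _ _ "mat 1"]) (auto simp: unitriangular_def)
    moreover have "x <#\<^bsub>SL2\<^esub> unitriangular \<subseteq> carrier SL2"
      using x SL2.l_coset_subset_G[OF unitriangular_subset] by blast
    ultimately have "f' x \<in> x <#\<^bsub>SL2\<^esub> unitriangular" by (rule fixed)
    then show "f' x $ 2 $ 1 = x $ 2 $ 1 \<and> f' x $ 1 $ 1 = x $ 1 $ 1"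
      by (auto simp: l_coset_SL2 unitriangular_def)
  qed
  have "F x = x" if x: "x \<in> carrier SL2" for x
  proof -
    have "\<phi> (F x) = \<phi> x" using id[of "\<phi> x"] \<phi>[OF x] by (simp add: f'_def)
    then have "\<psi> (\<phi> (F x)) = \<psi> (\<phi> x)" by (rule arg_cong)
    then show ?thesis using \<phi>[OF x] \<phi>[of "F x"] F[OF x] by simp
  qed
  then show ?thesis using trivial_if_affine_trivial[OF aut inf] F by metis
qed

lemma short_mult:
  fixes Y :: "'a mat2 set"
  assumes "h \<in> carrier SL2" "k \<in> carrier SL2" "Y \<in> short_blocks p"
  shows "(\<lambda>x. h ** x ** k) ` Y \<in> short_blocks p"
proof -
  obtain v z where "v \<noteq> 0" "z \<noteq> 0" "Y = row_fiber v z" using assms(3) unfolding short_iff by blast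
  moreover from this have "v v* adj2 h \<noteq> 0" "z v* k \<noteq> 0" using assms by simp_all
  ultimately show ?thesis unfolding short_iff using row_fiber_mult[OF assms(1,2)] by blast
qed

lemma short_inv:
  fixes Y :: "'a mat2 set"
  assumes "Y \<in> short_blocks p"
  shows "adj2 ` Y \<in> short_blocks p"
proof -
  obtain v z where vz: "v \<noteq> 0" "z \<noteq> 0" "Y = row_fiber v z" using assms unfolding short_iff by blast
  then show ?thesis unfolding short_iff vz(3) row_fiber_inv by blast
qed

lemma no_translation_par_odd:
  assumes "odd (CARD('a))" "\<pi> = par_odd" "C \<in> \<pi>" and tr: "translation Pts Blks (Inf_pt C) f"
  shows "\<not> nontrivial_on Pts f"
proof -
  obtain h where h: "h \<in> carrier SL2"
    "C = {inv\<^bsub>SL2\<^esub> h <#\<^bsub>SL2\<^esub> Y #>\<^bsub>SL2\<^esub> h | Y. Y \<in> base_class Omega_odd}"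
    using assms by (auto simp: par_odd_def)
  obtain l :: 'a where l: "\<forall>y. l \<noteq> y\<^sup>2" using exists_nonsquare[OF assms(1)] by blast
  have "inv\<^bsub>SL2\<^esub> h <#\<^bsub>SL2\<^esub> Y #>\<^bsub>SL2\<^esub> h = (\<lambda>x. adj2 h ** x ** h) ` Y" for Y
    using h by (simp add: l_coset_SL2 r_coset_SL2 inv_SL2 image_image)
  then have C: "C = {(\<lambda>x. adj2 h ** x ** h) ` Y | Y. Y \<in> base_class {g \<in> carrier SL2. g $ 2 $ 1 \<in> {c. \<exists>y. c = y\<^sup>2}}}"
    using h(2) by (simp add: Omega_odd_def)
  show ?thesis
    by (rule no_translation_twisted_base_class[OF tr assms(3) _ _ _ _ C, of "\<lambda>x. h ** x ** adj2 h" l])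
      (use h l in \<open>auto simp: matrix_mul_assoc intro: short_mult exI[of _ 1] exI[of _ 0]\<close>)
qed

text \<open>For \<open>par_sq_inv\<close> the twisted conjugation is followed by inversion, which
  also preserves short blocks.\<close>

lemma no_translation_par_sq:
  assumes r: "CARD('a) = r\<^sup>2" and \<pi>: "\<pi> = par_sq r \<or> \<pi> = par_sq_inv r" and C: "C \<in> \<pi>"
    and tr: "translation Pts Blks (Inf_pt C) f"
  shows "\<not> nontrivial_on Pts f"
proof -
  have r': "p ^ e = r\<^sup>2" using r unfolding card_field .
  note pqr = prime_p card_field r'
  obtain l :: 'a where l: "l ^ r \<noteq> l" using exists_not_power_fixed[OF pqr] by blast
  have r0: "r > 0" using sqrt_card_ge_2[OF pqr] by simp
  have img: "twisted_conj r h ` Y = (\<lambda>x. adj2 h ** x ** frob r h) ` Y" if "h \<in> carrier SL2" for h and Y :: "'a mat2 set"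
    using that by (simp add: twisted_conj_def inv_SL2)
  have cl: "{twisted_conj r h ` Y | Y. Y \<in> base_class (Omega_sq r)}
      = {(\<lambda>x. adj2 h ** x ** frob r h) ` Y | Y. Y \<in> base_class {g \<in> carrier SL2. g $ 2 $ 1 \<in> {x :: 'a. x ^ r = x}}}"
    if "h \<in> carrier SL2" for h
    using img[OF that] Omega_sq_eq[OF pqr] by simp
  from \<pi> show ?thesis
  proof
    assume "\<pi> = par_sq r"
    then obtain h where h: "h \<in> carrier SL2" "C = {twisted_conj r h ` Y | Y. Y \<in> base_class (Omega_sq r)}"
      using C by (auto simp: par_sq_def)
    note fr = frob_in_SL2[OF pqr h(1)]
    have sh: "(\<lambda>x. adj2 h ** x ** frob r h) ` Y \<in> short_blocks p"
       "(\<lambda>x. h ** x ** adj2 (frob r h)) ` Y \<in> short_blocks p" if "Y \<in> short_blocks p" for Y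
      using short_mult[OF _ _ that] h fr by auto
    show ?thesis
      by (rule no_translation_twisted_base_class[OF tr C _ _ sh(1) sh(2) h(2)[unfolded cl[OF h(1)]], where l = l])
        (use h fr l r0 in \<open>auto simp: matrix_mul_assoc\<close>)
  next
    assume "\<pi> = par_sq_inv r"
    then obtain B where B: "B \<in> par_sq r" "C = {set_inv\<^bsub>SL2\<^esub> Y | Y. Y \<in> B}"
      using C by (auto simp: par_sq_inv_def)
    then obtain h where h: "h \<in> carrier SL2" "B = {twisted_conj r h ` Y | Y. Y \<in> base_class (Omega_sq r)}"
      by (auto simp: par_sq_def)
    note fr = frob_in_SL2[OF pqr h(1)]
    have inv: "set_inv\<^bsub>SL2\<^esub> Y = adj2 ` Y" if "Y \<subseteq> carrier SL2" for Y :: "'a mat2 set"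
    proof -
      have "set_inv\<^bsub>SL2\<^esub> Y = (\<lambda>h. inv\<^bsub>SL2\<^esub> h) ` Y" by (auto simp: SET_INV_def)
      also have "\<dots> = adj2 ` Y" using that inv_SL2 by (intro image_cong) auto
      finally show ?thesis .
    qed
    have sub: "Y \<subseteq> carrier SL2" if YB: "Y \<in> B" for Y
    proof -
      obtain Z where Z: "Z \<in> base_class (Omega_sq r)" "Y = twisted_conj r h ` Z"
        using YB unfolding h(2) by blast
      have "Z \<subseteq> carrier SL2"
        using Z(1) SL2.r_coset_subset_G[OF unitriangular_subset] SL2.l_coset_subset_G[OF unitriangular_subset]
        by (auto simp: base_class_def)
      then show ?thesis unfolding Z(2) img[OF h(1)] using h fr by auto
    qed
    have "C = {adj2 ` Y | Y. Y \<in> B}" 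
      unfolding B(2) Setcompr_eq_image using inv sub by (intro image_cong) auto
    also have "\<dots> = {(\<lambda>x. adj2 (adj2 h ** x ** frob r h)) ` Y | Y. 
        Y \<in> base_class {g \<in> carrier SL2. g $ 2 $ 1 \<in> {x :: 'a. x ^ r = x}}}"
      unfolding h(2) cl[OF h(1)] Setcompr_eq_image image_image ..
    finally have C_eq: "C = {(\<lambda>x. adj2 (adj2 h ** x ** frob r h)) ` Y | Y. 
        Y \<in> base_class {g \<in> carrier SL2. g $ 2 $ 1 \<in> {x :: 'a. x ^ r = x}}}" .
    have sh: "(\<lambda>x. adj2 (adj2 h ** x ** frob r h)) ` Y \<in> short_blocks p"
       "(\<lambda>x. h ** adj2 x ** adj2 (frob r h)) ` Y \<in> short_blocks p" if "Y \<in> short_blocks p" for Y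
      using short_inv[OF short_mult[OF _ fr that, of "adj2 h"]]
        short_mult[OF h(1) adj2_in_SL2[OF fr] short_inv[OF that]] h(1) by (simp_all add: image_image)
    show ?thesis
      by (rule no_translation_twisted_base_class[OF tr C _ _ sh(1) sh(2) C_eq, where l = l])
        (use h fr l r0 in \<open>auto simp: matrix_mul_assoc\<close>)
  qed
qed

end

subsection \<open>The flat parallelism\<close>

lemma adj2_one [simp]: "adj2 (mat 1 :: 'a::comm_ring_1 mat2) = mat 1"
  by (simp add: mat2_eq_iff)

lemma transvection_apply: "u v* transvection v t = (\<chi> i. u $ i + t * cross2 u v * v $ i)"
  by (simp add: vec2_eq_iff transvection_def cross2_def algebra_simps power2_eq_square)

lemma cross2_eq_0:
  assumes "cross2 a b \<noteq> 0" "cross2 a d = 0" "cross2 b d = (0::'a::field)"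
  shows "d = 0"
proof -
  have "cross2 a b * d $ 1 = b $ 1 * cross2 a d - a $ 1 * cross2 b d"
    "cross2 a b * d $ 2 = b $ 2 * cross2 a d - a $ 2 * cross2 b d"
    by (simp_all add: cross2_def algebra_simps)
  then show ?thesis using assms by (simp add: vec2_eq_iff)
qed

lemma cross2_rows_eq:
  fixes A B :: "'a::field mat2"
  assumes c: "cross2 v w \<noteq> 0" and "v v* A = v v* B" "w v* A = w v* B"
  shows "A = B"
proof -
  define N where "N = A - B"
  have N: "v $ 1 * N $ 1 $ j + v $ 2 * N $ 2 $ j = 0" "w $ 1 * N $ 1 $ j + w $ 2 * N $ 2 $ j = 0" for j
    using assms(2,3) unfolding N_def by (simp_all add: vec_eq_iff algebra_simps)
  have "cross2 v w * N $ 1 $ j = w $ 2 * (v $ 1 * N $ 1 $ j + v $ 2 * N $ 2 $ j) - v $ 2 * (w $ 1 * N $ 1 $ j + w $ 2 * N $ 2 $ j)"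
    "cross2 v w * N $ 2 $ j = v $ 1 * (w $ 1 * N $ 1 $ j + w $ 2 * N $ 2 $ j) - w $ 1 * (v $ 1 * N $ 1 $ j + v $ 2 * N $ 2 $ j)" for j
    by (simp_all add: cross2_def algebra_simps)
  then have "cross2 v w * N $ 1 $ j = 0" "cross2 v w * N $ 2 $ j = 0" for j unfolding N by simp_all
  then have "N $ 1 $ j = 0" "N $ 2 $ j = 0" for j using c by auto
  then show ?thesis unfolding N_def by (simp add: mat2_eq_iff)
qed

lemma cross2_0_scale:
  fixes v w :: "'a::field ^ 2"
  assumes "cross2 v w = 0" "v \<noteq> 0"
  shows "\<exists>l. w = (\<chi> i. l * v $ i)"
proof (cases "v $ 1 = 0")
  case True
  then have "v $ 2 \<noteq> 0" using assms(2) by (simp add: vec2_eq_iff)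
  then have "w = (\<chi> i. w $ 2 / v $ 2 * v $ i)" using True assms(1) by (simp add: vec2_eq_iff cross2_def)
  then show ?thesis by blast
next
  case False
  then have "w = (\<chi> i. w $ 1 / v $ 1 * v $ i)" using assms(1) by (simp add: vec2_eq_iff cross2_def field_simps)
  then show ?thesis by blast
qed

lemma scale_vm: "(\<chi> i. l * v $ i) v* (A :: 'a::comm_ring_1 mat2) = (\<chi> i. l * (v v* A) $ i)"
  by (simp add: vec2_eq_iff algebra_simps)

lemma cross2_scale: "cross2 v (\<chi> i. l * w $ i) = l * cross2 v w"
  by (simp add: cross2_def algebra_simps)

lemma cross2_diff_right: "cross2 a (b - c) = cross2 a b - cross2 a c"
  by (simp add: cross2_def algebra_simps)

lemma cross2_add_scale: "cross2 (\<chi> i. a $ i + l * b $ i) d = cross2 a d + l * cross2 b d"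
  by (simp add: cross2_def algebra_simps)

lemma rstab_scale:
  assumes "l \<noteq> 0"
  shows "rstab (\<chi> i. l * v $ i) = rstab v"
  using assms unfolding rstab_def scale_vm by (simp add: vec_eq_iff)

lemma rstab_neq_imp_cross2:
  assumes "rstab v \<noteq> rstab w" "v \<noteq> 0" "w \<noteq> 0"
  shows "cross2 v w \<noteq> 0"
proof
  assume "cross2 v w = 0"
  then obtain l where l: "w = (\<chi> i. l * v $ i)" using cross2_0_scale assms(2) by blast
  then have "l \<noteq> 0" using assms(3) by (auto simp: vec2_eq_iff)
  then show False using l rstab_scale assms(1) by metis
qed

lemma automorphismI:
  assumes f: "\<And>x. x \<in> P \<Longrightarrow> f x \<in> P \<and> g (f x) = x" and g: "\<And>x. x \<in> P \<Longrightarrow> g x \<in> P \<and> f (g x) = x"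
    and fB: "\<And>B. B \<in> Bl \<Longrightarrow> f ` B \<in> Bl" and gB: "\<And>B. B \<in> Bl \<Longrightarrow> g ` B \<in> Bl" and sub: "\<And>B. B \<in> Bl \<Longrightarrow> B \<subseteq> P"
  shows "automorphism P Bl f"
proof -
  have "bij_betw f P P" by (rule bij_betw_byWitness[of _ g]) (use f g in auto)
  moreover have "(\<lambda>B. f ` B) ` Bl = Bl"
  proof (intro equalityI subsetI)
    fix B assume B: "B \<in> Bl"
    have "f ` g ` B = (\<lambda>x. x) ` B"
      unfolding image_image by (rule image_cong[OF refl]) (use g sub[OF B] in blast)
    then have "B = f ` g ` B" by simp
    then show "B \<in> (\<lambda>B. f ` B) ` Bl" using gB[OF B] by (rule image_eqI)
  qed (use fB in blast)
  ultimately show ?thesis by (simp add: automorphism_def)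
qed

text \<open>Right multiplication permutes the cosets of each Sylow subgroup, so in the flat closure
  it extends by fixing every point at infinity.\<close>

definition right_mult :: "('a::field) mat2 \<Rightarrow> 'a upoint \<Rightarrow> 'a upoint" where
  "right_mult h x = (case x of Aff g \<Rightarrow> Aff (g ** h) | Inf_pt C \<Rightarrow> Inf_pt C)"

lemma right_mult_simps [simp]: "right_mult h (Aff g) = Aff (g ** h)" "right_mult h (Inf_pt C) = Inf_pt C"
  by (simp_all add: right_mult_def)

context sl2_unital
begin

text \<open>The conjugate of \<open>S\<close> is a subgroup of order q + 1, too small for the q(q+1)
  quotients of a block \<open>D k\<close>. So it is a coset of \<open>S\<close> containing
  1.\<close>

lemma left_mult_conj_S:
  assumes x: "x \<in> carrier SL2" and W: "(\<lambda>s. x ** s ** adj2 x) ` S \<in> long_blocks S \<D>"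
  shows "(\<lambda>s. x ** s ** adj2 x) ` S = S"
proof -
  let ?H = "(\<lambda>s. x ** s ** adj2 x) ` S"
  have one: "mat 1 \<in> ?H" by (rule image_eqI[of _ _ "mat 1"]) (use x in auto)
  have closed: "g ** adj2 h \<in> ?H" if gh: "g \<in> ?H" "h \<in> ?H" for g h
  proof -
    obtain s t where st: "s \<in> S" "t \<in> S" "g = x ** s ** adj2 x" "h = x ** t ** adj2 x" using gh by blast
    have "adj2 h = x ** (adj2 t ** adj2 x)" using st by (simp add: adj2_mult matrix_mul_assoc)
    then have "g ** adj2 h = x ** s ** (adj2 x ** (x ** (adj2 t ** adj2 x)))"
      using st by (simp only: matrix_mul_assoc)
    also have "\<dots> = x ** (s ** adj2 t) ** adj2 x" using x by (simp add: matrix_mul_assoc)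
    finally show ?thesis using S_mult[OF st(1) S_inv[OF st(2)]] by blast
  qed
  consider k where "k \<in> carrier SL2" "?H = S #>\<^bsub>SL2\<^esub> k" | D k where "D \<in> \<D>" "k \<in> carrier SL2" "?H = D #>\<^bsub>SL2\<^esub> k"
    using W unfolding long_blocks_def by blast
  then show ?thesis
  proof cases
    case 1
    then have "mat 1 ** adj2 k \<in> S" using one mem_r_coset_SL2 by metis
    then have "k \<in> S" using S_inv[of "adj2 k"] by simp
    then show ?thesis using 1 SL2.coset_join2[OF 1(1) subgroup_S] by simp
  next
    case 2
    have "quotient_set D \<subseteq> ?H"
    proof
      fix z assume "z \<in> quotient_set D"
      then obtain a b where ab: "a \<in> D" "b \<in> D" "z = a \<otimes>\<^bsub>SL2\<^esub> inv\<^bsub>SL2\<^esub> b"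
        unfolding quotient_set_def by blast
      then have z: "z = a ** adj2 b" using D_subset[OF 2(1)] inv_SL2[of b] by auto
      have "a ** k \<in> ?H" "b ** k \<in> ?H" unfolding 2(3) r_coset_SL2 using ab by blast+
      then have "(a ** k) ** adj2 (b ** k) \<in> ?H" by (rule closed)
      moreover have "(a ** k) ** adj2 (b ** k) = z"
        unfolding z adj2_mult using 2(2) by (simp add: matrix_mul_assoc)
      ultimately show "z \<in> ?H" by simp
    qed
    then have "card (quotient_set D) \<le> card ?H" by (intro card_mono) auto
    also have "\<dots> \<le> card S" by (rule card_image_le) simp
    finally have "CARD('a) * (CARD('a) + 1) \<le> CARD('a) + 1" using card_quotient_set[OF 2(1)] card_S by simp
    moreover have "2 * (CARD('a) + 1) \<le> CARD('a) * (CARD('a) + 1)" by (rule mult_le_mono1[OF card_field_ge_2])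
    ultimately show ?thesis by simp
  qed
qed

lemma normalizer_iff: "x \<in> normalizer SL2 S \<longleftrightarrow> x \<in> carrier SL2 \<and> (\<lambda>s. x ** s ** adj2 x) ` S = S"
proof -
  have "x <#\<^bsub>SL2\<^esub> S #>\<^bsub>SL2\<^esub> inv\<^bsub>SL2\<^esub> x = (\<lambda>s. x ** s ** adj2 x) ` S" if "x \<in> carrier SL2"
    using inv_SL2[OF that] by (simp add: l_coset_SL2 r_coset_SL2 image_image)
  then show ?thesis unfolding normalizer_def stabilizer_def using S_subset by auto
qed

lemma sylow_subset: "P \<in> sylow_subgroups p SL2 \<Longrightarrow> P \<subseteq> carrier (SL2 :: 'a mat2 monoid)"
  unfolding sylow_iff rstab_def by blast

text \<open>An element commuting with the transvection \<open>x\<close> preserves its axis, spanned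
  by \<open>v\<close>, which gives the eigenvalue \<open>l\<close>. Comparing both products on a
  vector off the axis, with invariance of \<open>cross2\<close>, gives
  \<open>l\<^sup>2 = 1\<close>.\<close>

lemma commutes_with_sylow_element:
  assumes s: "s \<in> S" and x: "x \<in> rstab v" "x \<noteq> mat 1" and v: "v \<noteq> 0" and comm: "x ** s = s ** x"
  shows "\<exists>l. v v* s = (\<chi> i. l * v $ i) \<and> l\<^sup>2 = 1"
proof -
  have sS: "s \<in> carrier SL2" using s S_subset by blast
  obtain t where t: "x = transvection v t" using x(1) rstab_eq[OF v] by blast
  have t0: "t \<noteq> 0" using x(2) t transvection_0 by metis
  have "(v v* s) v* x = (v v* x) v* s" unfolding vm_assoc comm ..
  also have "v v* x = v" using x(1) by (simp add: rstab_def)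
  finally have "cross2 (v v* s) v * v $ 1 = 0" "cross2 (v v* s) v * v $ 2 = 0"
    unfolding t transvection_apply using t0 by (simp_all add: vec2_eq_iff)
  then have "cross2 (v v* s) v = 0" using v by (auto simp: vec2_eq_iff)
  then have "cross2 v (v v* s) = 0" unfolding cross2_def by (simp add: algebra_simps)
  then obtain l where l: "v v* s = (\<chi> i. l * v $ i)" using cross2_0_scale v by blast
  obtain w :: "'a ^ 2" where w: "cross2 w v \<noteq> 0"
  proof (cases "v $ 1 = 0")
    case True
    then have "cross2 (vector [1, 0]) v \<noteq> 0" using v by (auto simp: cross2_def vec2_eq_iff)
    then show ?thesis using that by blast
  next
    case False
    then have "cross2 (vector [0, 1]) v \<noteq> 0" by (auto simp: cross2_def)
    then show ?thesis using that by blast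
  qed
  have "(w v* s) v* x = (w v* x) v* s" unfolding vm_assoc comm ..
  then have "(\<chi> i. (w v* s) $ i + t * cross2 (w v* s) v * v $ i) = (\<chi> i. w $ i + t * cross2 w v * v $ i) v* s"
    unfolding t transvection_apply .
  also have "\<dots> = (\<chi> i. (w v* s) $ i + t * cross2 w v * (v v* s) $ i)"
    by (simp add: vec2_eq_iff algebra_simps)
  finally have "cross2 (w v* s) v * v $ i = cross2 w v * l * v $ i" for i
    unfolding l using t0 by (auto simp: vec_eq_iff)
  then have 1: "cross2 (w v* s) v = cross2 w v * l" using v by (auto simp: vec2_eq_iff)
  have "cross2 w v = cross2 (w v* s) (v v* s)" using cross2_mult[OF sS] by simp
  also have "\<dots> = l * cross2 (w v* s) v" unfolding l by (simp add: cross2_def algebra_simps)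
  also have "\<dots> = cross2 w v * l\<^sup>2" unfolding 1 by (simp add: power2_eq_square)
  finally have "l\<^sup>2 = 1" using w by simp
  then show ?thesis using l by blast
qed

lemma rstab_sylow: "v \<noteq> 0 \<Longrightarrow> rstab v \<in> sylow_subgroups p (SL2 :: 'a mat2 monoid)"
  unfolding sylow_iff by blast

lemma funpow_conj:
  assumes "x \<in> carrier SL2"
  shows "((\<lambda>s. x ** s ** adj2 x) ^^ n) s = (x [^]\<^bsub>SL2\<^esub> n) ** s ** adj2 (x [^]\<^bsub>SL2\<^esub> n)"
proof (induction n)
  case 0
  then show ?case by simp
next
  case (Suc n)
  have "x [^]\<^bsub>SL2\<^esub> Suc n = x ** (x [^]\<^bsub>SL2\<^esub> n)"
    using SL2.nat_pow_Suc2[OF assms] by simp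
  then show ?case using Suc by (simp add: adj2_mult matrix_mul_assoc)
qed

text \<open>For odd \<open>q\<close>, the subgroup \<open>S\<close> of even order contains \<open>-1\<close>. A unipotent element normalizing \<open>S\<close>
  would centralize exactly \<open>{1, -1}\<close> in \<open>S\<close>, but the size of this fixed point set is congruent to
  \<open>q + 1\<close> modulo \<open>p\<close>.\<close>

lemma no_sylow_element_normalizes_S_odd:
  assumes odd: "odd (CARD('a))" and P: "P \<in> sylow_subgroups p SL2" and x: "x \<in> P" "x \<noteq> mat 1"
    and norm: "(\<lambda>s. x ** s ** adj2 x) ` S = S"
  shows False
proof -
  obtain v where v: "v \<noteq> 0" "P = rstab v" using P unfolding sylow_iff by blast
  have xS: "x \<in> carrier SL2" using sylow_subset[OF P] x by blast
  let ?m = "mk2 (-1) 0 0 (-1) :: 'a mat2"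
  have p_odd: "odd p" using odd card_field e_pos by simp
  have two: "(2 :: 'a) \<noteq> 0"
  proof
    assume "(2 :: 'a) = 0"
    then have "of_nat 2 = (0 :: 'a)" by simp
    then have "p dvd 2" using of_nat_eq_0_iff_char_dvd CHAR_eq_prime[OF prime_p card_field] by metis
    then show False using p_odd prime_p by (metis dvd_antisym even_zero gcd_nat.extremum nat_dvd_not_less prime_dvd_fact_iff primes_dvd_imp_eq two_is_prime_nat)
  qed
  have inv_only: "s = mat 1 \<or> s = ?m" if s: "s \<in> S" "adj2 s = s" for s
  proof -
    have zero: "b = 0" if "- b = b" for b :: 'a
    proof -
      have "2 * b = b + - b" using that by simp
      then show ?thesis using two by simp
    qed
    have "adj2 s $ i $ j = s $ i $ j" for i j using s(2) by simp
    from this[of 1 1] this[of 1 2] this[of 2 1]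
    have e: "s $ 2 $ 2 = s $ 1 $ 1" "s $ 1 $ 2 = 0" "s $ 2 $ 1 = 0"
      unfolding adj2_nth by (blast intro: zero)+
    have "s \<in> carrier SL2" using s(1) S_subset by blast
    then have "s $ 1 $ 1 * s $ 1 $ 1 = 1" unfolding SL2_carrier e by simp
    then have "s $ 1 $ 1 = 1 \<or> s $ 1 $ 1 = - 1" by (simp add: square_eq_1_iff)
    then show ?thesis using e by (auto simp: mat2_eq_iff)
  qed
  \<comment> \<open>The fixed points of inversion on \<open>S\<close> are among 1 and -1, and their
    number has the parity of q + 1, which is even.\<close>
  have m: "?m \<in> S"
  proof (rule ccontr)
    assume nm: "?m \<notin> S"
    have "card S mod 2 = card {s \<in> S. adj2 s = s} mod 2"
      by (rule card_fixed_points_prime_order) (auto simp: S_inv eval_nat_numeral two_is_prime_nat[unfolded numeral_2_eq_2])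
    also have "{s \<in> S. adj2 s = s} = {mat 1}"
      using inv_only nm by auto
    finally show False using card_S odd by simp
  qed
  have fixed: "{s \<in> S. x ** s ** adj2 x = s} = {mat 1, ?m}"
  proof (intro equalityI subsetI)
    fix s assume s: "s \<in> {s \<in> S. x ** s ** adj2 x = s}"
    then have "x ** s ** adj2 x = s" by simp
    then have "(x ** s ** adj2 x) ** x = s ** x" by (rule arg_cong)
    then have "x ** s = s ** x" unfolding adj2_cancel(4)[OF xS] .
    then obtain l where l: "v v* s = (\<chi> i. l * v $ i)" "l\<^sup>2 = 1"
      using commutes_with_sylow_element[of s x v] s x v by blast
    from l(2) have "l = 1 \<or> l = - 1" by (simp add: power2_eq_1_iff)
    then show "s \<in> {mat 1, ?m}"
    proof
      assume "l = 1"
      then have "v v* s = v" unfolding l(1) by (simp add: vec2_eq_iff)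
      then have "s \<in> rstab v" using s S_subset unfolding rstab_def by blast
      then have "s = mat 1" using S_inter_sylow[OF P] s v by blast
      then show ?thesis by simp
    next
      \<comment> \<open>Multiplication by -1, an element of \<open>S\<close>, reduces to the
        eigenvalue 1.\<close>
      assume "l = - 1"
      then have "v v* (s ** ?m) = v" using l unfolding vm_assoc[symmetric] by (simp add: vec2_eq_iff)
      moreover have sm: "s ** ?m \<in> S" using S_mult[OF _ m] s by blast
      ultimately have "s ** ?m \<in> rstab v" using S_subset unfolding rstab_def by blast
      then have "s ** ?m = mat 1" using S_inter_sylow[OF P] sm v by blast
      then have "(s ** ?m) ** ?m = ?m" by simp
      moreover have "(s ** ?m) ** ?m = s" unfolding mat2_eq_iff mat2_mult mk2_nth by simp
      ultimately have "s = ?m" by simp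
      then show ?thesis by simp
    qed
  next
    fix s assume "s \<in> {mat 1, ?m}"
    moreover have "x ** ?m ** adj2 x = ?m"
    proof -
      have "x ** ?m = ?m ** x" by (simp add: mat2_eq_iff)
      then show ?thesis using xS by simp
    qed
    ultimately show "s \<in> {s \<in> S. x ** s ** adj2 x = s}" using m xS by auto
  qed
  have pow: "x [^]\<^bsub>SL2\<^esub> p = mat 1"
  proof -
    obtain t where t: "x = transvection v t" using x(1) v rstab_eq[OF v(1)] by blast
    have "x [^]\<^bsub>SL2\<^esub> (n::nat) = transvection v (of_nat n * t)" for n
      by (induction n) (simp_all add: transvection_0 t transvection_add algebra_simps)
    moreover have "of_nat p = (0::'a)" using CHAR_eq_prime[OF prime_p card_field] of_nat_CHAR[where ?'a = 'a] by simp
    ultimately show ?thesis by (simp add: transvection_0)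
  qed
  have "card S mod p = card {s \<in> S. x ** s ** adj2 x = s} mod p"
  proof (rule card_fixed_points_prime_order[OF prime_p])
    show "((\<lambda>s. x ** s ** adj2 x) ^^ p) s = s" for s
      unfolding funpow_conj[OF xS] pow by simp
  qed (use norm in auto)
  moreover have "mat 1 \<noteq> ?m" using two by (auto simp: mat2_eq_iff eq_neg_iff_add_eq_0)
  ultimately have "(CARD('a) + 1) mod p = 2 mod p" unfolding fixed card_S by (simp add: numeral_2_eq_2)
  moreover have "(CARD('a) + 1) mod p = 1 mod p"
  proof -
    have "p dvd CARD('a)" using card_field e_pos by simp
    then show ?thesis by (metis add.commute mod_add_self2 dvd_def mod_mult_self2)
  qed
  moreover have "p > 2" using p_odd prime_gt_1_nat[OF prime_p] by (metis One_nat_def Suc_1 Suc_lessI even_numeral)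
  ultimately show False by simp
qed

end

section \<open>Automorphisms and translations of the flat closure\<close>

locale flat_unital = sl2_unital +
  assumes flat: "\<pi> = par_flat p" and card_field_ge_3: "CARD('a) \<ge> 3"
begin

definition cosets_of :: "'a mat2 set \<Rightarrow> 'a mat2 set set" where
  "cosets_of P = {P #>\<^bsub>SL2\<^esub> g | g. g \<in> carrier SL2}"

lemma par_iff: "C \<in> \<pi> \<longleftrightarrow> (\<exists>P\<in>sylow_subgroups p SL2. C = cosets_of P)"
  unfolding flat par_flat_def cosets_of_def by blast

lemma cosets_of_in_par: "P \<in> sylow_subgroups p SL2 \<Longrightarrow> cosets_of P \<in> \<pi>"
  unfolding par_iff by blast

lemma coset_in_cosets_of: "g \<in> carrier SL2 \<Longrightarrow> P #>\<^bsub>SL2\<^esub> g \<in> cosets_of P"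
  unfolding cosets_of_def by blast

lemma sylow_subgroup: "P \<in> sylow_subgroups p (SL2 :: 'a mat2 monoid) \<Longrightarrow> subgroup P SL2"
  unfolding sylow_subgroups_def by blast

lemma cosets_of_inject:
  assumes P: "P \<in> sylow_subgroups p SL2" and Q: "Q \<in> sylow_subgroups p SL2" and eq: "cosets_of P = cosets_of Q"
  shows "P = Q"
proof -
  have P1: "P #>\<^bsub>SL2\<^esub> mat 1 = P" using SL2.coset_mult_one[OF sylow_subset[OF P]] by simp
  have "P \<in> cosets_of P" using coset_in_cosets_of[OF mat_1_in_SL2, of P] P1 by simp
  then have "\<exists>g. P = Q #>\<^bsub>SL2\<^esub> g \<and> g \<in> carrier SL2" unfolding eq by (simp add: cosets_of_def)
  then obtain g where g: "g \<in> carrier SL2" "P = Q #>\<^bsub>SL2\<^esub> g" by blast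
  have "mat 1 \<in> Q #>\<^bsub>SL2\<^esub> g" using sylow_one[OF P] g by simp
  then have "Q #>\<^bsub>SL2\<^esub> g = Q #>\<^bsub>SL2\<^esub> mat 1" using SL2.repr_independence[OF _ g(1) sylow_subgroup[OF Q]] by simp
  also have "\<dots> = Q" using SL2.coset_mult_one[OF sylow_subset[OF Q]] by simp
  finally show ?thesis using g by simp
qed

lemma r_coset_mult_image: "(\<lambda>x. x ** h) ` (H #>\<^bsub>SL2\<^esub> g) = H #>\<^bsub>SL2\<^esub> (g ** h)"
  unfolding r_coset_SL2 image_image matrix_mul_assoc ..

lemma right_mult_Aff_image: "right_mult h ` Aff ` W = Aff ` (\<lambda>x. x ** h) ` W"
  unfolding image_image right_mult_simps ..

lemma right_mult_infinity_block [simp]: "right_mult h ` infinity_block \<pi> = infinity_block \<pi>"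
  unfolding infinity_block_def image_image right_mult_simps ..

lemma right_mult_block:
  assumes h: "h \<in> carrier SL2" and B: "B \<in> Blks"
  shows "right_mult h ` B \<in> Blks"
  using B
proof (cases rule: block_cases)
  case (long W)
  have "(\<lambda>x. x ** h) ` W \<in> long_blocks S \<D>"
    using long(1) h SL2_closed[of _ h] unfolding long_blocks_def
    by (elim UnE CollectE exE conjE; simp only: r_coset_mult_image; blast)
  then show ?thesis unfolding long(2) right_mult_Aff_image by (rule long_block_mem)
next
  case (short C Y)
  obtain P where P: "P \<in> sylow_subgroups p SL2" "C = cosets_of P" using short(1) unfolding par_iff by blast
  obtain g where g: "g \<in> carrier SL2" "Y = P #>\<^bsub>SL2\<^esub> g" using short(2) unfolding P(2) cosets_of_def by blast
  have "(\<lambda>x. x ** h) ` Y \<in> C" unfolding g(2) r_coset_mult_image P(2)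
    by (rule coset_in_cosets_of) (use g h in blast)
  then show ?thesis
    unfolding short(3) image_insert right_mult_Aff_image right_mult_simps by (rule short_block_mem[OF short(1)])
next
  case infinity
  then show ?thesis using infinity_block_mem by simp
qed

lemma right_mult_in_Pts: "h \<in> carrier SL2 \<Longrightarrow> x \<in> Pts \<Longrightarrow> right_mult h x \<in> Pts"
  by (cases x) auto

lemma right_mult_inverse: "h \<in> carrier SL2 \<Longrightarrow> right_mult (adj2 h) (right_mult h x) = x"
  by (cases x) auto

lemma right_mult_automorphism:
  assumes h: "h \<in> carrier SL2"
  shows "automorphism Pts Blks (right_mult h)"
proof (rule automorphismI)
  show "right_mult h x \<in> Pts \<and> right_mult (adj2 h) (right_mult h x) = x" if "x \<in> Pts" for x
    using right_mult_in_Pts[OF h that] right_mult_inverse[OF h] by blast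
  show "right_mult (adj2 h) x \<in> Pts \<and> right_mult h (right_mult (adj2 h) x) = x" if "x \<in> Pts" for x
    using right_mult_in_Pts[OF adj2_in_SL2[OF h] that] right_mult_inverse[OF adj2_in_SL2[OF h]] by simp
qed (use right_mult_block h block_subset in auto)

text \<open>The map \<open>F\<close> keeps \<open>v g\<close>. Cosets of a second Sylow subgroup
  \<open>rstab w\<close> go to cosets of some \<open>rstab w'\<close>, so \<open>w' F(g)\<close>
  depends on \<open>w g\<close> only. Invariance of \<open>cross2\<close> identifies this vector
  with a multiple of \<open>w g\<close>, and two independent rows determine
  \<open>F g\<close>.\<close>

lemma flat_translation:
  assumes P: "P \<in> sylow_subgroups p SL2" and tr: "translation Pts Blks (Inf_pt (cosets_of P)) f"
  shows "\<exists>x\<in>P. \<forall>g\<in>carrier SL2. f (Aff g) = Aff (x ** g)"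
proof -
  let ?C = "cosets_of P"
  have C: "?C \<in> \<pi>" using cosets_of_in_par[OF P] .
  have aut: "automorphism Pts Blks f" using tr by (simp add: translation_def)
  note inf = translation_infinity_block[OF tr C]
  obtain F where F: "\<And>x. x \<in> carrier SL2 \<Longrightarrow> F x \<in> carrier SL2 \<and> f (Aff x) = Aff (F x)"
    and Fc: "\<And>C. C \<in> \<pi> \<Longrightarrow> \<exists>C'\<in>\<pi>. f (Inf_pt C) = Inf_pt C' \<and> (\<forall>Y\<in>C. F ` Y \<in> C')"
    by (rule affine_part[OF aut inf]) blast
  obtain v where v: "v \<noteq> 0" "P = rstab v" using P unfolding sylow_iff by blast
  have vF: "v v* F g = v v* g" if g: "g \<in> carrier SL2" for g
  proof -
    have "F ` (P #>\<^bsub>SL2\<^esub> g) = P #>\<^bsub>SL2\<^esub> g"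
      using translation_fixes_class[OF tr C, of F "P #>\<^bsub>SL2\<^esub> g"] F coset_in_cosets_of[OF g] by blast
    moreover have "g \<in> P #>\<^bsub>SL2\<^esub> g" using g sylow_one[OF P] mem_r_coset_SL2[OF g, of g P] by simp
    ultimately have "F g \<in> P #>\<^bsub>SL2\<^esub> g" by blast
    then show ?thesis unfolding v(2) rstab_coset[OF g] by simp
  qed
  obtain w where w: "cross2 v w \<noteq> 0"
  proof (cases "v $ 1 = 0")
    case True
    then have "cross2 v (vector [1, 0]) \<noteq> 0" using v(1) by (auto simp: cross2_def vec2_eq_iff)
    then show ?thesis using that by blast
  next
    case False
    then have "cross2 v (vector [0, 1]) \<noteq> 0" by (auto simp: cross2_def)
    then show ?thesis using that by blast
  qed
  have w0: "w \<noteq> 0" using w by (auto simp: cross2_def)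
  let ?Q = "rstab w"
  have Q: "?Q \<in> sylow_subgroups p SL2" using rstab_sylow[OF w0] .
  have PQ: "P \<noteq> ?Q"
  proof
    assume eq: "P = ?Q"
    have "transvection v 1 \<in> ?Q" using transvection_in_rstab[of v 1] v eq by simp
    then have "w v* transvection v 1 = w" by (simp add: rstab_def)
    then have "cross2 w v = 0" using v(1) by (auto simp: transvection_apply vec2_eq_iff)
    then show False using w by (simp add: cross2_def algebra_simps)
  qed
  obtain C' where C': "C' \<in> \<pi>" "f (Inf_pt (cosets_of ?Q)) = Inf_pt C'" "\<And>Y. Y \<in> cosets_of ?Q \<Longrightarrow> F ` Y \<in> C'"
    using Fc[OF cosets_of_in_par[OF Q]] by blast
  obtain Q' where Q': "Q' \<in> sylow_subgroups p SL2" "C' = cosets_of Q'" using C'(1) unfolding par_iff by blast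
  have "P \<noteq> Q'"
  proof
    assume "P = Q'"
    then have "f (Inf_pt (cosets_of ?Q)) = f (Inf_pt ?C)" using C' Q' tr by (simp add: translation_def)
    then have "Inf_pt (cosets_of ?Q) = Inf_pt ?C"
      by (rule inj_onD[OF automorphism_inj[OF aut]]) (use C cosets_of_in_par[OF Q] in simp_all)
    then show False using cosets_of_inject[OF P Q] PQ by simp
  qed
  obtain w' where w': "w' \<noteq> 0" "Q' = rstab w'" using Q' unfolding sylow_iff by blast
  have c': "cross2 v w' \<noteq> 0" using rstab_neq_imp_cross2 \<open>P \<noteq> Q'\<close> v w' by blast
  have w'F: "w' v* F g = w' v* F h" if g: "g \<in> carrier SL2" "h \<in> carrier SL2" "w v* g = w v* h" for g h
  proof -
    have gh: "g \<in> ?Q #>\<^bsub>SL2\<^esub> h" "h \<in> ?Q #>\<^bsub>SL2\<^esub> h" unfolding rstab_coset[OF g(2)] using g by simp_all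
    obtain k where k: "k \<in> carrier SL2" "F ` (?Q #>\<^bsub>SL2\<^esub> h) = Q' #>\<^bsub>SL2\<^esub> k"
      using C'(3)[OF coset_in_cosets_of[OF g(2)]] unfolding Q'(2) cosets_of_def by blast
    have "F g \<in> Q' #>\<^bsub>SL2\<^esub> k" "F h \<in> Q' #>\<^bsub>SL2\<^esub> k" using gh k(2) by blast+
    then show ?thesis unfolding w'(2) rstab_coset[OF k(1)] by simp
  qed
  \<comment> \<open>The multiple of \<open>w'\<close> for which \<open>u v* F g\<close> can be
    compared with \<open>w v* g\<close>.\<close>
  define u where "u = (\<chi> i. cross2 v w / cross2 v w' * w' $ i)"
  have cu: "cross2 v u = cross2 v w" unfolding u_def cross2_scale using c' by simp
  have uF: "u v* F g = w v* g" if g: "g \<in> carrier SL2" for g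
  proof -
    \<comment> \<open>The defect \<open>d\<close> is orthogonal to \<open>v h\<close> for every h
      with \<open>w h = w g\<close>. Taking h = g and h = t g, with t a transvection fixing
      \<open>w\<close>, gives two independent vectors, so \<open>d\<close> vanishes.\<close>
    define d where "d = u v* F g - w v* g"
    have d: "cross2 (v v* h) d = 0" if h: "h \<in> carrier SL2" "w v* h = w v* g" for h
    proof -
      have "u v* F h = u v* F g" unfolding u_def scale_vm w'F[OF h(1) g h(2)] ..
      then have "d = u v* F h - w v* h" using h(2) by (simp add: d_def)
      then have "cross2 (v v* h) d = cross2 (v v* F h) (u v* F h) - cross2 (v v* h) (w v* h)"
        unfolding vF[OF h(1)] by (simp only: cross2_diff_right)
      also have "\<dots> = 0"
        unfolding cross2_mult[OF conjunct1[OF F[OF h(1)]]] cross2_mult[OF h(1)] cu by simp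
      finally show ?thesis .
    qed
    let ?t = "transvection w 1"
    have t: "?t \<in> carrier SL2" "w v* ?t = w" using transvection_in_rstab[of w 1] by (simp_all add: rstab_def)
    have "cross2 (v v* (?t ** g)) d = 0"
      by (rule d) (use t g in \<open>simp_all flip: vm_assoc\<close>)
    moreover have "v v* (?t ** g) = (\<chi> i. (v v* g) $ i + cross2 v w * (w v* g) $ i)"
      unfolding vm_assoc[symmetric] transvection_apply by (simp add: vec2_eq_iff algebra_simps)
    ultimately have "cross2 (v v* g) d + cross2 v w * cross2 (w v* g) d = 0"
      by (simp only: cross2_add_scale)
    then have "cross2 (w v* g) d = 0" unfolding d[OF g refl] using w by simp
    then have "d = 0" using cross2_eq_0[of "v v* g" "w v* g" d] d[OF g refl] cross2_mult[OF g] w by simp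
    then show ?thesis by (simp add: d_def)
  qed
  have one: "mat 1 \<in> carrier (SL2 :: 'a mat2 monoid)" by simp
  have "F (mat 1) ** g = F g" if g: "g \<in> carrier SL2" for g
  proof (rule cross2_rows_eq[of v u])
    show "cross2 v u \<noteq> 0" using cu w by simp
    show "v v* (F (mat 1) ** g) = v v* F g" unfolding vm_assoc[symmetric] vF[OF one] vF[OF g] by simp
    show "u v* (F (mat 1) ** g) = u v* F g" unfolding vm_assoc[symmetric] uF[OF one] uF[OF g] by simp
  qed
  then have "\<forall>g\<in>carrier SL2. f (Aff g) = Aff (F (mat 1) ** g)" using F by simp
  moreover have "F (mat 1) \<in> P" using vF[OF one] F[OF one] unfolding v(2) rstab_def by simp
  ultimately show ?thesis by blast
qed

text \<open>The conjugate of \<open>S\<close> is the image of the block \<open>S\<close> under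
  \<open>f\<close> followed by a right multiplication. Being a block with only affine points, it is
  long.\<close>

lemma left_mult_normalizes_S:
  assumes aut: "automorphism Pts Blks f" and x: "x \<in> carrier SL2"
    and f: "\<And>g. g \<in> carrier SL2 \<Longrightarrow> f (Aff g) = Aff (x ** g)"
  shows "(\<lambda>s. x ** s ** adj2 x) ` S = S"
proof (rule left_mult_conj_S[OF x])
  have "S #>\<^bsub>SL2\<^esub> mat 1 = S" using SL2.coset_mult_one[OF S_subset] by simp
  then have "S \<in> long_blocks S \<D>" unfolding long_blocks_def using mat_1_in_SL2 by blast
  then have "right_mult (adj2 x) ` f ` Aff ` S \<in> Blks"
    using right_mult_block[OF adj2_in_SL2[OF x] automorphism_block[OF aut long_block_mem]] by blast
  moreover have "right_mult (adj2 x) ` f ` Aff ` S = Aff ` (\<lambda>s. x ** s ** adj2 x) ` S"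
    unfolding image_image by (rule image_cong[OF refl]) (use f S_subset in auto)
  ultimately have "Aff ` (\<lambda>s. x ** s ** adj2 x) ` S \<in> Blks" by simp
  then show "(\<lambda>s. x ** s ** adj2 x) ` S \<in> long_blocks S \<D>"
  proof (cases rule: block_cases)
    case (long W)
    then show ?thesis by (simp add: inj_image_eq_iff inj_def)
  next
    case (short C Y)
    then have "Inf_pt C \<in> Aff ` (\<lambda>s. x ** s ** adj2 x) ` S" by simp
    then show ?thesis by blast
  next
    case infinity
    have "Aff (x ** mat 1 ** adj2 x) \<in> Aff ` (\<lambda>s. x ** s ** adj2 x) ` S" using S_one by blast
    then show ?thesis unfolding infinity by simp
  qed
qed

lemma left_mult_acts_as_left_mult:
  assumes aut: "automorphism Pts Blks f" and inf: "f ` infinity_block \<pi> = infinity_block \<pi>"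
    and x: "x \<in> carrier SL2" and f: "\<And>g. g \<in> carrier SL2 \<Longrightarrow> f (Aff g) = Aff (x ** g)"
  shows "acts_as_left_mult \<pi> x f"
proof -
  obtain F where F: "\<And>x. x \<in> carrier SL2 \<Longrightarrow> F x \<in> carrier SL2 \<and> f (Aff x) = Aff (F x)"
    and Fc: "\<And>C. C \<in> \<pi> \<Longrightarrow> \<exists>C'\<in>\<pi>. f (Inf_pt C) = Inf_pt C' \<and> (\<forall>Y\<in>C. F ` Y \<in> C')"
    by (rule affine_part[OF aut inf]) blast
  have Fx: "F g = x ** g" if "g \<in> carrier SL2" for g using F[OF that] f[OF that] by simp
  have "f (Inf_pt C) = Inf_pt ((\<lambda>Y. x <#\<^bsub>SL2\<^esub> Y) ` C)" if C: "C \<in> \<pi>" for C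
  proof -
    obtain C' where C': "C' \<in> \<pi>" "f (Inf_pt C) = Inf_pt C'" "\<And>Y. Y \<in> C \<Longrightarrow> F ` Y \<in> C'" using Fc[OF C] by blast
    have img: "x <#\<^bsub>SL2\<^esub> Y = F ` Y" if "Y \<in> C" for Y
      unfolding l_coset_SL2 by (rule image_cong[OF refl])
        (use Fx short_subset[OF class_short[OF C that]] in auto)
    have "(\<lambda>Y. x <#\<^bsub>SL2\<^esub> Y) ` C \<subseteq> C'" using img C'(3) by auto
    moreover have "card ((\<lambda>Y. x <#\<^bsub>SL2\<^esub> Y) ` C) = card C"
    proof (rule card_image, rule inj_onI)
      fix Y Z assume "x <#\<^bsub>SL2\<^esub> Y = x <#\<^bsub>SL2\<^esub> Z"
      then have "(\<lambda>h. adj2 x ** h) ` (\<lambda>h. x ** h) ` Y = (\<lambda>h. adj2 x ** h) ` (\<lambda>h. x ** h) ` Z"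
        unfolding l_coset_SL2 by simp
      then show "Y = Z" unfolding image_image adj2_cancel(1)[OF x] by simp
    qed
    ultimately have "(\<lambda>Y. x <#\<^bsub>SL2\<^esub> Y) ` C = C'"
      using card_class[OF C] card_class[OF C'(1)] card_subset_eq[of C'] by simp
    then show ?thesis using C' by simp
  qed
  then show ?thesis using f by (simp add: acts_as_left_mult_def)
qed

lemma translation_at_infinity:
  assumes tr: "translation Pts Blks (Inf_pt C) f" and C: "C \<in> \<pi>" and nt: "nontrivial_on Pts f"
  obtains P x where "P \<in> sylow_subgroups p SL2" "C = cosets_of P" "x \<in> P" "x \<noteq> mat 1"
    "(\<lambda>s. x ** s ** adj2 x) ` S = S" "\<And>g. g \<in> carrier SL2 \<Longrightarrow> f (Aff g) = Aff (x ** g)"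
    "acts_as_left_mult \<pi> x f"
proof -
  have aut: "automorphism Pts Blks f" using tr by (simp add: translation_def)
  note inf = translation_infinity_block[OF tr C]
  obtain P where P: "P \<in> sylow_subgroups p SL2" "C = cosets_of P" using C unfolding par_iff by blast
  obtain x where x: "x \<in> P" "\<And>g. g \<in> carrier SL2 \<Longrightarrow> f (Aff g) = Aff (x ** g)"
    using flat_translation[OF P(1)] tr P(2) by blast
  have xS: "x \<in> carrier SL2" using sylow_subset[OF P(1)] x(1) by blast
  have "x \<noteq> mat 1" using trivial_if_affine_trivial[OF aut inf] x(2) nt by auto
  then show thesis
    using that[OF P x(1) _ left_mult_normalizes_S[OF aut xS x(2)] x(2)] left_mult_acts_as_left_mult[OF aut inf xS x(2)]
    by blast
qed

section \<open>Moving affine centers to infinity\<close>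

lemma affine_center_moves_infinity:
  assumes tr: "translation Pts Blks (Aff g) f" and nt: "nontrivial_on Pts f" and C: "C \<in> \<pi>"
  shows "\<exists>h\<in>carrier SL2. f (Inf_pt C) = Aff h"
proof -
  have g: "g \<in> carrier SL2" and aut: "automorphism Pts Blks f" using tr by (auto simp: translation_def)
  \<comment> \<open>The block joining the center to the point at infinity is fixed, and its other
    points are affine.\<close>
  obtain B where B: "B \<in> Blks" "Aff g \<in> B" "Inf_pt C \<in> B" using ex_join[of "Aff g" "Inf_pt C"] g C by auto
  then have "B \<noteq> infinity_block \<pi>" by auto
  then obtain Y where Y: "B = insert (Inf_pt C) (Aff ` Y)" using block_with_inf_point[OF B(1,3)] by blast
  have "f ` B = B" using tr B unfolding translation_def by blast
  then have "f (Inf_pt C) \<in> B" using B by blast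
  moreover have "f (Inf_pt C) \<noteq> Inf_pt C" using translation_fixed_point[OF tr nt, of "Inf_pt C"] C by simp
  ultimately obtain h where "f (Inf_pt C) = Aff h" using Y by auto
  moreover have "f (Inf_pt C) \<in> Pts" using automorphism_in_Pts[OF aut] C by simp
  ultimately show ?thesis by auto
qed

text \<open>Right multiplication is transitive on affine points, so the image can be corrected to
  any prescribed \<open>k\<close>.\<close>

lemma affine_center_transfer:
  assumes tr: "translation Pts Blks (Aff g) f" and nt: "nontrivial_on Pts f" and C: "C \<in> \<pi>" and k: "k \<in> carrier SL2"
  shows "\<exists>\<alpha>. automorphism Pts Blks \<alpha> \<and> \<alpha> (Inf_pt C) = Aff k"
proof -
  obtain h where h: "h \<in> carrier SL2" "f (Inf_pt C) = Aff h" using affine_center_moves_infinity[OF tr nt C] by blast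
  have "automorphism Pts Blks (right_mult (adj2 h ** k) \<circ> f)"
    using tr right_mult_automorphism[of "adj2 h ** k"] h k by (intro automorphism_comp) (auto simp: translation_def)
  moreover have "(right_mult (adj2 h ** k) \<circ> f) (Inf_pt C) = Aff k" using h by simp
  ultimately show ?thesis by blast
qed

text \<open>Some automorphism takes \<open>Inf_pt C\<close> to the center \<open>Aff g\<close>;
  conjugating by its inverse brings the center to infinity.\<close>

lemma translation_transfer_to_infinity:
  assumes tr: "translation Pts Blks (Aff g) f" and nt: "nontrivial_on Pts f" and C: "C \<in> \<pi>"
  shows "\<exists>f'. translation Pts Blks (Inf_pt C) f' \<and> nontrivial_on Pts f'"
proof -
  have g: "g \<in> carrier SL2" and aut: "automorphism Pts Blks f" using tr by (auto simp: translation_def)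
  obtain \<alpha> where \<alpha>: "automorphism Pts Blks \<alpha>" "\<alpha> (Inf_pt C) = Aff g"
    using affine_center_transfer[OF tr nt C g] by blast
  let ?b = "inv_into Pts \<alpha>"
  have b: "automorphism Pts Blks ?b" by (rule automorphism_inv_into[OF \<alpha>(1) block_subset])
  have bg: "?b (Aff g) = Inf_pt C"
    using inv_into_f_f[OF automorphism_inj[OF \<alpha>(1)], of "Inf_pt C"] \<alpha>(2) C by simp
  have "translation Pts Blks (?b (Aff g)) (?b \<circ> f \<circ> inv_into Pts ?b)"
    by (rule translation_conjugate[OF tr b block_subset])
  moreover have "nontrivial_on Pts (?b \<circ> f \<circ> inv_into Pts ?b)"
    by (rule nontrivial_on_conjugate[OF nt]) (use aut b in \<open>auto simp: automorphism_def\<close>)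
  ultimately show ?thesis unfolding bg by blast
qed

lemma no_translation_odd:
  assumes odd: "odd (CARD('a))" and tr: "translation Pts Blks c f"
  shows "\<not> nontrivial_on Pts f"
proof
  assume nt: "nontrivial_on Pts f"
  have no_inf: False if "translation Pts Blks (Inf_pt C) f'" "C \<in> \<pi>" "nontrivial_on Pts f'" for C f'
    by (rule translation_at_infinity[OF that]) (rule no_sylow_element_normalizes_S_odd[OF odd])
  have c: "c \<in> Pts" using tr by (simp add: translation_def)
  show False
  proof (cases c)
    case (Aff g)
    have "\<pi> \<noteq> {}" using card_par by auto
    then obtain C where "C \<in> \<pi>" by blast
    then show False using translation_transfer_to_infinity[of g f C] tr nt Aff no_inf by blast
  next
    case (Inf_pt C)
    then show False using no_inf[of C f] tr nt c by simp
  qed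
qed

end

subsection \<open>The normalizer of \<open>S\<close> in characteristic 2\<close>

text \<open>A non-scalar matrix has an off-diagonal entry or a difference of diagonal entries that
  is not zero; dividing by it yields \<beta>. In other words, the centralizer consists of the
  polynomials in \<open>A\<close>.\<close>

lemma commuting_mat2:
  fixes A B :: "'a::field mat2"
  assumes comm: "A ** B = B ** A" and ns: "A \<noteq> (\<chi> i j. if i = j then A $ 1 $ 1 else 0)"
  shows "\<exists>\<alpha> \<beta>. B = (\<chi> i j. \<beta> * A $ i $ j + (if i = j then \<alpha> else 0))"
proof -
  have e: "A $ i $ 1 * B $ 1 $ j + A $ i $ 2 * B $ 2 $ j = B $ i $ 1 * A $ 1 $ j + B $ i $ 2 * A $ 2 $ j" for i j
    using arg_cong[OF comm, of "\<lambda>M. M $ i $ j"] unfolding mat2_mult .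
  obtain a b c d where A: "A $ 1 $ 1 = a" "A $ 1 $ 2 = b" "A $ 2 $ 1 = c" "A $ 2 $ 2 = d" by blast
  obtain a' b' c' d' where B: "B $ 1 $ 1 = a'" "B $ 1 $ 2 = b'" "B $ 2 $ 1 = c'" "B $ 2 $ 2 = d'" by blast
  have "a * a' + b * c' = a' * a + b' * c" "a * b' + b * d' = a' * b + b' * d" "c * a' + d * c' = c' * a + d' * c"
    using e[of 1 1] e[of 1 2] e[of 2 1] unfolding A B .
  note eq' = this
  have "b * c' - b' * c = (a * a' + b * c') - (a' * a + b' * c)"
    "a * b' + b * d' - a' * b - b' * d = (a * b' + b * d') - (a' * b + b' * d)"
    "c * a' + d * c' - c' * a - d' * c = (c * a' + d * c') - (c' * a + d' * c)"
    by (simp_all add: algebra_simps)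
  then have eq: "b * c' - b' * c = 0" "a * b' + b * d' - a' * b - b' * d = 0" "c * a' + d * c' - c' * a - d' * c = 0"
    unfolding eq' by simp_all
  have "b \<noteq> 0 \<or> c \<noteq> 0 \<or> a \<noteq> d" using ns unfolding mat2_eq_iff by (auto simp: A)
  then have "\<exists>\<alpha> \<beta>. a' = \<beta> * a + \<alpha> \<and> b' = \<beta> * b \<and> c' = \<beta> * c \<and> d' = \<beta> * d + \<alpha>"
  proof (elim disjE)
    assume b: "b \<noteq> 0"
    then obtain \<beta> where \<beta>: "b' = \<beta> * b" by (metis nonzero_eq_divide_eq)
    have "b * (c' - \<beta> * c) = b * c' - b' * c"
      "b * (d' - (\<beta> * d + (a' - \<beta> * a))) = a * b' + b * d' - a' * b - b' * d"
      unfolding \<beta> by (simp_all add: algebra_simps)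
    then have "c' = \<beta> * c" "d' = \<beta> * d + (a' - \<beta> * a)" using b unfolding eq by simp_all
    then show ?thesis using \<beta> by (intro exI[of _ "a' - \<beta> * a"] exI[of _ \<beta>]) simp
  next
    assume c: "c \<noteq> 0"
    then obtain \<beta> where \<beta>: "c' = \<beta> * c" by (metis nonzero_eq_divide_eq)
    have "c * (b' - \<beta> * b) = - (b * c' - b' * c)"
      "c * (d' - (\<beta> * d + (a' - \<beta> * a))) = - (c * a' + d * c' - c' * a - d' * c)"
      unfolding \<beta> by (simp_all add: algebra_simps)
    then have "b' = \<beta> * b" "d' = \<beta> * d + (a' - \<beta> * a)" using c unfolding eq by simp_all
    then show ?thesis using \<beta> by (intro exI[of _ "a' - \<beta> * a"] exI[of _ \<beta>]) simp
  next
    assume "a \<noteq> d"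
    then have ad: "a - d \<noteq> 0" by simp
    then obtain \<beta> where \<beta>: "a' - d' = \<beta> * (a - d)" by (metis nonzero_eq_divide_eq)
    then have d': "d' = a' - \<beta> * (a - d)" by (simp add: algebra_simps)
    have "(a - d) * (b' - \<beta> * b) = a * b' + b * d' - a' * b - b' * d"
      "(a - d) * (c' - \<beta> * c) = - (c * a' + d * c' - c' * a - d' * c)"
      unfolding d' by (simp_all add: algebra_simps)
    then have "b' = \<beta> * b" "c' = \<beta> * c" using ad unfolding eq by simp_all
    moreover have "d' = \<beta> * d + (a' - \<beta> * a)" unfolding d' by (simp add: algebra_simps)
    ultimately show ?thesis by (intro exI[of _ "a' - \<beta> * a"] exI[of _ \<beta>]) simp
  qed
  then obtain \<alpha> \<beta> where "a' = \<beta> * a + \<alpha> \<and> b' = \<beta> * b \<and> c' = \<beta> * c \<and> d' = \<beta> * d + \<alpha>" by blast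
  then have "B = (\<chi> i j. \<beta> * A $ i $ j + (if i = j then \<alpha> else 0))" unfolding mat2_eq_iff by (simp add: A B)
  then show ?thesis by blast
qed

text \<open>With \<open>N = (y, -x)(x, y)\<close>, one has \<open>N s + s N = tr(s) N + tr(N s)\<close>; in characteristic 2 the
  element \<open>1 + t N\<close> therefore inverts \<open>s\<close> if and only if \<open>t * tr(N s) = tr(s)\<close>.\<close>

lemma transvection_inverts_char_2:
  fixes s :: "'a::field mat2"
  assumes two: "(2 :: 'a) = 0" and t: "t * cross2 (v v* s) v = s $ 1 $ 1 + s $ 2 $ 2"
  shows "transvection v t ** s = adj2 s ** transvection v t"
proof -
  have *: "(1 + t * x * y) * a + t * y\<^sup>2 * c = d * (1 + t * x * y) + - b * (- t * x\<^sup>2)"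
    "(1 + t * x * y) * b + t * y\<^sup>2 * d = d * (t * y\<^sup>2) + - b * (1 - t * x * y)"
    "- t * x\<^sup>2 * a + (1 - t * x * y) * c = - c * (1 + t * x * y) + a * (- t * x\<^sup>2)"
    "- t * x\<^sup>2 * b + (1 - t * x * y) * d = - c * (t * y\<^sup>2) + a * (1 - t * x * y)"
    if E: "t * ((x * a + y * c) * y - (x * b + y * d) * x) = a + d" for a b c d x y :: 'a
  proof -
    have "(1 + t * x * y) * a + t * y\<^sup>2 * c - (d * (1 + t * x * y) + - b * (- t * x\<^sup>2))
        = t * ((x * a + y * c) * y - (x * b + y * d) * x) - (a + d) + 2 * a"
      "(1 + t * x * y) * b + t * y\<^sup>2 * d - (d * (t * y\<^sup>2) + - b * (1 - t * x * y)) = 2 * b"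
      "- t * x\<^sup>2 * a + (1 - t * x * y) * c - (- c * (1 + t * x * y) + a * (- t * x\<^sup>2)) = 2 * c"
      "- t * x\<^sup>2 * b + (1 - t * x * y) * d - (- c * (t * y\<^sup>2) + a * (1 - t * x * y))
        = t * ((x * a + y * c) * y - (x * b + y * d) * x) - (a + d) + 2 * d"
      by (simp_all add: algebra_simps power2_eq_square)
    note eq = this[unfolded E two]
    show "(1 + t * x * y) * a + t * y\<^sup>2 * c = d * (1 + t * x * y) + - b * (- t * x\<^sup>2)"
      by (rule iffD2[OF eq_iff_diff_eq_0], rule trans[OF eq(1)]) simp
    show "(1 + t * x * y) * b + t * y\<^sup>2 * d = d * (t * y\<^sup>2) + - b * (1 - t * x * y)"
      by (rule iffD2[OF eq_iff_diff_eq_0], rule trans[OF eq(2)]) simp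
    show "- t * x\<^sup>2 * a + (1 - t * x * y) * c = - c * (1 + t * x * y) + a * (- t * x\<^sup>2)"
      by (rule iffD2[OF eq_iff_diff_eq_0], rule trans[OF eq(3)]) simp
    show "- t * x\<^sup>2 * b + (1 - t * x * y) * d = - c * (t * y\<^sup>2) + a * (1 - t * x * y)"
      by (rule iffD2[OF eq_iff_diff_eq_0], rule trans[OF eq(4)]) simp
  qed
  show ?thesis
    unfolding mat2_eq_iff mat2_mult transvection_def mk2_nth adj2_nth
    by (intro conjI *) (use t in \<open>simp_all add: cross2_def\<close>)
qed

context sl2_unital
begin

context
  assumes p2: "p = 2"
begin

lemma two_eq_0: "(2 :: 'a) = 0"
  using CHAR_eq_prime[OF prime_p card_field] of_nat_CHAR[where ?'a = 'a] p2 by simp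

lemma neg_eq [simp]: "- z = (z :: 'a)"
proof -
  have "z + z = 2 * z" by simp
  then have "z + z = 0" unfolding two_eq_0 by simp
  then show ?thesis by (simp add: add_eq_0_iff)
qed

lemma double_eq_0: "z + z = (0 :: 'a)"
  using add.right_inverse[of z] unfolding neg_eq .

lemma sq_eq_1: "(l :: 'a)\<^sup>2 = 1 \<Longrightarrow> l = 1"
  by (auto simp: power2_eq_1_iff)

lemma even_card: "even (CARD('a))"
  using card_field e_pos p2 by simp

lemma S_power_card: "s \<in> S \<Longrightarrow> s [^]\<^bsub>SL2\<^esub> (CARD('a) + 1) = mat 1"
proof -
  assume s: "s \<in> S"
  interpret H: group "SL2\<lparr>carrier := S\<rparr>" by (rule SL2.subgroup_imp_group[OF subgroup_S])
  have "s [^]\<^bsub>SL2\<lparr>carrier := S\<rparr>\<^esub> Coset.order (SL2\<lparr>carrier := S\<rparr>) = \<one>\<^bsub>SL2\<lparr>carrier := S\<rparr>\<^esub>"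
    by (rule H.pow_order_eq_1) (use s in simp)
  then show ?thesis by (simp add: Coset.order_def card_S SL2.nat_pow_consistent[symmetric])
qed

text \<open>The eigenvalue satisfies l^(q+1) = 1 by the order of \<open>S\<close> and l^(q-1) = 1 as
  a unit of the field, so l^2 = 1 and l = 1. Then \<open>s\<close> lies in a Sylow subgroup, which
  meets \<open>S\<close> trivially.\<close>

lemma S_eigenvector:
  assumes s: "s \<in> S" and v: "v \<noteq> 0" "v v* s = (\<chi> i. l * v $ i)"
  shows "s = mat 1"
proof -
  have sS: "s \<in> carrier SL2" using s S_subset by blast
  have pow: "v v* (s [^]\<^bsub>SL2\<^esub> n) = (\<chi> i. l ^ n * v $ i)" for n :: nat
  proof (induction n)
    case (Suc n)
    have "v v* (s [^]\<^bsub>SL2\<^esub> Suc n) = (v v* (s [^]\<^bsub>SL2\<^esub> n)) v* s" unfolding vm_assoc by simp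
    also have "\<dots> = (\<chi> i. l ^ n * (\<chi> i. l * v $ i) $ i)" unfolding Suc scale_vm v(2) ..
    finally show ?case by (simp add: vec2_eq_iff ac_simps)
  qed (simp add: vec2_eq_iff)
  have "v = (\<chi> i. l ^ (CARD('a) + 1) * v $ i)" using pow[of "CARD('a) + 1"] S_power_card[OF s] by simp
  then have l1: "l ^ (CARD('a) + 1) = 1" using v(1) by (auto simp: vec2_eq_iff)
  then have "l \<noteq> 0" by auto
  then have "l ^ card (UNIV - {0 :: 'a}) = 1" by (intro power_card_mult_closed) auto
  then have l2: "l ^ (CARD('a) - 1) = 1" by (simp add: card_Diff_singleton)
  have "l ^ (CARD('a) + 1) = l ^ (CARD('a) - 1) * l\<^sup>2"
    using card_field_ge_2 by (simp flip: power_add)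
  then have "l\<^sup>2 = 1" using l1 l2 by simp
  then have "l = 1" by (rule sq_eq_1)
  then have "v v* s = v" unfolding v(2) by (simp add: vec2_eq_iff)
  then have "s \<in> rstab v" using sS unfolding rstab_def by blast
  then show ?thesis using S_inter_sylow[OF rstab_sylow[OF v(1)]] s by blast
qed

lemma commutes_with_sylow_element_even:
  assumes P: "P \<in> sylow_subgroups p SL2" and x: "x \<in> P" "x \<noteq> mat 1" and s: "s \<in> S" and comm: "x ** s = s ** x"
  shows "s = mat 1"
proof -
  obtain v where v: "v \<noteq> 0" "P = rstab v" using P unfolding sylow_iff by blast
  obtain l where "v v* s = (\<chi> i. l * v $ i)"
    using commutes_with_sylow_element[OF s _ x(2) v(1) comm] x(1) v(2) by blast
  then show ?thesis by (rule S_eigenvector[OF s v(1)])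
qed

lemma sylow_involution:
  fixes P :: "'a mat2 set"
  assumes P: "P \<in> sylow_subgroups p SL2" and x: "x \<in> P"
  shows "x ** x = mat 1" "adj2 x = x"
proof -
  obtain v where v: "v \<noteq> 0" "P = rstab v" using P unfolding sylow_iff by blast
  obtain t where t: "x = transvection v t" using x rstab_eq[OF v(1)] v(2) by blast
  have "t + t = 0" by (rule double_eq_0)
  then show xx: "x ** x = mat 1" unfolding t transvection_add by (simp only: transvection_0)
  have "x \<in> carrier SL2" using sylow_subset[OF P] x by blast
  then have "adj2 x ** (x ** x) = x" by simp
  then show "adj2 x = x" unfolding xx by simp
qed

text \<open>An automorphism of order 2 of a finite group without fixed points except the identity inverts
  every element, because \<open>s \<mapsto> s\<^sup>-\<^sup>1 s\<^sup>x\<close> is injective and hence surjective.\<close>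

lemma normalizing_element_inverts_S:
  assumes P: "P \<in> sylow_subgroups p SL2" and x: "x \<in> P" "x \<noteq> mat 1"
    and norm: "(\<lambda>s. x ** s ** adj2 x) ` S = S" and s: "s \<in> S"
  shows "x ** s ** x = adj2 s"
proof -
  note xx = sylow_involution[OF P x(1)]
  have cj: "x ** u ** x \<in> S" if "u \<in> S" for u using norm that xx(2) by auto
  have inj: "inj_on (\<lambda>u. adj2 u ** (x ** u ** x)) S"
  proof (rule inj_onI)
    fix u w assume u: "u \<in> S" and w: "w \<in> S" and eq: "adj2 u ** (x ** u ** x) = adj2 w ** (x ** w ** x)"
    have uS: "u \<in> carrier SL2" "w \<in> carrier SL2" using u w S_subset by auto
    let ?r = "w ** adj2 u"
    have "w ** (adj2 u ** (x ** u ** x)) = x ** w ** x" unfolding eq using uS by simp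
    then have "w ** (adj2 u ** (x ** u ** x)) ** x = x ** w ** x ** x" by simp
    then have "?r ** x ** u = x ** w" by (simp add: xx flip: matrix_mul_assoc)
    then have "?r ** x ** u ** adj2 u = x ** w ** adj2 u" by simp
    then have "?r ** x = x ** ?r" using uS by (simp flip: matrix_mul_assoc)
    then have "?r = mat 1"
      using commutes_with_sylow_element_even[OF P x, of ?r] S_mult[OF w S_inv[OF u]] by simp
    then have "?r ** u = u" by simp
    then show "u = w" using uS by simp
  qed
  have "(\<lambda>u. adj2 u ** (x ** u ** x)) ` S = S"
    by (rule card_subset_eq) (use inj cj S_mult S_inv in \<open>auto simp: card_image\<close>)
  then obtain u where u: "u \<in> S" "s = adj2 u ** (x ** u ** x)" using s by blast
  have uS: "u \<in> carrier SL2" using u S_subset by blast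
  have "x ** s ** x = (x ** adj2 u ** x) ** u"
    unfolding u(2) by (simp add: xx flip: matrix_mul_assoc)
  also have "\<dots> = adj2 s" unfolding u(2) adj2_mult xx(2) by (simp add: matrix_mul_assoc)
  finally show ?thesis .
qed

text \<open>The product of two such elements inverts twice and so centralizes \<open>S\<close>, but
  a non-trivial element of \<open>P\<close> commutes only with 1 in \<open>S\<close>.\<close>

lemma normalizing_element_unique:
  assumes P: "P \<in> sylow_subgroups p SL2" and x: "x \<in> P" "x \<noteq> mat 1" "(\<lambda>s. x ** s ** adj2 x) ` S = S"
    and y: "y \<in> P" "y \<noteq> mat 1" "(\<lambda>s. y ** s ** adj2 y) ` S = S"
  shows "x = y"
proof (rule ccontr)
  assume ne: "x \<noteq> y"
  note xx = sylow_involution[OF P x(1)] and yy = sylow_involution[OF P y(1)]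
  have xyP: "x ** y \<in> P"
    using subgroup.m_closed[of P SL2 x y] P x y by (auto simp: sylow_subgroups_def)
  have "x ** y \<noteq> mat 1"
  proof
    assume "x ** y = mat 1"
    then have "x ** (x ** y) = x" by simp
    then show False using ne unfolding matrix_mul_assoc xx by simp
  qed
  moreover have "(x ** y) ** s = s ** (x ** y)" if s: "s \<in> S" for s
  proof -
    have "y ** s ** y = adj2 s" by (rule normalizing_element_inverts_S[OF P y s])
    then have "y ** s ** y ** y = adj2 s ** y" by simp
    then have 1: "y ** s = adj2 s ** y" by (simp add: yy flip: matrix_mul_assoc)
    have "x ** adj2 s ** x = adj2 (adj2 s)" by (rule normalizing_element_inverts_S[OF P x S_inv[OF s]])
    then have "x ** adj2 s ** x ** x = s ** x" by simp
    then have 2: "x ** adj2 s = s ** x" by (simp add: xx flip: matrix_mul_assoc)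
    have "(x ** y) ** s = x ** (adj2 s ** y)" using 1 by (simp flip: matrix_mul_assoc)
    also have "\<dots> = (s ** x) ** y" using 2 by (simp add: matrix_mul_assoc)
    finally show ?thesis by (simp add: matrix_mul_assoc)
  qed
  ultimately have "S \<subseteq> {mat 1}" using commutes_with_sylow_element_even[OF P xyP] by blast
  then have "card S \<le> card {mat 1 :: 'a mat2}" by (intro card_mono) auto
  then show False using card_S card_field_ge_2 by simp
qed

text \<open>\<open>S\<close> has odd order, so \<open>s\<close> is a power of its square.\<close>

lemma S_square_root:
  assumes s: "s \<in> S" and comm: "(s ** s) ** t = t ** (s ** s)"
  shows "s ** t = t ** s"
proof -
  have sS: "s \<in> carrier SL2" using s S_subset by blast
  obtain k where k: "CARD('a) = 2 * k" using even_card by (rule dvdE)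
  have "(s ** s) [^]\<^bsub>SL2\<^esub> n ** t = t ** (s ** s) [^]\<^bsub>SL2\<^esub> n" for n :: nat
  proof (induction n)
    case (Suc n)
    have "(s ** s) [^]\<^bsub>SL2\<^esub> Suc n ** t = (s ** s) [^]\<^bsub>SL2\<^esub> n ** ((s ** s) ** t)" by (simp add: matrix_mul_assoc)
    also have "\<dots> = ((s ** s) [^]\<^bsub>SL2\<^esub> n ** t) ** (s ** s)" unfolding comm by (simp add: matrix_mul_assoc)
    also have "\<dots> = t ** (s ** s) [^]\<^bsub>SL2\<^esub> Suc n" unfolding Suc by (simp add: matrix_mul_assoc)
    finally show ?case .
  qed simp
  moreover have "(s ** s) [^]\<^bsub>SL2\<^esub> (k + 1) = s"
  proof -
    have "s [^]\<^bsub>SL2\<^esub> (2::nat) = s ** s" using sS by (simp add: numeral_2_eq_2)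
    then have "(s ** s) [^]\<^bsub>SL2\<^esub> (k + 1) = s [^]\<^bsub>SL2\<^esub> (2 * (k + 1))" using SL2.nat_pow_pow[OF sS, of 2 "k + 1"] by simp
    \<comment> \<open>The exponent is the order of \<open>S\<close> plus 1.\<close>
    also have "2 * (k + 1) = Suc (CARD('a) + 1)" using k by simp
    also have "s [^]\<^bsub>SL2\<^esub> Suc (CARD('a) + 1) = s [^]\<^bsub>SL2\<^esub> (CARD('a) + 1) \<otimes>\<^bsub>SL2\<^esub> s" by (rule SL2.nat_pow_Suc)
    finally show ?thesis unfolding S_power_card[OF s] by simp
  qed
  ultimately show ?thesis by metis
qed

lemma S_self_inverse: "s \<in> S \<Longrightarrow> s ** s = mat 1 \<Longrightarrow> s = mat 1"
proof -
  assume s: "s \<in> S" and ss: "s ** s = mat 1"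
  have sS: "s \<in> carrier SL2" using s S_subset by blast
  obtain k where k: "CARD('a) = 2 * k" using even_card by (rule dvdE)
  have "s [^]\<^bsub>SL2\<^esub> (2::nat) = mat 1" using sS ss by (simp add: numeral_2_eq_2)
  then have "s [^]\<^bsub>SL2\<^esub> (2 * k) = \<one>\<^bsub>SL2\<^esub> [^]\<^bsub>SL2\<^esub> k" using SL2.nat_pow_pow[OF sS, of 2 k] by simp
  then have "s [^]\<^bsub>SL2\<^esub> CARD('a) = mat 1" using k SL2.nat_pow_one[of k] by simp
  moreover have "s [^]\<^bsub>SL2\<^esub> (CARD('a) + 1) = s [^]\<^bsub>SL2\<^esub> CARD('a) ** s" by simp
  ultimately show "s = mat 1" using S_power_card[OF s] by simp
qed

lemma S_not_scalar:
  assumes s: "s \<in> S" "s \<noteq> mat 1"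
  shows "s \<noteq> (\<chi> i j. if i = j then s $ 1 $ 1 else 0)"
proof
  assume "s = (\<chi> i j. if i = j then s $ 1 $ 1 else 0)"
  then have e: "s $ 1 $ 2 = 0" "s $ 2 $ 1 = 0" "s $ 2 $ 2 = s $ 1 $ 1" unfolding mat2_eq_iff by simp_all
  have "s \<in> carrier SL2" using s S_subset by blast
  then have "(s $ 1 $ 1)\<^sup>2 = 1" unfolding SL2_carrier e by (simp add: power2_eq_square)
  then have "s $ 1 $ 1 = 1" by (rule sq_eq_1)
  then show False using s(2) e by (simp add: mat2_eq_iff)
qed

text \<open>In characteristic 2, trace zero means that \<open>s\<close> equals its adjugate, so
  \<open>s\<close> would be an involution in a group of odd order.\<close>

lemma S_trace:
  assumes s: "s \<in> S" "s \<noteq> mat 1"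
  shows "s $ 1 $ 1 + s $ 2 $ 2 \<noteq> 0"
proof
  assume tr: "s $ 1 $ 1 + s $ 2 $ 2 = 0"
  have sS: "s \<in> carrier SL2" using s S_subset by blast
  have "s $ 1 $ 1 = s $ 2 $ 2" using tr by (simp add: add_eq_0_iff)
  then have "adj2 s = s" unfolding mat2_eq_iff by simp
  then have "s ** s = mat 1" using adj2_mult_left[OF sS] by simp
  then show False using S_self_inverse s by blast
qed

text \<open>By \<open>commuting_mat2\<close>, \<open>s\<close> is a linear polynomial in
  \<open>t\<close>, so it commutes with whatever commutes with \<open>t\<close>. Hence centralizers
  of non-trivial elements of \<open>S\<close> are abelian.\<close>

lemma commuting_trans:
  assumes s: "s \<in> S" "s \<noteq> mat 1" and t: "t \<in> S" "t \<noteq> mat 1" and st: "s ** t = t ** s" and u: "t ** u = u ** t"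
  shows "s ** u = u ** s"
proof -
  obtain \<alpha> \<beta> where *: "s = (\<chi> i j. \<beta> * t $ i $ j + (if i = j then \<alpha> else 0))"
    using commuting_mat2[OF st[symmetric] S_not_scalar[OF t]] by blast
  have "(\<chi> i j. \<beta> * t $ i $ j + (if i = j then \<alpha> else 0)) ** u = (\<chi> i j. \<beta> * (t ** u) $ i $ j + \<alpha> * u $ i $ j)"
    unfolding mat2_eq_iff by (simp add: algebra_simps)
  moreover have "u ** (\<chi> i j. \<beta> * t $ i $ j + (if i = j then \<alpha> else 0)) = (\<chi> i j. \<beta> * (u ** t) $ i $ j + \<alpha> * u $ i $ j)"
    unfolding mat2_eq_iff by (simp add: algebra_simps)
  ultimately show ?thesis using * u by metis
qed

text \<open>A conjugate of \<open>t\<close> that commutes with \<open>t\<close> has the same characteristic polynomial, hence is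
  \<open>t\<close> or its inverse; the latter is impossible in a group of odd order.\<close>

lemma commuting_conjugate:
  assumes t: "t \<in> S" "t \<noteq> mat 1" and g: "g \<in> S" and comm: "t ** (g ** t ** adj2 g) = (g ** t ** adj2 g) ** t"
  shows "g ** t = t ** g"
proof -
  let ?c = "g ** t ** adj2 g"
  let ?T = "t $ 1 $ 1 + t $ 2 $ 2"
  have gS: "g \<in> carrier SL2" and tS: "t \<in> carrier SL2" using g t S_subset by auto
  have cS: "?c \<in> carrier SL2" using gS tS by simp
  obtain \<alpha> \<beta> where *: "?c = (\<chi> i j. \<beta> * t $ i $ j + (if i = j then \<alpha> else 0))"
    using commuting_mat2[OF comm S_not_scalar[OF t]] by blast
  have "?c $ 1 $ 1 + ?c $ 2 $ 2 = (g $ 1 $ 1 * g $ 2 $ 2 - g $ 1 $ 2 * g $ 2 $ 1) * ?T"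
    unfolding mat2_mult adj2_nth by (simp add: algebra_simps del: neg_eq)
  then have "?c $ 1 $ 1 + ?c $ 2 $ 2 = ?T" using gS unfolding SL2_carrier by simp
  \<comment> \<open>Equal traces give \<beta> = 1, since the trace of \<open>t\<close> is not zero;
    equal determinants then leave two values for \<alpha>.\<close>
  then have "\<beta> * ?T + 2 * \<alpha> = ?T" unfolding * by (simp add: algebra_simps)
  then have \<beta>: "\<beta> = 1" using S_trace[OF t] unfolding two_eq_0 by simp
  have "(t $ 1 $ 1 + \<alpha>) * (t $ 2 $ 2 + \<alpha>) - t $ 1 $ 2 * t $ 2 $ 1 = 1"
    using cS unfolding * \<beta> SL2_carrier by simp
  then have "\<alpha> * (\<alpha> + ?T) = 0" using tS unfolding SL2_carrier by (simp add: algebra_simps)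
  then have "\<alpha> = 0 \<or> \<alpha> = ?T" by (auto simp: add_eq_0_iff2)
  then show ?thesis
  proof
    assume "\<alpha> = 0"
    then have "?c = t" unfolding * \<beta> by (simp add: mat2_eq_iff)
    then have "?c ** g = t ** g" by simp
    then show ?thesis using gS by simp
  next
    assume \<alpha>: "\<alpha> = ?T"
    \<comment> \<open>Adding the trace to the diagonal produces the adjugate in characteristic 2. So
      \<open>g\<close> inverts \<open>t\<close>, and its square centralizes
      \<open>t\<close>.\<close>
    have ct: "?c = adj2 t"
      unfolding * \<beta> \<alpha> mat2_eq_iff by (simp add: two_eq_0)
    have "adj2 ?c = g ** adj2 t ** adj2 g" by (simp add: adj2_mult matrix_mul_assoc)
    then have "t = g ** adj2 t ** adj2 g" unfolding ct by simp
    also have "\<dots> = g ** ?c ** adj2 g" unfolding ct ..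
    finally have "t ** (g ** g) = (g ** ?c ** adj2 g) ** (g ** g)" by simp
    also have "\<dots> = (g ** g) ** t" using gS by (simp add: matrix_mul_assoc)
    finally show ?thesis by (intro S_square_root[OF g]) simp
  qed
qed

section \<open>Counting conjugates of centralizers in \<open>S\<close>\<close>

definition centralizer_S :: "'a mat2 \<Rightarrow> 'a mat2 set" where
  "centralizer_S s = {t \<in> S. s ** t = t ** s}"

definition conjugates_S :: "'a mat2 \<Rightarrow> 'a mat2 set" where
  "conjugates_S s = (\<lambda>(g, t). g ** t ** adj2 g) ` (S \<times> (centralizer_S s - {mat 1}))"

lemma conjugates_S_iff:
  "w \<in> conjugates_S s \<longleftrightarrow> (\<exists>g\<in>S. \<exists>t\<in>centralizer_S s. t \<noteq> mat 1 \<and> w = g ** t ** adj2 g)"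
  unfolding conjugates_S_def by (simp add: image_iff) blast

lemma conj_S: "g \<in> S \<Longrightarrow> t \<in> S \<Longrightarrow> g ** t ** adj2 g \<in> S"
  by (intro S_mult S_inv)

lemma conj_S_eq_one:
  assumes "g \<in> S" "g ** t ** adj2 g = mat 1"
  shows "t = mat 1"
proof -
  have g: "g \<in> carrier SL2" using assms S_subset by blast
  have "adj2 g ** (g ** t ** adj2 g) ** g = mat 1" unfolding assms(2) using g by simp
  then show ?thesis using g by (simp add: matrix_mul_assoc)
qed

lemma conjugates_S_subset: "conjugates_S s \<subseteq> S - {mat 1}"
proof
  fix w assume "w \<in> conjugates_S s"
  then obtain g t where gt: "g \<in> S" "t \<in> centralizer_S s" "t \<noteq> mat 1" "w = g ** t ** adj2 g"
    unfolding conjugates_S_iff by blast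
  then have "t \<in> S" by (simp add: centralizer_S_def)
  then show "w \<in> S - {mat 1}" using conj_S[OF gt(1), of t] conj_S_eq_one[OF gt(1), of t] gt(3,4) by auto
qed

lemma conj_conj:
  assumes "g \<in> carrier SL2" "h \<in> carrier SL2" "g ** t ** adj2 g = h ** u ** adj2 h"
  shows "t = (adj2 g ** h) ** u ** adj2 (adj2 g ** h)"
proof -
  have "adj2 g ** (g ** t ** adj2 g) ** g = adj2 g ** (h ** u ** adj2 h) ** g" unfolding assms(3) ..
  then show ?thesis using assms(1) by (simp add: matrix_mul_assoc adj2_mult)
qed

text \<open>If conjugates of two elements t and t' of the centralizer agree, then t and t' commute,
  so by \<open>commuting_conjugate\<close> the conjugating element centralizes t' and t = t'. Every
  fiber of (g, t) -> g t g^-1 is therefore as large as the centralizer.\<close>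

lemma card_conjugates_S:
  assumes s: "s \<in> S" "s \<noteq> mat 1"
  shows "card (conjugates_S s) * card (centralizer_S s) = card S * (card (centralizer_S s) - 1)"
proof -
  let ?H = "centralizer_S s" and ?f = "\<lambda>(g, t). g ** t ** adj2 g"
  let ?A = "S \<times> (?H - {mat 1})"
  have fiber: "card {a \<in> ?A. ?f a = w} = card ?H" if w: "w \<in> conjugates_S s" for w
  proof -
    obtain g t where gt: "g \<in> S" "t \<in> ?H" "t \<noteq> mat 1" "w = g ** t ** adj2 g"
      using w unfolding conjugates_S_def by auto
    have gS: "g \<in> carrier SL2" using gt S_subset by blast
    have t: "t \<in> S" "s ** t = t ** s" using gt(2) by (auto simp: centralizer_S_def)
    have "{a \<in> ?A. ?f a = w} = (\<lambda>k. (g ** k, t)) ` ?H"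
    proof (intro equalityI subsetI)
      fix a assume "a \<in> {a \<in> ?A. ?f a = w}"
      then obtain g' t' where a: "a = (g', t')" "g' \<in> S" "t' \<in> ?H" "t' \<noteq> mat 1" "g' ** t' ** adj2 g' = w" by auto
      have g'S: "g' \<in> carrier SL2" using a S_subset by blast
      have t': "t' \<in> S" "s ** t' = t' ** s" using a(3) by (auto simp: centralizer_S_def)
      let ?k = "adj2 g ** g'"
      have k: "?k \<in> S" by (intro S_mult S_inv gt a)
      have kS: "?k \<in> carrier SL2" using k S_subset by blast
      have tk: "t = ?k ** t' ** adj2 ?k" by (rule conj_conj[OF gS g'S]) (simp add: gt a)
      have "t' ** t = t ** t'"
        by (rule commuting_trans[OF t'(1) a(4) s _ t(2)]) (use t' in simp)
      then have kt': "?k ** t' = t' ** ?k"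
        by (intro commuting_conjugate[OF t'(1) a(4) k]) (simp flip: tk)
      then have "t = t'" using tk kS by (metis adj2_cancel(3))
      moreover have "s ** ?k = ?k ** s"
        by (rule commuting_trans[OF s t'(1) a(4) t'(2)]) (simp add: kt')
      then have "?k \<in> ?H" using k by (simp add: centralizer_S_def)
      moreover have "g' = g ** ?k" using gS by simp
      ultimately show "a \<in> (\<lambda>k. (g ** k, t)) ` ?H" using a(1) by blast
    next
      fix a assume "a \<in> (\<lambda>k. (g ** k, t)) ` ?H"
      then obtain k where k: "k \<in> ?H" "a = (g ** k, t)" by blast
      have k': "k \<in> S" "s ** k = k ** s" using k by (auto simp: centralizer_S_def)
      have kS: "k \<in> carrier SL2" using k' S_subset by blast
      have "t ** k = k ** t"
        by (rule commuting_trans[OF t(1) gt(3) s _ k'(2)]) (use t in simp)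
      then have "g ** k ** t ** adj2 (g ** k) = g ** t ** k ** adj2 k ** adj2 g"
        by (simp add: adj2_mult matrix_mul_assoc) (simp flip: matrix_mul_assoc)
      also have "\<dots> = w" using kS gt(4) by simp
      finally show "a \<in> {a \<in> ?A. ?f a = w}" using k gt S_mult[OF gt(1) k'(1)] by simp
    qed
    moreover have "inj_on (\<lambda>k. (g ** k, t)) ?H"
      by (rule inj_onI) (metis Pair_inject adj2_cancel(1) gS)
    ultimately show ?thesis by (simp add: card_image)
  qed
  have "?A = (\<Union>w\<in>conjugates_S s. {a \<in> ?A. ?f a = w})" unfolding conjugates_S_def by blast
  then have "card ?A = card (\<Union>w\<in>conjugates_S s. {a \<in> ?A. ?f a = w})" by simp
  also have "\<dots> = (\<Sum>w\<in>conjugates_S s. card {a \<in> ?A. ?f a = w})"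
    by (rule card_UN_disjoint) auto
  also have "\<dots> = card (conjugates_S s) * card ?H" using fiber by simp
  finally show ?thesis by (simp add: card_cartesian_product card_Diff_singleton centralizer_S_def)
qed

text \<open>1, \<open>s\<close> and its inverse are distinct because \<open>S\<close> has odd
  order.\<close>

lemma centralizer_S_ge_3:
  assumes s: "s \<in> S" "s \<noteq> mat 1"
  shows "card (centralizer_S s) \<ge> 3"
proof -
  have sS: "s \<in> carrier SL2" using s S_subset by blast
  have "adj2 s \<noteq> s" using S_self_inverse[OF s(1)] s(2) adj2_mult_left[OF sS] by auto
  moreover have "adj2 s \<noteq> mat 1" using s(2) by (metis adj2_adj2 adj2_one)
  ultimately have "card {mat 1, s, adj2 s} = 3" using s(2) by auto
  moreover have "{mat 1, s, adj2 s} \<subseteq> centralizer_S s" using s S_inv[OF s(1)] sS by (auto simp: centralizer_S_def)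
  ultimately show ?thesis by (metis card_mono finite)
qed

text \<open>Conjugates of the centralizer of one element already cover two thirds of \<open>S\<close>, so any two
  centralizers are conjugate, and a single class of them covers \<open>S\<close>; this forces the centralizer to be \<open>S\<close>.\<close>

lemma S_abelian:
  assumes s: "s \<in> S" and t: "t \<in> S"
  shows "s ** t = t ** s"
proof (cases "s = mat 1")
  case False
  \<comment> \<open>A proportion 1 - 1/h of \<open>S\<close> is covered, where h >= 3.\<close>
  have big: "3 * card (conjugates_S u) \<ge> 2 * card S" if u: "u \<in> S" "u \<noteq> mat 1" for u
  proof -
    let ?h = "card (centralizer_S u)"
    have h: "?h \<ge> 3" by (rule centralizer_S_ge_3[OF u])
    have "(2 * card S) * ?h \<le> 3 * (card S * (?h - 1))"
    proof -
      have "2 * ?h \<le> 3 * (?h - 1)" using h by linarith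
      then have "card S * (2 * ?h) \<le> card S * (3 * (?h - 1))" by (rule mult_le_mono2)
      then show ?thesis by (simp add: mult.commute mult.left_commute)
    qed
    also have "\<dots> = (3 * card (conjugates_S u)) * ?h" using card_conjugates_S[OF u] by simp
    finally show ?thesis using h by simp
  qed
  have cover: "u \<in> conjugates_S s" if u: "u \<in> S" "u \<noteq> mat 1" for u
  proof -
    have "conjugates_S s \<inter> conjugates_S u \<noteq> {}"
    proof
      assume "conjugates_S s \<inter> conjugates_S u = {}"
      then have "card (conjugates_S s) + card (conjugates_S u) = card (conjugates_S s \<union> conjugates_S u)"
        by (simp add: card_Un_disjoint)
      also have "\<dots> \<le> card (S - {mat 1})" by (rule card_mono) (use conjugates_S_subset in auto)
      also have "\<dots> < card S" using card_S by simp
      finally show False using big[OF s False] big[OF u] by linarith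
    qed
    then obtain w where "w \<in> conjugates_S s" "w \<in> conjugates_S u" by blast
    then obtain g a h b where ga: "g \<in> S" "a \<in> centralizer_S s" "a \<noteq> mat 1" "w = g ** a ** adj2 g"
      and hb: "h \<in> S" "b \<in> centralizer_S u" "b \<noteq> mat 1" "w = h ** b ** adj2 h"
      unfolding conjugates_S_iff by blast
    have gS: "g \<in> carrier SL2" and hS: "h \<in> carrier SL2" using ga hb S_subset by auto
    have a: "a \<in> S" "s ** a = a ** s" and b: "b \<in> S" "u ** b = b ** u" using ga hb by (auto simp: centralizer_S_def)
    define k where "k = adj2 g ** h"
    have k: "k \<in> S" unfolding k_def by (intro S_mult S_inv ga hb)
    have kS: "k \<in> carrier SL2" using k S_subset by blast
    have ak: "a = k ** b ** adj2 k" unfolding k_def by (rule conj_conj[OF gS hS]) (use ga hb in simp)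
    let ?c = "k ** u ** adj2 k"
    have cS: "?c \<in> S" by (rule conj_S[OF k u(1)])
    have "a ** ?c = k ** (b ** u) ** adj2 k" "?c ** a = k ** (u ** b) ** adj2 k"
      unfolding ak using kS by (simp_all add: matrix_mul_assoc)
    then have "a ** ?c = ?c ** a" using b by simp
    then have "s ** ?c = ?c ** s" by (rule commuting_trans[OF s False a(1) ga(3) a(2)])
    moreover have "?c \<noteq> mat 1" using conj_S_eq_one[OF k] u(2) by blast
    moreover have "?c \<in> centralizer_S s" using cS calculation(1) by (simp add: centralizer_S_def)
    moreover have "u = adj2 k ** ?c ** adj2 (adj2 k)" using kS by (simp add: matrix_mul_assoc)
    ultimately show ?thesis unfolding conjugates_S_iff using S_inv[OF k] by blast
  qed
  let ?h = "card (centralizer_S s)"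
  have "conjugates_S s = S - {mat 1}" using cover conjugates_S_subset by blast
  \<comment> \<open>The count reads (n - 1) h = n (h - 1) for n = \<open>card S\<close>, whence h =
    n.\<close>
  then have "(card S - 1) * ?h = card S * (?h - 1)" using card_conjugates_S[OF s False] by (simp add: card_Diff_singleton)
  moreover obtain n where n: "?h = Suc n" using centralizer_S_ge_3[OF s False] by (cases ?h) auto
  ultimately have "CARD('a) * Suc n = Suc (CARD('a)) * n" using card_S by simp
  then have "?h = card S" using n card_S by simp
  then have "centralizer_S s = S" by (intro card_subset_eq) (auto simp: centralizer_S_def)
  then show ?thesis using t unfolding centralizer_S_def by blast
qed simp

text \<open>The transvection parameter makes \<open>x\<close> invert one chosen \<open>s\<close>; it
  is defined and non-zero because \<open>s\<close> has no eigenvector and non-zero trace. As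
  \<open>S\<close> is abelian, its elements have the form \<beta> s + \<alpha>, and their adjugates
  are the same combinations of \<open>adj2 s\<close>, so \<open>x\<close> inverts them all.\<close>

lemma normalizing_element_exists:
  assumes P: "P \<in> sylow_subgroups p SL2"
  shows "\<exists>x. x \<in> P \<and> x \<noteq> mat 1 \<and> (\<lambda>s. x ** s ** adj2 x) ` S = S"
proof -
  obtain v where v: "v \<noteq> 0" "P = rstab v" using P unfolding sylow_iff by blast
  have "\<not> S \<subseteq> {mat 1}"
  proof
    assume "S \<subseteq> {mat 1}"
    then have "card S \<le> card {mat 1 :: 'a mat2}" by (intro card_mono) auto
    then show False using card_S card_field_ge_2 by simp
  qed
  then obtain s where s: "s \<in> S" "s \<noteq> mat 1" by blast
  let ?T = "s $ 1 $ 1 + s $ 2 $ 2" and ?c = "cross2 (v v* s) v"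
  have T: "?T \<noteq> 0" by (rule S_trace[OF s])
  have c: "?c \<noteq> 0"
  proof
    assume "?c = 0"
    then have "cross2 v (v v* s) = 0" unfolding cross2_def by (simp add: algebra_simps)
    then obtain l where "v v* s = (\<chi> i. l * v $ i)" using cross2_0_scale v(1) by blast
    then show False using S_eigenvector[OF s(1) v(1)] s(2) by blast
  qed
  define x where "x = transvection v (?T / ?c)"
  have xP: "x \<in> P" unfolding x_def v(2) by (rule transvection_in_rstab)
  have xS: "x \<in> carrier SL2" using sylow_subset[OF P] xP by blast
  have x1: "x \<noteq> mat 1"
    unfolding x_def transvection_0[of v, symmetric] transvection_inject[OF v(1)] using T c by simp
  have xs: "x ** s = adj2 s ** x"
    unfolding x_def by (rule transvection_inverts_char_2[OF two_eq_0]) (use c in simp)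
  have conj: "x ** t ** adj2 x = adj2 t" if t: "t \<in> S" for t
  proof -
    obtain \<alpha> \<beta> where *: "t = (\<chi> i j. \<beta> * s $ i $ j + (if i = j then \<alpha> else 0))"
      using commuting_mat2[OF S_abelian[OF s(1) t] S_not_scalar[OF s]] by blast
    have "x ** t = (\<chi> i j. \<beta> * (x ** s) $ i $ j + \<alpha> * x $ i $ j)"
      unfolding * mat2_eq_iff by (simp add: algebra_simps)
    also have "\<dots> = adj2 t ** x"
      unfolding xs * mat2_eq_iff by (simp add: algebra_simps)
    finally show ?thesis using xS by simp
  qed
  have "(\<lambda>s. x ** s ** adj2 x) ` S = adj2 ` S" using conj by (intro image_cong) auto
  also have "\<dots> = S"
    using S_inv adj2_adj2 by (metis (no_types, lifting) image_subsetI subsetI subset_antisym image_eqI)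
  finally show ?thesis using xP x1 by blast
qed

end

end

context sl2_unital
begin

lemma conj_rstab:
  fixes v :: "'a ^ 2"
  assumes "g \<in> carrier SL2"
  shows "(\<lambda>x. g ** x ** adj2 g) ` rstab v = rstab (v v* adj2 g)"
proof -
  have "rstab u = row_fiber u u" for u :: "'a ^ 2" by (simp add: rstab_def row_fiber_def)
  then show ?thesis using row_fiber_mult[OF assms adj2_in_SL2[OF assms], of v v] by simp
qed

lemma conj_sylow:
  fixes g :: "'a mat2"
  assumes "g \<in> carrier SL2" "P \<in> sylow_subgroups p SL2"
  shows "(\<lambda>x. g ** x ** adj2 g) ` P \<in> sylow_subgroups p SL2"
proof -
  obtain v where v: "v \<noteq> 0" "P = rstab v" using assms(2) unfolding sylow_iff by blast
  show ?thesis unfolding v(2) conj_rstab[OF assms(1)]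
    by (rule rstab_sylow) (use v assms in simp)
qed

end

context flat_unital
begin

lemma card_sylow_subgroups: "card (sylow_subgroups p (SL2 :: 'a mat2 monoid)) = CARD('a) + 1"
proof -
  have "\<pi> = cosets_of ` sylow_subgroups p SL2" using par_iff by auto
  moreover have "inj_on cosets_of (sylow_subgroups p SL2)" by (intro inj_onI cosets_of_inject)
  ultimately show ?thesis using card_par by (simp add: card_image)
qed

end

section \<open>The dihedral group formed by \<open>S\<close> and the normalizing involutions\<close>

locale even_flat_unital = flat_unital +
  assumes p2: "p = 2"
begin

text \<open>Normalizing \<open>rstab v\<close> preserves the line of \<open>v\<close>, so
  \<open>v\<close> is an eigenvector of the inverse of \<open>s\<close>.\<close>

lemma S_normalizes_sylow:
  assumes P: "P \<in> sylow_subgroups p SL2" and s: "s \<in> S" and norm: "(\<lambda>x. s ** x ** adj2 s) ` P = P"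
  shows "s = mat 1"
proof -
  obtain v where v: "v \<noteq> 0" "P = rstab v" using P unfolding sylow_iff by blast
  have sS: "s \<in> carrier SL2" using s S_subset by blast
  have "rstab (v v* adj2 s) = rstab v" using norm conj_rstab[OF sS, of v] v(2) by simp
  then have "transvection (v v* adj2 s) 1 \<in> rstab v" using transvection_in_rstab by blast
  then have "v v* transvection (v v* adj2 s) 1 = v" by (simp add: rstab_def)
  then have *: "cross2 v (v v* adj2 s) * (v v* adj2 s) $ i = 0" for i
    unfolding transvection_apply by (auto simp: vec_eq_iff simp del: vec2_mult)
  have "v v* adj2 s \<noteq> 0" using v(1) sS by simp
  then obtain i where "(v v* adj2 s) $ i \<noteq> 0" unfolding vec_eq_iff by (auto simp del: vec2_mult)
  then have "cross2 v (v v* adj2 s) = 0" using *[of i] by (simp del: vec2_mult)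
  then obtain l where "v v* adj2 s = (\<chi> i. l * v $ i)" using cross2_0_scale v(1) by blast
  then have "adj2 s = mat 1" by (rule S_eigenvector[OF p2 S_inv[OF s] v(1)])
  then have "adj2 (adj2 s) = mat 1" by simp
  then show ?thesis by simp
qed

text \<open>The reflection that \<open>P\<close> contributes to the dihedral group extending
  \<open>S\<close>.\<close>

definition inverter :: "'a mat2 set \<Rightarrow> 'a mat2" where
  "inverter P = (THE x. x \<in> P \<and> x \<noteq> mat 1 \<and> (\<lambda>s. x ** s ** adj2 x) ` S = S)"

lemma ex1_inverter:
  assumes P: "P \<in> sylow_subgroups p SL2"
  shows "\<exists>!x. x \<in> P \<and> x \<noteq> mat 1 \<and> (\<lambda>s. x ** s ** adj2 x) ` S = S"
  using normalizing_element_exists[OF p2 P] normalizing_element_unique[OF p2 P] by blast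

lemma inverter:
  assumes P: "P \<in> sylow_subgroups p SL2"
  shows "inverter P \<in> P" "inverter P \<noteq> mat 1" "(\<lambda>s. inverter P ** s ** adj2 (inverter P)) ` S = S"
  using theI'[OF ex1_inverter[OF P]] unfolding inverter_def by blast+

lemma inverter_unique:
  assumes P: "P \<in> sylow_subgroups p SL2" and "x \<in> P" "x \<noteq> mat 1" "(\<lambda>s. x ** s ** adj2 x) ` S = S"
  shows "x = inverter P"
  using ex1_inverter[OF P] inverter[OF P] assms by blast

lemma inverter_SL2: "P \<in> sylow_subgroups p SL2 \<Longrightarrow> inverter P \<in> carrier SL2"
  using inverter(1) sylow_subset by blast

lemma inverter_self [simp]:
  assumes P: "P \<in> sylow_subgroups p SL2"
  shows "inverter P ** inverter P = mat 1" "adj2 (inverter P) = inverter P"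
  using sylow_involution[OF p2 P inverter(1)[OF P]] by blast+

lemma inverter_inverts: "P \<in> sylow_subgroups p SL2 \<Longrightarrow> s \<in> S \<Longrightarrow> inverter P ** s ** inverter P = adj2 s"
  by (rule normalizing_element_inverts_S[OF p2 _ inverter])

text \<open>Conjugating a reflection by a rotation multiplies it by the square of the
  rotation.\<close>

lemma conj_inverter:
  assumes P: "P \<in> sylow_subgroups p SL2" and s: "s \<in> S"
  shows "inverter ((\<lambda>x. s ** x ** adj2 s) ` P) = s ** s ** inverter P"
proof -
  let ?x = "inverter P" and ?y = "s ** inverter P ** adj2 s"
  have sS: "s \<in> carrier SL2" using s S_subset by blast
  have yx: "?y = s ** s ** ?x"
  proof -
    have "?x ** adj2 s ** ?x = s" using inverter_inverts[OF P S_inv[OF s]] by simp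
    then have "?x ** adj2 s ** ?x ** ?x = s ** ?x" by simp
    then have "?x ** adj2 s = s ** ?x" using inverter_self[OF P] by (simp flip: matrix_mul_assoc)
    then show ?thesis by (simp flip: matrix_mul_assoc)
  qed
  have "?y ** t ** adj2 ?y = adj2 t" if t: "t \<in> S" for t
  proof -
    let ?u = "adj2 s ** t ** s"
    have u: "?u \<in> S" by (intro S_mult S_inv s t)
    have "?y ** t ** adj2 ?y = s ** (?x ** ?u ** ?x) ** adj2 s"
      by (simp add: adj2_mult inverter_self[OF P] matrix_mul_assoc)
    also have "\<dots> = s ** adj2 ?u ** adj2 s" using inverter_inverts[OF P u] by simp
    also have "\<dots> = adj2 t" using sS by (simp add: adj2_mult matrix_mul_assoc)
    finally show ?thesis .
  qed
  then have "(\<lambda>t. ?y ** t ** adj2 ?y) ` S = adj2 ` S" by (intro image_cong) auto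
  also have "\<dots> = S" using S_inv adj2_adj2 by (metis (no_types, lifting) image_subsetI subsetI subset_antisym image_eqI)
  finally have norm: "(\<lambda>t. ?y ** t ** adj2 ?y) ` S = S" .
  have "?y \<noteq> mat 1"
  proof
    assume "?y = mat 1"
    then have "adj2 s ** ?y ** s = mat 1" using sS by simp
    then show False using inverter(2)[OF P] sS by (simp add: matrix_mul_assoc)
  qed
  then have "?y = inverter ((\<lambda>x. s ** x ** adj2 s) ` P)"
    by (intro inverter_unique[OF conj_sylow[OF sS P] _ _ norm]) (use inverter(1)[OF P] in auto)
  then show ?thesis using yx by simp
qed

text \<open>Both sets have q + 1 elements, and only the identity of \<open>S\<close> normalizes a
  Sylow subgroup.\<close>

lemma S_regular_on_sylow:
  assumes P: "P \<in> sylow_subgroups p SL2"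
  shows "bij_betw (\<lambda>s. (\<lambda>x. s ** x ** adj2 s) ` P) S (sylow_subgroups p SL2)"
proof -
  have inj: "inj_on (\<lambda>s. (\<lambda>x. s ** x ** adj2 s) ` P) S"
  proof (rule inj_onI)
    fix s t assume s: "s \<in> S" and t: "t \<in> S" and eq: "(\<lambda>x. s ** x ** adj2 s) ` P = (\<lambda>x. t ** x ** adj2 t) ` P"
    have sS: "s \<in> carrier SL2" "t \<in> carrier SL2" using s t S_subset by auto
    have "(\<lambda>x. (adj2 s ** t) ** x ** adj2 (adj2 s ** t)) ` P = (\<lambda>y. adj2 s ** y ** s) ` (\<lambda>x. t ** x ** adj2 t) ` P"
      unfolding image_image by (simp add: adj2_mult matrix_mul_assoc)
    also have "\<dots> = (\<lambda>y. adj2 s ** y ** s) ` (\<lambda>x. s ** x ** adj2 s) ` P" unfolding eq ..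
    also have "\<dots> = P" unfolding image_image using sS by (simp add: matrix_mul_assoc)
    finally have "adj2 s ** t = mat 1" by (rule S_normalizes_sylow[OF P S_mult[OF S_inv[OF s] t]])
    then have "s ** (adj2 s ** t) = s" by simp
    then show "s = t" using sS by simp
  qed
  have "(\<lambda>s. (\<lambda>x. s ** x ** adj2 s) ` P) ` S = sylow_subgroups p SL2"
  proof (rule card_subset_eq)
    show "finite (sylow_subgroups p (SL2 :: 'a mat2 monoid))" by simp
    show "(\<lambda>s. (\<lambda>x. s ** x ** adj2 s) ` P) ` S \<subseteq> sylow_subgroups p SL2" using conj_sylow[OF _ P] S_subset by blast
    show "card ((\<lambda>s. (\<lambda>x. s ** x ** adj2 s) ` P) ` S) = card (sylow_subgroups p (SL2 :: 'a mat2 monoid))"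
      using card_image[OF inj] card_S card_sylow_subgroups by simp
  qed
  then show ?thesis using inj by (simp add: bij_betw_def)
qed

text \<open>\<open>Q\<close> is the conjugate of \<open>P\<close> by some s in \<open>S\<close>, and
  the product is then the square of s.\<close>

lemma inverter_mult_inverter:
  assumes P: "P \<in> sylow_subgroups p SL2" and Q: "Q \<in> sylow_subgroups p SL2"
  shows "inverter Q ** inverter P \<in> S"
proof -
  obtain s where s: "s \<in> S" "Q = (\<lambda>x. s ** x ** adj2 s) ` P"
    using S_regular_on_sylow[OF P] Q unfolding bij_betw_def by blast
  have "inverter Q ** inverter P = s ** s" unfolding s(2) conj_inverter[OF P s(1)]
    using inverter_self[OF P] by (simp flip: matrix_mul_assoc)
  then show ?thesis using S_mult s by simp
qed

lemma inverter_inject: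
  assumes P: "P \<in> sylow_subgroups p SL2" and Q: "Q \<in> sylow_subgroups p SL2" and eq: "inverter P = inverter Q"
  shows "P = Q"
  using sylow_unique[OF P Q inverter(1)[OF P]] inverter[OF Q] inverter(2)[OF P] eq by simp

text \<open>For fixed \<open>P\<close> the q + 1 products are distinct elements of
  \<open>S\<close>.\<close>

lemma S_generated_by_inverters:
  assumes P: "P \<in> sylow_subgroups p SL2" and s: "s \<in> S"
  shows "\<exists>Q\<in>sylow_subgroups p SL2. s = inverter Q ** inverter P"
proof -
  have inj: "inj_on (\<lambda>Q. inverter Q ** inverter P) (sylow_subgroups p SL2)"
  proof (rule inj_onI)
    fix Q R assume Q: "Q \<in> sylow_subgroups p SL2" and R: "R \<in> sylow_subgroups p SL2"
      and "inverter Q ** inverter P = inverter R ** inverter P"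
    then have "inverter Q ** inverter P ** inverter P = inverter R ** inverter P ** inverter P" by simp
    then have "inverter Q = inverter R" using inverter_self[OF P] by (simp flip: matrix_mul_assoc)
    then show "Q = R" by (rule inverter_inject[OF Q R])
  qed
  have "(\<lambda>Q. inverter Q ** inverter P) ` sylow_subgroups p SL2 = S"
    by (rule card_subset_eq)
      (use inverter_mult_inverter[OF P] card_image[OF inj] card_S card_sylow_subgroups in auto)
  then show ?thesis using s by blast
qed

text \<open>If two reflections map \<open>P\<close> to the same subgroup, their product lies in
  \<open>S\<close> and normalizes \<open>P\<close>, so it is trivial. Hence the q + 1 reflections
  give distinct images of \<open>P\<close>.\<close>

lemma ex1_inverter_swapping:
  assumes P: "P \<in> sylow_subgroups p SL2" and Q: "Q \<in> sylow_subgroups p SL2"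
  shows "\<exists>!R. R \<in> sylow_subgroups p SL2 \<and> (\<lambda>x. inverter R ** x ** inverter R) ` P = Q"
proof -
  let ?f = "\<lambda>R. (\<lambda>x. inverter R ** x ** inverter R) ` P"
  have inj: "inj_on ?f (sylow_subgroups p SL2)"
  proof (rule inj_onI)
    fix R R' assume R: "R \<in> sylow_subgroups p SL2" and R': "R' \<in> sylow_subgroups p SL2" and eq: "?f R = ?f R'"
    let ?s = "inverter R' ** inverter R"
    have s: "?s \<in> S" by (rule inverter_mult_inverter[OF R R'])
    have "(\<lambda>x. ?s ** x ** adj2 ?s) ` P = (\<lambda>x. inverter R' ** x ** inverter R') ` ?f R"
      unfolding image_image by (simp add: adj2_mult matrix_mul_assoc inverter_self[OF R] inverter_self[OF R'])
    also have "\<dots> = (\<lambda>x. inverter R' ** x ** inverter R') ` ?f R'" unfolding eq ..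
    also have "\<dots> = P"
    proof -
      have "inverter R' ** (inverter R' ** x ** inverter R') ** inverter R' = x" for x
        using inverter_self(1)[OF R'] by (metis matrix_mul_assoc matrix_mul_lid matrix_mul_rid)
      then show ?thesis unfolding image_image by simp
    qed
    finally have "?s = mat 1" by (rule S_normalizes_sylow[OF P s])
    then have "inverter R' ** ?s = inverter R'" by simp
    then have "inverter R = inverter R'" unfolding matrix_mul_assoc using inverter_self(1)[OF R'] by simp
    then show "R = R'" by (rule inverter_inject[OF R R'])
  qed
  have "?f ` sylow_subgroups p SL2 \<subseteq> sylow_subgroups p SL2"
    using conj_sylow[OF inverter_SL2 P] inverter_self(2) by auto
  then have "?f ` sylow_subgroups p SL2 = sylow_subgroups p SL2"
    by (intro card_subset_eq) (use card_image[OF inj] in auto)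
  then have "Q \<in> ?f ` sylow_subgroups p SL2" using Q by simp
  then obtain R where "Q = ?f R" "R \<in> sylow_subgroups p SL2" by (rule imageE)
  then have R: "R \<in> sylow_subgroups p SL2" "?f R = Q" by simp_all
  show ?thesis
  proof (rule ex1I[of _ R])
    fix R' assume R': "R' \<in> sylow_subgroups p SL2 \<and> ?f R' = Q"
    then have "?f R' = ?f R" using R(2) by simp
    from inj_onD[OF inj this] show "R' = R" using R' R(1) by blast
  qed (use R in simp)
qed

end

subsection \<open>Affine centers in characteristic 2\<close>

lemma automorphism_id: "automorphism P Bl (\<lambda>x. x)"
  by (simp add: automorphism_def bij_betw_def)

text \<open>Towards a contradiction, an affine point is assumed to be the center of a non-trivial
  translation. Then every point is the center of exactly one, which yields a second action to compare
  with right multiplication.\<close>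

locale affine_center = even_flat_unital +
  fixes g0 f0
  assumes tr0: "translation Pts Blks (Aff g0) f0" and nt0: "nontrivial_on Pts f0"
begin

lemma move_from_infinity:
  assumes "C \<in> \<pi>" "k \<in> carrier SL2"
  shows "\<exists>\<alpha>. automorphism Pts Blks \<alpha> \<and> \<alpha> (Inf_pt C) = Aff k"
  by (rule affine_center_transfer[OF tr0 nt0 assms])

lemma point_cases:
  assumes "y \<in> Pts"
  obtains (Aff) k where "k \<in> carrier SL2" "y = Aff k" | (Inf) C where "C \<in> \<pi>" "y = Inf_pt C"
  using assms by (cases y) auto

text \<open>Translations with affine center move points off [\<infinity>], and right multiplication
  is transitive on affine points. Questions about centers can thereby be settled at
  infinity.\<close>

lemma conjugate_from_infinity:
  assumes "y \<in> Pts"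
  shows "\<exists>\<alpha> C. automorphism Pts Blks \<alpha> \<and> C \<in> \<pi> \<and> \<alpha> (Inf_pt C) = y"
  using assms
proof (cases rule: point_cases)
  case (Aff k)
  have "\<pi> \<noteq> {}" using card_par by auto
  then obtain C where "C \<in> \<pi>" by blast
  then show ?thesis using move_from_infinity[of C k] Aff by blast
next
  case (Inf C)
  have "automorphism Pts Blks (\<lambda>x. x) \<and> C \<in> \<pi> \<and> (\<lambda>x. x) (Inf_pt C) = y"
    using Inf automorphism_id by simp
  then show ?thesis by blast
qed

lemma automorphism_bij: "automorphism Pts Blks f \<Longrightarrow> bij_betw f Pts Pts"
  by (simp add: automorphism_def)

lemma conjugate_nontrivial_translation:
  assumes "translation Pts Blks c f" "nontrivial_on Pts f" "automorphism Pts Blks \<alpha>"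
  shows "translation Pts Blks (\<alpha> c) (\<alpha> \<circ> f \<circ> inv_into Pts \<alpha>)" "nontrivial_on Pts (\<alpha> \<circ> f \<circ> inv_into Pts \<alpha>)"
proof -
  show "translation Pts Blks (\<alpha> c) (\<alpha> \<circ> f \<circ> inv_into Pts \<alpha>)"
    by (rule translation_conjugate[OF assms(1,3) block_subset])
  have "automorphism Pts Blks f" using assms(1) by (simp add: translation_def)
  then show "nontrivial_on Pts (\<alpha> \<circ> f \<circ> inv_into Pts \<alpha>)"
    by (intro nontrivial_on_conjugate[OF assms(2)] automorphism_bij assms(3))
qed

section \<open>The translation belonging to each point\<close>

lemma ex_translation:
  assumes "y \<in> Pts"
  shows "\<exists>f. translation Pts Blks y f \<and> nontrivial_on Pts f"
proof -
  obtain \<alpha> C where \<alpha>: "automorphism Pts Blks \<alpha>" "C \<in> \<pi>" "\<alpha> (Inf_pt C) = y"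
    using conjugate_from_infinity[OF assms] by blast
  obtain f where "translation Pts Blks (Inf_pt C) f" "nontrivial_on Pts f"
    using translation_transfer_to_infinity[OF tr0 nt0 \<alpha>(2)] by blast
  from conjugate_nontrivial_translation[OF this \<alpha>(1)] show ?thesis unfolding \<alpha>(3) by blast
qed

lemma translation_inverter:
  assumes P: "P \<in> sylow_subgroups p SL2" and tr: "translation Pts Blks (Inf_pt (cosets_of P)) f" and nt: "nontrivial_on Pts f"
  shows "g \<in> carrier SL2 \<Longrightarrow> f (Aff g) = Aff (inverter P ** g)" "acts_as_left_mult \<pi> (inverter P) f"
proof -
  obtain Q x where Q: "Q \<in> sylow_subgroups p SL2" "cosets_of P = cosets_of Q" and x: "x \<in> Q" "x \<noteq> mat 1"
    "(\<lambda>s. x ** s ** adj2 x) ` S = S" "\<And>g. g \<in> carrier SL2 \<Longrightarrow> f (Aff g) = Aff (x ** g)" "acts_as_left_mult \<pi> x f"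
    by (rule translation_at_infinity[OF tr cosets_of_in_par[OF P] nt]) blast
  have "Q = P" using cosets_of_inject[OF P Q(1,2)] by simp
  then have "x = inverter P" using inverter_unique[OF P] x(1,2,3) by simp
  then show "g \<in> carrier SL2 \<Longrightarrow> f (Aff g) = Aff (inverter P ** g)" "acts_as_left_mult \<pi> (inverter P) f"
    using x by simp_all
qed

lemma translation_at_infinity_unique:
  assumes C: "C \<in> \<pi>" and f: "translation Pts Blks (Inf_pt C) f" "nontrivial_on Pts f"
    and f': "translation Pts Blks (Inf_pt C) f'" "nontrivial_on Pts f'" and z: "z \<in> Pts"
  shows "f z = f' z"
proof -
  obtain P where P: "P \<in> sylow_subgroups p SL2" "C = cosets_of P" using C unfolding par_iff by blast
  note 1 = translation_inverter[OF P(1) f[unfolded P(2)]] and 2 = translation_inverter[OF P(1) f'[unfolded P(2)]]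
  from z show ?thesis
  proof (cases rule: point_cases)
    case (Aff k)
    then show ?thesis using 1(1) 2(1) by simp
  next
    case (Inf C')
    then show ?thesis using 1(2) 2(2) unfolding acts_as_left_mult_def by simp
  qed
qed

lemma translation_unique:
  assumes y: "y \<in> Pts" and f: "translation Pts Blks y f" "nontrivial_on Pts f"
    and f': "translation Pts Blks y f'" "nontrivial_on Pts f'" and z: "z \<in> Pts"
  shows "f z = f' z"
proof -
  obtain \<alpha> C where \<alpha>: "automorphism Pts Blks \<alpha>" "C \<in> \<pi>" "\<alpha> (Inf_pt C) = y"
    using conjugate_from_infinity[OF y] by blast
  let ?b = "inv_into Pts \<alpha>"
  have b: "automorphism Pts Blks ?b" by (rule automorphism_inv_into[OF \<alpha>(1) block_subset])
  have by_: "?b y = Inf_pt C" using inv_into_f_f[OF automorphism_inj[OF \<alpha>(1)], of "Inf_pt C"] \<alpha>(2,3) by simp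
  have bz: "?b z \<in> Pts" by (rule automorphism_in_Pts[OF b z])
  have inv: "inv_into Pts ?b (?b z) = z" by (rule inv_into_f_f[OF automorphism_inj[OF b] z])
  have "(?b \<circ> f \<circ> inv_into Pts ?b) (?b z) = (?b \<circ> f' \<circ> inv_into Pts ?b) (?b z)"
    using translation_at_infinity_unique[OF \<alpha>(2) conjugate_nontrivial_translation[OF f b, unfolded by_]
      conjugate_nontrivial_translation[OF f' b, unfolded by_] bz] .
  then have "?b (f z) = ?b (f' z)" using inv by simp
  moreover have "f z \<in> Pts" "f' z \<in> Pts" using f f' z automorphism_in_Pts by (auto simp: translation_def)
  ultimately show ?thesis using automorphism_inj[OF b] by (meson inj_onD)
qed

text \<open>On the points the choice is determined by \<open>translation_unique\<close>; elsewhere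
  it is arbitrary, so facts about \<open>ctr\<close> are restricted to points.\<close>

definition ctr :: "'a upoint \<Rightarrow> 'a upoint \<Rightarrow> 'a upoint" where
  "ctr y = (SOME f. translation Pts Blks y f \<and> nontrivial_on Pts f)"

lemma ctr:
  assumes "y \<in> Pts"
  shows "translation Pts Blks y (ctr y)" "nontrivial_on Pts (ctr y)" "automorphism Pts Blks (ctr y)"
  using someI_ex[OF ex_translation[OF assms]] unfolding ctr_def translation_def by blast+

lemma ctr_in_Pts: "y \<in> Pts \<Longrightarrow> z \<in> Pts \<Longrightarrow> ctr y z \<in> Pts"
  by (rule automorphism_in_Pts[OF ctr(3)])

text \<open>Conjugation by \<alpha> gives a non-trivial translation with center
  \<open>\<alpha> y\<close>, and there is only one.\<close>

lemma ctr_equivariant: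
  assumes \<alpha>: "automorphism Pts Blks \<alpha>" and y: "y \<in> Pts" and z: "z \<in> Pts"
  shows "\<alpha> (ctr y z) = ctr (\<alpha> y) (\<alpha> z)"
proof -
  have \<alpha>y: "\<alpha> y \<in> Pts" "\<alpha> z \<in> Pts" using automorphism_in_Pts[OF \<alpha>] y z by auto
  have "(\<alpha> \<circ> ctr y \<circ> inv_into Pts \<alpha>) (\<alpha> z) = ctr (\<alpha> y) (\<alpha> z)"
    by (rule translation_unique[OF \<alpha>y(1) conjugate_nontrivial_translation[OF ctr(1,2)[OF y] \<alpha>] ctr(1,2)[OF \<alpha>y(1)] \<alpha>y(2)])
  then show ?thesis using inv_into_f_f[OF automorphism_inj[OF \<alpha>] z] by simp
qed

lemma ctr_image:
  assumes \<alpha>: "automorphism Pts Blks \<alpha>" and y: "y \<in> Pts" and B: "B \<subseteq> Pts"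
  shows "ctr (\<alpha> y) ` \<alpha> ` B = \<alpha> ` ctr y ` B"
  unfolding image_image by (rule image_cong[OF refl]) (use ctr_equivariant[OF \<alpha> y] B in auto)

lemma ctr_inf_aff:
  assumes P: "P \<in> sylow_subgroups p SL2" and g: "g \<in> carrier SL2"
  shows "ctr (Inf_pt (cosets_of P)) (Aff g) = Aff (inverter P ** g)"
  by (rule translation_inverter(1)[OF P ctr(1,2) g]) (simp_all add: cosets_of_in_par[OF P])

text \<open>With x the inverter of \<open>P\<close>, which has order 2, x (Q g) = (x Q x)(x
  g).\<close>

lemma ctr_inf_inf:
  assumes P: "P \<in> sylow_subgroups p SL2" and Q: "Q \<in> sylow_subgroups p SL2"
  shows "ctr (Inf_pt (cosets_of P)) (Inf_pt (cosets_of Q))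
    = Inf_pt (cosets_of ((\<lambda>x. inverter P ** x ** inverter P) ` Q))"
proof -
  let ?x = "inverter P"
  have xS: "?x \<in> carrier SL2" by (rule inverter_SL2[OF P])
  have "acts_as_left_mult \<pi> ?x (ctr (Inf_pt (cosets_of P)))"
    by (rule translation_inverter(2)[OF P ctr(1,2)]) (simp_all add: cosets_of_in_par[OF P])
  then have "ctr (Inf_pt (cosets_of P)) (Inf_pt (cosets_of Q)) = Inf_pt ((\<lambda>Y. ?x <#\<^bsub>SL2\<^esub> Y) ` cosets_of Q)"
    using cosets_of_in_par[OF Q] unfolding acts_as_left_mult_def by blast
  moreover have "(\<lambda>Y. ?x <#\<^bsub>SL2\<^esub> Y) ` cosets_of Q = cosets_of ((\<lambda>x. ?x ** x ** ?x) ` Q)"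
  proof -
    have *: "?x <#\<^bsub>SL2\<^esub> (Q #>\<^bsub>SL2\<^esub> g) = (\<lambda>x. ?x ** x ** ?x) ` Q #>\<^bsub>SL2\<^esub> (?x ** g)" for g
    proof -
      have "?x ** (x ** g) = ?x ** x ** ?x ** (?x ** g)" for x
        using inverter_self(1)[OF P] by (metis matrix_mul_assoc matrix_mul_lid)
      then show ?thesis unfolding l_coset_SL2 r_coset_SL2 image_image by simp
    qed
    show ?thesis
    proof (intro equalityI subsetI)
      fix Y assume "Y \<in> (\<lambda>Y. ?x <#\<^bsub>SL2\<^esub> Y) ` cosets_of Q"
      then obtain g where "g \<in> carrier SL2" "Y = ?x <#\<^bsub>SL2\<^esub> (Q #>\<^bsub>SL2\<^esub> g)" unfolding cosets_of_def by blast
      then show "Y \<in> cosets_of ((\<lambda>x. ?x ** x ** ?x) ` Q)"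
        unfolding * using coset_in_cosets_of SL2_closed[OF xS] by simp
    next
      fix Y assume "Y \<in> cosets_of ((\<lambda>x. ?x ** x ** ?x) ` Q)"
      then obtain g where g: "g \<in> carrier SL2" "Y = (\<lambda>x. ?x ** x ** ?x) ` Q #>\<^bsub>SL2\<^esub> g" unfolding cosets_of_def by blast
      have "?x ** (?x ** g) = g" unfolding matrix_mul_assoc inverter_self(1)[OF P] by simp
      then have "Y = ?x <#\<^bsub>SL2\<^esub> (Q #>\<^bsub>SL2\<^esub> (?x ** g))" unfolding * g(2) by simp
      then show "Y \<in> (\<lambda>Y. ?x <#\<^bsub>SL2\<^esub> Y) ` cosets_of Q"
        using coset_in_cosets_of[OF SL2_closed[OF xS g(1)], of Q] by blast
    qed
  qed
  ultimately show ?thesis by simp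
qed

lemma conj_inverter_sylow:
  assumes "P \<in> sylow_subgroups p SL2" "Q \<in> sylow_subgroups p SL2"
  shows "(\<lambda>x. inverter P ** x ** inverter P) ` Q \<in> sylow_subgroups p SL2"
  using conj_sylow[OF inverter_SL2[OF assms(1)] assms(2)] inverter_self(2)[OF assms(1)] by simp

lemma ctr_ctr:
  assumes y: "y \<in> Pts" and z: "z \<in> Pts"
  shows "ctr y (ctr y z) = z"
proof -
  have inf: "ctr (Inf_pt C) (ctr (Inf_pt C) z) = z" if C: "C \<in> \<pi>" and z: "z \<in> Pts" for C z
  proof -
    obtain P where P: "P \<in> sylow_subgroups p SL2" "C = cosets_of P" using C unfolding par_iff by blast
    note xx = inverter_self(1)[OF P(1)]
    from z show ?thesis
    proof (cases rule: point_cases)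
      case (Aff k)
      then show ?thesis unfolding P(2)
        using ctr_inf_aff[OF P(1)] SL2_closed[OF inverter_SL2[OF P(1)]] by (simp add: matrix_mul_assoc xx)
    next
      case (Inf C')
      then obtain Q where Q: "Q \<in> sylow_subgroups p SL2" "C' = cosets_of Q" unfolding par_iff by blast
      have "inverter P ** (inverter P ** x ** inverter P) ** inverter P = x" for x
        using xx by (metis matrix_mul_assoc matrix_mul_lid matrix_mul_rid)
      then show ?thesis unfolding P(2) Inf(2) Q(2) ctr_inf_inf[OF P(1) Q(1)]
          ctr_inf_inf[OF P(1) conj_inverter_sylow[OF P(1) Q(1)]] image_image by simp
    qed
  qed
  obtain \<alpha> C where \<alpha>: "automorphism Pts Blks \<alpha>" "C \<in> \<pi>" "\<alpha> (Inf_pt C) = y"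
    using conjugate_from_infinity[OF y] by blast
  have C: "Inf_pt C \<in> Pts" using \<alpha>(2) by simp
  obtain w where w: "w \<in> Pts" "z = \<alpha> w" using automorphism_bij[OF \<alpha>(1)] z unfolding bij_betw_def by blast
  have "ctr y (ctr y z) = \<alpha> (ctr (Inf_pt C) (ctr (Inf_pt C) w))"
    unfolding w(2) \<alpha>(3)[symmetric] using ctr_equivariant[OF \<alpha>(1) C] ctr_in_Pts[OF C w(1)] w(1) by simp
  then show ?thesis using inf[OF \<alpha>(2) w(1)] w(2) by simp
qed

lemma ctr_aff_inf:
  assumes "g \<in> carrier SL2" "C \<in> \<pi>"
  shows "\<exists>h\<in>carrier SL2. ctr (Aff g) (Inf_pt C) = Aff h"
  by (rule affine_center_moves_infinity[OF ctr(1,2) assms(2)]) (use assms in simp_all)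

lemma infinity_block_iff:
  "i \<in> infinity_block \<pi> \<longleftrightarrow> (\<exists>P. P \<in> sylow_subgroups p SL2 \<and> i = Inf_pt (cosets_of P))"
  unfolding infinity_block_def by (auto simp: par_iff image_iff)

lemma infinity_subset: "infinity_block \<pi> \<subseteq> Pts"
  using block_subset[OF infinity_block_mem] .

text \<open>On [\<infinity>] these translations conjugate Sylow subgroups by inverters, so this is
  \<open>ex1_inverter_swapping\<close>.\<close>

lemma ex1_ctr_swapping_infinity:
  assumes i: "i \<in> infinity_block \<pi>" and j: "j \<in> infinity_block \<pi>"
  shows "\<exists>!z. z \<in> infinity_block \<pi> \<and> ctr z i = j"
proof -
  obtain P where P: "P \<in> sylow_subgroups p SL2" "i = Inf_pt (cosets_of P)"
    using i unfolding infinity_block_iff by blast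
  obtain Q where Q: "Q \<in> sylow_subgroups p SL2" "j = Inf_pt (cosets_of Q)"
    using j unfolding infinity_block_iff by blast
  have iff: "ctr (Inf_pt (cosets_of R)) i = j \<longleftrightarrow> (\<lambda>x. inverter R ** x ** inverter R) ` P = Q"
    if R: "R \<in> sylow_subgroups p SL2" for R
    unfolding P(2) Q(2) ctr_inf_inf[OF R P(1)] using cosets_of_inject[OF conj_inverter_sylow[OF R P(1)] Q(1)] by auto
  obtain R where R: "R \<in> sylow_subgroups p SL2" "(\<lambda>x. inverter R ** x ** inverter R) ` P = Q"
    and uniq: "\<And>R'. R' \<in> sylow_subgroups p SL2 \<Longrightarrow> (\<lambda>x. inverter R' ** x ** inverter R') ` P = Q \<Longrightarrow> R' = R"
  proof (rule ex1E[OF ex1_inverter_swapping[OF P(1) Q(1)]], elim conjE)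
    fix R
    assume R: "R \<in> sylow_subgroups p SL2" "(\<lambda>x. inverter R ** x ** inverter R) ` P = Q"
      and uniq: "\<forall>R'. R' \<in> sylow_subgroups p SL2 \<and> (\<lambda>x. inverter R' ** x ** inverter R') ` P = Q \<longrightarrow> R' = R"
    show thesis
      by (rule that[OF R]) (rule uniq[rule_format, OF conjI])
  qed
  show ?thesis
  proof (rule ex1I[of _ "Inf_pt (cosets_of R)"])
    show "Inf_pt (cosets_of R) \<in> infinity_block \<pi> \<and> ctr (Inf_pt (cosets_of R)) i = j"
      using iff[OF R(1)] R cosets_of_in_par[OF R(1)] by simp
    fix z assume z: "z \<in> infinity_block \<pi> \<and> ctr z i = j"
    then obtain R' where R': "R' \<in> sylow_subgroups p SL2" "z = Inf_pt (cosets_of R')"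
      unfolding infinity_block_iff by blast
    then show "z = Inf_pt (cosets_of R)" using iff[OF R'(1)] uniq[OF R'(1)] z by simp
  qed
qed

text \<open>Here q >= 3 enters: \<open>P\<close> has q elements.\<close>

lemma ex_non_inverter:
  assumes P: "P \<in> sylow_subgroups p SL2"
  shows "\<exists>u\<in>P. u \<noteq> mat 1 \<and> u \<noteq> inverter P"
proof (rule ccontr)
  assume "\<not> ?thesis"
  then have "P \<subseteq> {mat 1, inverter P}" by blast
  then have "card P \<le> card {mat 1, inverter P}" by (intro card_mono) auto
  also have "\<dots> \<le> 2" using card_insert_le_m1[of 2 "{inverter P}" "mat 1"] by simp
  finally show False using card_sylow[OF P] card_field_ge_3 by simp
qed

text \<open>In the image of \<open>[\<infinity>]\<close>, exactly one point \<open>z\<close> is the center of a translation swapping \<open>1\<close> and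
  \<open>u\<close>. Right multiplication by \<open>u\<close> fixes \<open>z\<close>, hence \<open>z\<close> lies on \<open>[\<infinity>]\<close>.\<close>

lemma infinity_not_moved_to_sylow:
  assumes \<alpha>: "automorphism Pts Blks \<alpha>" and P: "P \<in> sylow_subgroups p SL2"
  shows "\<alpha> ` infinity_block \<pi> \<noteq> insert (Inf_pt (cosets_of P)) (Aff ` P)"
proof
  assume img: "\<alpha> ` infinity_block \<pi> = insert (Inf_pt (cosets_of P)) (Aff ` P)"
  obtain u where u: "u \<in> P" "u \<noteq> mat 1" "u \<noteq> inverter P" using ex_non_inverter[OF P] by blast
  have uS: "u \<in> carrier SL2" using sylow_subset[OF P] u by blast
  note uu = sylow_involution(1)[OF p2 P u(1)]
  note \<rho> = right_mult_automorphism[OF uS]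
  have "Aff (mat 1) \<in> \<alpha> ` infinity_block \<pi>" "Aff u \<in> \<alpha> ` infinity_block \<pi>"
    unfolding img using sylow_one[OF P] u by auto
  then obtain i j where i: "i \<in> infinity_block \<pi>" "\<alpha> i = Aff (mat 1)" and j: "j \<in> infinity_block \<pi>" "\<alpha> j = Aff u"
    by (metis imageE)
  have ijP: "i \<in> Pts" "j \<in> Pts" using i j infinity_subset by auto
  obtain z0 where z0: "z0 \<in> infinity_block \<pi>" "ctr z0 i = j"
    and uniq: "\<And>z. z \<in> infinity_block \<pi> \<Longrightarrow> ctr z i = j \<Longrightarrow> z = z0"
    using ex1_ctr_swapping_infinity[OF i(1) j(1)] by blast
  define z where "z = \<alpha> z0"
  have z0P: "z0 \<in> Pts" using z0 infinity_subset by blast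
  have zP: "z \<in> Pts" unfolding z_def by (rule automorphism_in_Pts[OF \<alpha> z0P])
  have "ctr z (Aff (mat 1)) = Aff u"
    using ctr_equivariant[OF \<alpha> z0P ijP(1)] z0(2) i(2) j(2) by (simp add: z_def)
  \<comment> \<open>Right multiplication by the involution \<open>u\<close> exchanges 1 and
    \<open>u\<close>, so it takes z to a center with the same property; uniqueness will identify the
    two.\<close>
  then have "right_mult u (Aff u) = ctr (right_mult u z) (right_mult u (Aff (mat 1)))"
    using ctr_equivariant[OF \<rho> zP, of "Aff (mat 1)"] by simp
  then have "ctr (right_mult u z) (Aff u) = Aff (mat 1)" using uu by simp
  moreover have rz: "right_mult u z \<in> Pts" by (rule automorphism_in_Pts[OF \<rho> zP])
  ultimately have *: "ctr (right_mult u z) (Aff (mat 1)) = Aff u"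
    using ctr_ctr[OF rz, of "Aff u"] uS by simp
  have "right_mult u z \<in> \<alpha> ` infinity_block \<pi>"
  proof -
    have "z \<in> insert (Inf_pt (cosets_of P)) (Aff ` P)" unfolding img[symmetric] z_def using z0(1) by blast
    then show ?thesis unfolding img
      using subgroup.m_closed[OF sylow_subgroup[OF P] _ u(1)] by auto
  qed
  then obtain z1 where z1: "z1 \<in> infinity_block \<pi>" "right_mult u z = \<alpha> z1" by blast
  have z1P: "z1 \<in> Pts" using z1 infinity_subset by blast
  have "\<alpha> (ctr z1 i) = \<alpha> j" using ctr_equivariant[OF \<alpha> z1P ijP(1)] * z1(2) i(2) j(2) by simp
  then have "ctr z1 i = j"
    using automorphism_inj[OF \<alpha>] ctr_in_Pts[OF z1P ijP(1)] ijP(2) by (meson inj_onD)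
  then have rz_z: "right_mult u z = z" using uniq[OF z1(1)] z1(2) z_def by simp
  have "z = Inf_pt (cosets_of P)"
  proof -
    have "z \<in> insert (Inf_pt (cosets_of P)) (Aff ` P)" unfolding img[symmetric] z_def using z0(1) by blast
    moreover have "z \<noteq> Aff g" if "g \<in> P" for g
    proof
      assume "z = Aff g"
      then have "adj2 g ** (g ** u) = adj2 g ** g" using rz_z by simp
      moreover have "g \<in> carrier SL2" using that sylow_subset[OF P] by blast
      ultimately show False using u(2) by simp
    qed
    ultimately show ?thesis by blast
  qed
  \<comment> \<open>This center sends 1 to \<open>inverter P\<close>, which \<open>u\<close> was
    chosen to avoid.\<close>
  then have "ctr z (Aff (mat 1)) = Aff (inverter P)" using ctr_inf_aff[OF P, of "mat 1"] by simp
  then show False using \<open>ctr z (Aff (mat 1)) = Aff u\<close> u(3) by simp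
qed

section \<open>The orbit of the block at infinity\<close>

definition orbit_infinity :: "'a upoint set set" where
  "orbit_infinity = {\<alpha> ` infinity_block \<pi> | \<alpha>. automorphism Pts Blks \<alpha>}"

lemma orbit_infinityI: "automorphism Pts Blks \<alpha> \<Longrightarrow> \<alpha> ` infinity_block \<pi> \<in> orbit_infinity"
  unfolding orbit_infinity_def by blast

lemma orbit_infinity_image:
  assumes "B \<in> orbit_infinity" "automorphism Pts Blks \<beta>"
  shows "\<beta> ` B \<in> orbit_infinity"
proof -
  obtain \<alpha> where \<alpha>: "automorphism Pts Blks \<alpha>" "B = \<alpha> ` infinity_block \<pi>"
    using assms(1) unfolding orbit_infinity_def by blast
  have "\<beta> ` B = (\<beta> \<circ> \<alpha>) ` infinity_block \<pi>" unfolding \<alpha>(2) by (rule image_comp)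
  then show ?thesis using orbit_infinityI[OF automorphism_comp[OF assms(2) \<alpha>(1)]] by simp
qed

lemma orbit_infinity_block: "B \<in> orbit_infinity \<Longrightarrow> B \<in> Blks"
  unfolding orbit_infinity_def using automorphism_block[OF _ infinity_block_mem] by blast

text \<open>Any other block through the point is a coset of a Sylow subgroup; right multiplication
  brings it to the subgroup itself, which is excluded by
  \<open>infinity_not_moved_to_sylow\<close>.\<close>

lemma orbit_infinity_through_inf:
  assumes B: "B \<in> orbit_infinity" "Inf_pt C \<in> B"
  shows "B = infinity_block \<pi>"
proof (rule ccontr)
  assume "B \<noteq> infinity_block \<pi>"
  then obtain Y where Y: "C \<in> \<pi>" "Y \<in> C" "B = insert (Inf_pt C) (Aff ` Y)"
    using block_with_inf_point[OF orbit_infinity_block[OF B(1)] B(2)] by blast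
  obtain P where P: "P \<in> sylow_subgroups p SL2" "C = cosets_of P" using Y(1) unfolding par_iff by blast
  obtain g where g: "g \<in> carrier SL2" "Y = P #>\<^bsub>SL2\<^esub> g" using Y(2) unfolding P(2) cosets_of_def by blast
  have "right_mult (adj2 g) ` B \<in> orbit_infinity"
    by (rule orbit_infinity_image[OF B(1) right_mult_automorphism]) (use g in simp)
  moreover have "right_mult (adj2 g) ` B = insert (Inf_pt (cosets_of P)) (Aff ` P)"
  proof -
    have "(\<lambda>x. x ** adj2 g) ` Y = P" unfolding g(2) r_coset_SL2 image_image using g(1) by simp
    then show ?thesis unfolding Y(3) image_insert right_mult_Aff_image P(2) by simp
  qed
  ultimately obtain \<alpha> where \<alpha>: "automorphism Pts Blks \<alpha>" "insert (Inf_pt (cosets_of P)) (Aff ` P) = \<alpha> ` infinity_block \<pi>"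
    unfolding orbit_infinity_def by auto
  show False using infinity_not_moved_to_sylow[OF \<alpha>(1) P(1)] \<alpha>(2) by simp
qed

text \<open>A common point can be moved to infinity, where [\<infinity>] is the only block of the
  orbit.\<close>

lemma orbit_infinity_disjoint:
  assumes B: "B \<in> orbit_infinity" "B' \<in> orbit_infinity" and x: "x \<in> B" "x \<in> B'"
  shows "B = B'"
proof -
  have xP: "x \<in> Pts" using block_subset[OF orbit_infinity_block[OF B(1)]] x by blast
  obtain \<alpha> C where \<alpha>: "automorphism Pts Blks \<alpha>" "C \<in> \<pi>" "\<alpha> (Inf_pt C) = x"
    using conjugate_from_infinity[OF xP] by blast
  let ?b = "inv_into Pts \<alpha>"
  have b: "automorphism Pts Blks ?b" by (rule automorphism_inv_into[OF \<alpha>(1) block_subset])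
  have bx: "?b x = Inf_pt C" using inv_into_f_f[OF automorphism_inj[OF \<alpha>(1)], of "Inf_pt C"] \<alpha>(2,3) by simp
  have "Inf_pt C \<in> ?b ` B" "Inf_pt C \<in> ?b ` B'" using x bx by (metis imageI)+
  then have "?b ` B = ?b ` B'"
    using orbit_infinity_through_inf[OF orbit_infinity_image[OF B(1) b]]
      orbit_infinity_through_inf[OF orbit_infinity_image[OF B(2) b]] by simp
  then show ?thesis
    using inj_on_image_eq_iff[OF automorphism_inj[OF b]] block_subset orbit_infinity_block B by simp
qed

text \<open>Short blocks pass through a point at infinity. A block \<open>D k\<close> is excluded
  because its right translates \<open>D\<close> and \<open>D d^-1\<close> share the point 1 and
  would coincide, against injectivity of quotients.\<close>

lemma orbit_infinity_cases:
  assumes B: "B \<in> orbit_infinity" and ne: "B \<noteq> infinity_block \<pi>"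
  shows "\<exists>k\<in>carrier SL2. B = Aff ` (S #>\<^bsub>SL2\<^esub> k)"
  using orbit_infinity_block[OF B]
proof (cases rule: block_cases)
  case (short C Y)
  then show ?thesis using orbit_infinity_through_inf[OF B, of C] ne by simp
next
  case infinity
  then show ?thesis using ne by simp
next
  case (long W)
  then consider k where "k \<in> carrier SL2" "W = S #>\<^bsub>SL2\<^esub> k" | D k where "D \<in> \<D>" "k \<in> carrier SL2" "W = D #>\<^bsub>SL2\<^esub> k"
    unfolding long_blocks_def by blast
  then show ?thesis
  proof cases
    case 1
    then show ?thesis using long(2) by blast
  next
    case 2
    have "D \<noteq> {mat 1}" using card_D[OF 2(1)] card_field_ge_2 by auto
    then obtain d where d: "d \<in> D" "d \<noteq> mat 1" using D_one[OF 2(1)] by blast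
    have dS: "d \<in> carrier SL2" using d D_subset[OF 2(1)] by blast
    have tr: "right_mult (adj2 k ** m) ` B = Aff ` (\<lambda>x. x ** m) ` D" for m
      unfolding long(2) 2(3) r_coset_SL2 right_mult_Aff_image image_image using 2(2) by (simp add: matrix_mul_assoc)
    have "right_mult (adj2 k ** mat 1) ` B = right_mult (adj2 k ** adj2 d) ` B"
    proof (rule orbit_infinity_disjoint[of _ _ "Aff (mat 1)"])
      show "right_mult (adj2 k ** mat 1) ` B \<in> orbit_infinity" "right_mult (adj2 k ** adj2 d) ` B \<in> orbit_infinity"
        using 2(2) dS by (auto intro!: orbit_infinity_image[OF B] right_mult_automorphism)
      show "Aff (mat 1) \<in> right_mult (adj2 k ** mat 1) ` B" unfolding tr using D_one[OF 2(1)] by force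
      have "mat 1 = d ** adj2 d" using dS by simp
      then show "Aff (mat 1) \<in> right_mult (adj2 k ** adj2 d) ` B" unfolding tr using d(1) by blast
    qed
    then have "(\<lambda>x. x ** mat 1) ` D = (\<lambda>x. x ** adj2 d) ` D" unfolding tr by (simp add: inj_image_eq_iff inj_def)
    then have "D = (\<lambda>x. x ** adj2 d) ` D" by simp
    then have dD: "x ** adj2 d \<in> D" if "x \<in> D" for x using that by blast
    have "mat 1 ** adj2 d \<in> D" by (rule dD[OF D_one[OF 2(1)]])
    then have ad: "adj2 d \<in> D" by simp
    \<comment> \<open>The pairs (d, 1) and (1, d^-1) of \<open>D\<close> have the same
      quotient.\<close>
    have "d ** adj2 (mat 1) = (d ** adj2 d) ** adj2 (mat 1 ** adj2 d)" using dS by simp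
    then have "d = d ** adj2 d"
      by (intro D_quotient_inj(1)[OF 2(1) d(1) D_one[OF 2(1)] d(2) _ ad]) (use dS d D_one[OF 2(1)] in \<open>auto\<close>, metis adj2_adj2 adj2_one)
    then show ?thesis using dS d(2) by simp
  qed
qed

text \<open>For blocks \<open>B \<noteq> B'\<close> of the orbit of \<open>[\<infinity>]\<close>, the centers of the translations mapping \<open>B\<close> to
  \<open>B'\<close> form a block of the orbit. For \<open>B = S\<close> and \<open>B' = S u\<close> with an involution \<open>u\<close>, this block is
  invariant under right multiplication by \<open>u\<close>.\<close>

lemma contradiction: False
proof -
  let ?I = "infinity_block \<pi>" and ?f = "ctr (Aff (mat 1))"
  have onePts: "Aff (mat 1) \<in> Pts" by simp
  have moved: "ctr (Aff g) ` ?I \<noteq> ?I" if g: "g \<in> carrier SL2" for g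
  proof -
    have "\<pi> \<noteq> {}" using card_par by auto
    then obtain C where C: "C \<in> \<pi>" by blast
    then obtain h where "ctr (Aff g) (Inf_pt C) = Aff h" using ctr_aff_inf[OF g] by blast
    then have "Aff h \<in> ctr (Aff g) ` ?I" using C by (metis imageI inf_in_infinity_block)
    then show ?thesis using aff_notin_infinity_block[of h] by blast
  qed
  have "?f ` ?I \<in> orbit_infinity" by (rule orbit_infinityI[OF ctr(3)[OF onePts]])
  then obtain c where c: "c \<in> carrier SL2" "?f ` ?I = Aff ` (S #>\<^bsub>SL2\<^esub> c)"
    using orbit_infinity_cases[OF _ moved[OF mat_1_in_SL2]] by blast
  \<comment> \<open>By equivariance under right multiplication, c determines the image of
    [\<infinity>] for every affine center.\<close>
  have ctrI: "ctr (Aff h) ` ?I = Aff ` (S #>\<^bsub>SL2\<^esub> (c ** h))" if h: "h \<in> carrier SL2" for h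
  proof -
    have "ctr (right_mult h (Aff (mat 1))) ` right_mult h ` ?I = right_mult h ` ?f ` ?I"
      by (rule ctr_image[OF right_mult_automorphism[OF h] onePts infinity_subset])
    then show ?thesis by (simp add: c(2) right_mult_Aff_image r_coset_mult_image)
  qed
  have S_orbit: "Aff ` (S #>\<^bsub>SL2\<^esub> k) \<in> orbit_infinity" if k: "k \<in> carrier SL2" for k
  proof -
    have "adj2 c ** k \<in> carrier SL2" using c(1) k by simp
    then have "ctr (Aff (adj2 c ** k)) ` ?I \<in> orbit_infinity" by (intro orbit_infinityI ctr(3)) simp
    then show ?thesis using ctrI[of "adj2 c ** k"] c(1) k by simp
  qed
  have S_coset_eq: "h ** adj2 k \<in> S" if "Aff ` (S #>\<^bsub>SL2\<^esub> h) = Aff ` (S #>\<^bsub>SL2\<^esub> k)" "h \<in> carrier SL2" "k \<in> carrier SL2" for h k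
  proof -
    have "S #>\<^bsub>SL2\<^esub> h = S #>\<^bsub>SL2\<^esub> k" using that(1) by (simp add: inj_image_eq_iff inj_def)
    moreover have "h \<in> S #>\<^bsub>SL2\<^esub> h" using mem_r_coset_SL2[OF that(2), of h S] that(2) by simp
    ultimately show ?thesis using mem_r_coset_SL2[OF that(3), of h S] by simp
  qed
  \<comment> \<open>Conjugation by the inverter of \<open>Q\<close> is an automorphism fixing 1 and
    preserving [\<infinity>], so it stabilizes \<open>S c\<close>.\<close>
  have cx: "\<exists>s\<in>S. c ** inverter Q ** adj2 c = inverter Q ** s" if Q: "Q \<in> sylow_subgroups p SL2" for Q
  proof -
    let ?x = "inverter Q" and ?i = "Inf_pt (cosets_of Q)"
    have xS: "?x \<in> carrier SL2" by (rule inverter_SL2[OF Q])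
    note xx = inverter_self(1)[OF Q]
    have iPts: "?i \<in> Pts" using cosets_of_in_par[OF Q] by simp
    define \<kappa> where "\<kappa> = right_mult ?x \<circ> ctr ?i"
    have \<kappa>: "automorphism Pts Blks \<kappa>" unfolding \<kappa>_def
      by (rule automorphism_comp[OF right_mult_automorphism[OF xS] ctr(3)[OF iPts]])
    have \<kappa>_aff: "\<kappa> (Aff g) = Aff (?x ** g ** ?x)" if "g \<in> carrier SL2" for g
      unfolding \<kappa>_def using ctr_inf_aff[OF Q that] by simp
    have \<kappa>_inf: "\<kappa> ` ?I = ?I"
    proof -
      have "ctr ?i ` ?I = ?I" by (rule translation_infinity_block[OF ctr(1)[OF iPts] cosets_of_in_par[OF Q]])
      then show ?thesis unfolding \<kappa>_def image_comp[symmetric] by simp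
    qed
    have "ctr (\<kappa> (Aff (mat 1))) ` \<kappa> ` ?I = \<kappa> ` ?f ` ?I" by (rule ctr_image[OF \<kappa> onePts infinity_subset])
    then have "Aff ` (S #>\<^bsub>SL2\<^esub> c) = \<kappa> ` Aff ` (S #>\<^bsub>SL2\<^esub> c)"
      using \<kappa>_aff[of "mat 1"] xx by (simp add: \<kappa>_inf c(2))
    moreover have "Aff c \<in> Aff ` (S #>\<^bsub>SL2\<^esub> c)" using mem_r_coset_SL2[OF c(1), of c S] c(1) by simp
    then have "\<kappa> (Aff c) \<in> \<kappa> ` Aff ` (S #>\<^bsub>SL2\<^esub> c)" by blast
    ultimately have "Aff (?x ** c ** ?x) \<in> Aff ` (S #>\<^bsub>SL2\<^esub> c)" using \<kappa>_aff[OF c(1)] by simp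
    then have "?x ** c ** ?x \<in> S #>\<^bsub>SL2\<^esub> c" by blast
    then have s: "?x ** c ** ?x ** adj2 c \<in> S" using mem_r_coset_SL2[OF c(1)] by blast
    have "?x ** (?x ** c ** ?x ** adj2 c) = c ** ?x ** adj2 c"
      by (simp add: matrix_mul_assoc xx)
    then show ?thesis using s by metis
  qed
  \<comment> \<open>Products of two inverters exhaust \<open>S\<close>, so c conjugates
    \<open>S\<close> into itself.\<close>
  have cS: "c ** s ** adj2 c \<in> S" if s: "s \<in> S" for s
  proof -
    obtain P where P: "P \<in> sylow_subgroups p (SL2 :: 'a mat2 monoid)"
      using rstab_sylow[of "vector [0, 1]"] by (auto simp: vec2_eq_iff)
    obtain Q where Q: "Q \<in> sylow_subgroups p SL2" "s = inverter Q ** inverter P"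
      using S_generated_by_inverters[OF P s] by blast
    obtain a b where a: "a \<in> S" "c ** inverter Q ** adj2 c = inverter Q ** a"
      and b: "b \<in> S" "c ** inverter P ** adj2 c = inverter P ** b" using cx[OF Q(1)] cx[OF P] by blast
    have "c ** s ** adj2 c = (c ** inverter Q ** adj2 c) ** (c ** inverter P ** adj2 c)"
      unfolding Q(2) using c(1) by (simp add: matrix_mul_assoc)
    also have "\<dots> = inverter Q ** a ** (inverter P ** b)" unfolding a(2) b(2) ..
    also have "\<dots> = (inverter Q ** inverter P) ** (inverter P ** a ** inverter P) ** b"
    proof -
      have "inverter P ** (inverter P ** (a ** (inverter P ** b))) = a ** (inverter P ** b)"
        unfolding matrix_mul_assoc inverter_self(1)[OF P] by simp
      then show ?thesis by (simp flip: matrix_mul_assoc)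
    qed
    also have "\<dots> = (inverter Q ** inverter P) ** adj2 a ** b" using inverter_inverts[OF P a(1)] by simp
    finally show ?thesis using inverter_mult_inverter[OF P Q(1)] S_mult S_inv a b by simp
  qed
  have cS': "adj2 c ** s ** c \<in> S" if s: "s \<in> S" for s
  proof -
    have "(\<lambda>s. c ** s ** adj2 c) ` S = S"
    proof (rule card_subset_eq)
      have "inj_on (\<lambda>s. c ** s ** adj2 c) S"
      proof (rule inj_onI)
        fix s t assume "c ** s ** adj2 c = c ** t ** adj2 c"
        then have "adj2 c ** (c ** s ** adj2 c) ** c = adj2 c ** (c ** t ** adj2 c) ** c" by simp
        then show "s = t" using c(1) by (simp add: matrix_mul_assoc)
      qed
      then show "card ((\<lambda>s. c ** s ** adj2 c) ` S) = card S" by (rule card_image)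
    qed (use cS in auto)
    then obtain t where "t \<in> S" "s = c ** t ** adj2 c" using s by blast
    then show ?thesis using c(1) by (simp add: matrix_mul_assoc)
  qed
  obtain P where P: "P \<in> sylow_subgroups p (SL2 :: 'a mat2 monoid)"
    using rstab_sylow[of "vector [0, 1]"] by (auto simp: vec2_eq_iff)
  obtain u where u: "u \<in> P" "u \<noteq> mat 1" "u \<noteq> inverter P" using ex_non_inverter[OF P] by blast
  have uS: "u \<in> carrier SL2" using sylow_subset[OF P] u by blast
  note uu = sylow_involution(1)[OF p2 P u(1)]
  note \<rho> = right_mult_automorphism[OF uS]
  have u_notin: "u \<notin> S" using S_inter_sylow[OF P u(1)] u(2) by blast
  let ?B1 = "Aff ` (S #>\<^bsub>SL2\<^esub> mat 1)" and ?B2 = "Aff ` (S #>\<^bsub>SL2\<^esub> u)"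
  have \<rho>B1: "right_mult u ` ?B1 = ?B2" unfolding right_mult_Aff_image r_coset_mult_image by simp
  have \<rho>B2: "right_mult u ` ?B2 = ?B1" unfolding right_mult_Aff_image r_coset_mult_image by (simp add: uu)
  have B1P: "?B1 \<subseteq> Pts" and B2P: "?B2 \<subseteq> Pts"
    using block_subset[OF orbit_infinity_block[OF S_orbit]] uS mat_1_in_SL2 by blast+
  \<comment> \<open>This center is chosen because its translation exchanges [\<infinity>] with
    \<open>S\<close>.\<close>
  define \<gamma> where "\<gamma> = ctr (Aff (adj2 c))"
  have cP: "Aff (adj2 c) \<in> Pts" using c(1) by simp
  have \<gamma>: "automorphism Pts Blks \<gamma>" unfolding \<gamma>_def by (rule ctr(3)[OF cP])
  have \<gamma>\<gamma>: "\<gamma> (\<gamma> z) = z" if "z \<in> Pts" for z unfolding \<gamma>_def by (rule ctr_ctr[OF cP that])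
  have \<gamma>\<gamma>_img: "\<gamma> ` \<gamma> ` B = B" if "B \<subseteq> Pts" for B
  proof -
    have "\<gamma> ` \<gamma> ` B = (\<lambda>x. x) ` B" unfolding image_image by (rule image_cong[OF refl]) (use \<gamma>\<gamma> that in blast)
    then show ?thesis by simp
  qed
  have \<gamma>I: "\<gamma> ` ?I = ?B1" unfolding \<gamma>_def using ctrI[of "adj2 c"] c(1) by simp
  have \<gamma>B1: "\<gamma> ` ?B1 = ?I" unfolding \<gamma>I[symmetric] by (rule \<gamma>\<gamma>_img[OF infinity_subset])
  have "\<gamma> ` ?B2 \<in> orbit_infinity" by (rule orbit_infinity_image[OF S_orbit[OF uS] \<gamma>])
  moreover have "\<gamma> ` ?B2 \<noteq> ?I"
  proof
    assume "\<gamma> ` ?B2 = ?I"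
    then have "\<gamma> ` \<gamma> ` ?B2 = \<gamma> ` ?I" by simp
    then have "?B2 = ?B1" unfolding \<gamma>\<gamma>_img[OF B2P] \<gamma>I .
    then have "u ** adj2 (mat 1) \<in> S" by (rule S_coset_eq) (use uS in simp_all)
    then show False using u_notin by simp
  qed
  ultimately have "\<exists>k\<in>carrier SL2. \<gamma> ` ?B2 = Aff ` (S #>\<^bsub>SL2\<^esub> k)" by (rule orbit_infinity_cases)
  then obtain k where k: "k \<in> carrier SL2" "\<gamma> ` ?B2 = Aff ` (S #>\<^bsub>SL2\<^esub> k)" by blast
  \<comment> \<open>With this h the translation centered at \<open>Aff h\<close> maps [\<infinity>]
    to \<open>S k\<close>; applying \<gamma> turns it into one mapping \<open>S\<close> to
    \<open>S u\<close>.\<close>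
  define h where "h = adj2 c ** k"
  have hS: "h \<in> carrier SL2" unfolding h_def using c(1) k(1) by simp
  have hP: "Aff h \<in> Pts" using hS by simp
  have ch: "c ** h = k" unfolding h_def using c(1) by simp
  define y where "y = \<gamma> (Aff h)"
  have yP: "y \<in> Pts" unfolding y_def by (rule automorphism_in_Pts[OF \<gamma> hP])
  have yB: "ctr y ` ?B1 = ?B2"
  proof -
    have "ctr y ` \<gamma> ` ?I = \<gamma> ` ctr (Aff h) ` ?I" unfolding y_def by (rule ctr_image[OF \<gamma> hP infinity_subset])
    also have "\<dots> = \<gamma> ` \<gamma> ` ?B2" unfolding ctrI[OF hS] ch k(2) ..
    finally show ?thesis unfolding \<gamma>I \<gamma>\<gamma>_img[OF B2P] .
  qed
  \<comment> \<open>Right multiplication by \<open>u\<close> exchanges \<open>?B1\<close> and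
    \<open>?B2\<close>, and \<open>ctr y'\<close> is an involution, so \<open>y'\<close> is a center
    of the same kind as \<open>y\<close>.\<close>
  define y' where "y' = right_mult u y"
  have y'P: "y' \<in> Pts" unfolding y'_def by (rule automorphism_in_Pts[OF \<rho> yP])
  have "ctr y' ` ?B2 = ?B1"
    using ctr_image[OF \<rho> yP B1P] unfolding y'_def[symmetric] \<rho>B1 yB \<rho>B2 .
  then have "ctr y' ` ctr y' ` ?B2 = ctr y' ` ?B1" by simp
  moreover have "ctr y' ` ctr y' ` ?B2 = (\<lambda>x. x) ` ?B2"
    unfolding image_image by (rule image_cong[OF refl]) (use ctr_ctr[OF y'P] B2P in blast)
  ultimately have y'B: "ctr y' ` ?B1 = ?B2" by simp
  define z where "z = \<gamma> y'"
  have zP: "z \<in> Pts" unfolding z_def by (rule automorphism_in_Pts[OF \<gamma> y'P])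
  have zI: "ctr z ` ?I = Aff ` (S #>\<^bsub>SL2\<^esub> k)"
    using ctr_image[OF \<gamma> y'P B1P] unfolding z_def[symmetric] \<gamma>B1 y'B k(2) .
  have "\<exists>h'\<in>carrier SL2. z = Aff h'"
    using zP
  proof (cases rule: point_cases)
    case (Inf C)
    then have "ctr z ` ?I = ?I" using translation_infinity_block[OF ctr(1)[OF zP[unfolded Inf(2)]] Inf(1)] by simp
    moreover have "Aff k \<in> Aff ` (S #>\<^bsub>SL2\<^esub> k)" using mem_r_coset_SL2[OF k(1), of k S] k(1) by simp
    ultimately have "Aff k \<in> ?I" using zI by simp
    then show ?thesis by simp
  qed blast
  then obtain h' where h': "h' \<in> carrier SL2" "z = Aff h'" by blast
  \<comment> \<open>As c normalizes \<open>S\<close>, the elements h and h' lie in one coset of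
    \<open>S\<close>, so \<open>y\<close> and \<open>y'\<close> lie on the common orbit block
    \<open>?Z\<close>.\<close>
  have "Aff ` (S #>\<^bsub>SL2\<^esub> (c ** h')) = Aff ` (S #>\<^bsub>SL2\<^esub> (c ** h))" using zI unfolding h'(2) ctrI[OF h'(1)] ch .
  then have "(c ** h') ** adj2 (c ** h) \<in> S" by (rule S_coset_eq) (use c(1) h' hS in simp_all)
  then have "adj2 c ** ((c ** h') ** adj2 (c ** h)) ** c \<in> S" by (rule cS')
  moreover have "adj2 c ** ((c ** h') ** adj2 (c ** h)) ** c = h' ** adj2 h"
    unfolding adj2_mult using c(1) by (simp add: matrix_mul_assoc)
  ultimately have "h' \<in> S #>\<^bsub>SL2\<^esub> h" using mem_r_coset_SL2[OF hS] by simp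
  then have z_mem: "z \<in> Aff ` (S #>\<^bsub>SL2\<^esub> h)" using h'(2) by blast
  have h_mem: "Aff h \<in> Aff ` (S #>\<^bsub>SL2\<^esub> h)" using mem_r_coset_SL2[OF hS, of h S] hS by simp
  let ?Z = "\<gamma> ` Aff ` (S #>\<^bsub>SL2\<^esub> h)"
  have Z: "?Z \<in> orbit_infinity" by (rule orbit_infinity_image[OF S_orbit[OF hS] \<gamma>])
  have yZ: "y \<in> ?Z" unfolding y_def using h_mem by blast
  have y'Z: "y' \<in> ?Z" using \<gamma>\<gamma>[OF y'P] z_mem unfolding z_def by (metis imageI)
  show False
  proof (cases "?Z = ?I")
    \<comment> \<open>A coset of \<open>S\<close> would contain both a and a u, and so
      \<open>S\<close> would contain a conjugate of the involution \<open>u\<close>.\<close>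
    case False
    then obtain m where m: "m \<in> carrier SL2" "?Z = Aff ` (S #>\<^bsub>SL2\<^esub> m)" using orbit_infinity_cases[OF Z] by blast
    obtain a where a: "y = Aff a" "a \<in> S #>\<^bsub>SL2\<^esub> m" using yZ unfolding m(2) by blast
    have aS: "a \<in> carrier SL2" using yP a(1) by simp
    have "a ** u \<in> S #>\<^bsub>SL2\<^esub> m" using y'Z a(1) unfolding m(2) y'_def by auto
    then have 1: "a ** u ** adj2 m \<in> S" and 2: "a ** adj2 m \<in> S" using a(2) mem_r_coset_SL2[OF m(1)] by auto
    have "(a ** u ** adj2 m) ** adj2 (a ** adj2 m) \<in> S" by (rule S_mult[OF 1 S_inv[OF 2]])
    moreover have "(a ** u ** adj2 m) ** adj2 (a ** adj2 m) = a ** u ** adj2 a"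
      unfolding adj2_mult using m(1) by (simp add: matrix_mul_assoc)
    moreover have "a ** u ** adj2 a \<in> (\<lambda>x. a ** x ** adj2 a) ` P" using u(1) by blast
    ultimately have "a ** u ** adj2 a = mat 1" using S_inter_sylow[OF conj_sylow[OF aS P]] by simp
    then have "adj2 a ** (a ** u ** adj2 a) ** a = mat 1" using aS by simp
    then show False using u(2) aS by (simp add: matrix_mul_assoc)
  next
    \<comment> \<open>A center at infinity sends 1 to an inverter, which lies in \<open>S u\<close>.
      Then \<open>u\<close> is an element of \<open>S\<close> times an inverter and normalizes
      \<open>S\<close>.\<close>
    case True
    then have "y \<in> ?I" using yZ by simp
    then obtain Q where Q: "Q \<in> sylow_subgroups p SL2" "y = Inf_pt (cosets_of Q)"
      unfolding infinity_block_iff by blast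
    let ?x = "inverter Q"
    have "Aff (mat 1) \<in> ?B1" using mem_r_coset_SL2[OF mat_1_in_SL2, of "mat 1" S] by simp
    then have "ctr y (Aff (mat 1)) \<in> ?B2" using yB by blast
    then have "Aff ?x \<in> ?B2" using ctr_inf_aff[OF Q(1), of "mat 1"] Q(2) by simp
    then have xu: "?x ** adj2 u \<in> S" using mem_r_coset_SL2[OF uS] by blast
    then have s: "adj2 (?x ** adj2 u) \<in> S" by (rule S_inv)
    have ux: "adj2 (?x ** adj2 u) = u ** ?x" unfolding adj2_mult using inverter_self(2)[OF Q(1)] by simp
    have "u ** t ** adj2 u \<in> S" if t: "t \<in> S" for t
    proof -
      have "?x ** t ** ?x = adj2 t" by (rule inverter_inverts[OF Q(1) t])
      then have "(u ** ?x) ** (?x ** t ** ?x) ** (?x ** adj2 u) \<in> S"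
        using S_mult[OF S_mult[OF s S_inv[OF t]] xu] ux by simp
      moreover have "(u ** ?x) ** (?x ** t ** ?x) ** (?x ** adj2 u) = u ** t ** adj2 u"
      proof -
        have "?x ** (?x ** A) = A" for A :: "'a mat2"
          unfolding matrix_mul_assoc inverter_self(1)[OF Q(1)] by simp
        then show ?thesis by (simp flip: matrix_mul_assoc)
      qed
      ultimately show ?thesis by simp
    qed
    then have sub: "(\<lambda>t. u ** t ** adj2 u) ` S \<subseteq> S" by blast
    have "inj_on (\<lambda>t. u ** t ** adj2 u) S"
    proof (rule inj_onI)
      fix s t assume "u ** s ** adj2 u = u ** t ** adj2 u"
      then have "adj2 u ** (u ** s ** adj2 u) ** u = adj2 u ** (u ** t ** adj2 u) ** u" by simp
      then show "s = t" using uS by (simp add: matrix_mul_assoc)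
    qed
    then have "(\<lambda>t. u ** t ** adj2 u) ` S = S" by (intro card_subset_eq sub card_image) simp
    then show False using inverter_unique[OF P u(1,2)] u(3) by simp
  qed
qed

end

theorem mainTheorem12:
  fixes p e q :: nat
    and S :: "('a::{field,finite}) mat2 set"
    and \<D> :: "'a mat2 set set"
    and \<pi> :: "'a mat2 set set set"
  assumes "Factorial_Ring.prime p" and "e > 0" and "q = p ^ e" and "CARD('a) = q"
    and "SL2_unital p S \<D> \<pi>"
  shows
    "(\<pi> = par_flat p \<and> q \<ge> 3 \<longrightarrow>
        (p = 2 \<longrightarrow>
           (\<forall>c f. translation (unital_points \<pi>) (unital_blocks S \<D> \<pi>) c f \<and>
                  nontrivial_on (unital_points \<pi>) f \<longrightarrow>
              (\<exists>x \<in> normalizer SL2 S. involution SL2 x \<and> acts_as_left_mult \<pi> x f)) \<and>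
           (\<forall>P \<in> sylow_subgroups 2 (SL2 :: 'a mat2 monoid).
              \<exists>!y. y \<in> P \<and> y \<noteq> \<one>\<^bsub>SL2\<^esub> \<and> y \<in> normalizer SL2 S)) \<and>
        (odd q \<longrightarrow>
           \<not> (\<exists>c f. translation (unital_points \<pi>) (unital_blocks S \<D> \<pi>) c f \<and>
                    nontrivial_on (unital_points \<pi>) f))) \<and>
     ((odd q \<and> \<pi> = par_odd) \<or> (\<exists>r. q = r\<^sup>2 \<and> (\<pi> = par_sq r \<or> \<pi> = par_sq_inv r)) \<longrightarrow>
        \<not> (\<exists>c f. c \<in> infinity_block \<pi> \<and>
                 translation (unital_points \<pi>) (unital_blocks S \<D> \<pi>) c f \<and>
                 nontrivial_on (unital_points \<pi>) f))"
proof -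
  interpret U: sl2_unital p e S \<D> \<pi>
    by unfold_locales (use assms in simp_all)
  have inf: False
    if \<pi>: "(odd q \<and> \<pi> = par_odd) \<or> (\<exists>r. q = r\<^sup>2 \<and> (\<pi> = par_sq r \<or> \<pi> = par_sq_inv r))"
      and c: "c \<in> infinity_block \<pi>"
      and tr: "translation (unital_points \<pi>) (unital_blocks S \<D> \<pi>) c f"
      and nt: "nontrivial_on (unital_points \<pi>) f" for c f
  proof -
    obtain C where C: "C \<in> \<pi>" "c = Inf_pt C" using c unfolding infinity_block_def by blast
    note tr' = tr[unfolded C(2)]
    show False
      using \<pi>
    proof (elim disjE exE conjE)
      assume "odd q" "\<pi> = par_odd"
      then show False using U.no_translation_par_odd[OF _ _ C(1) tr'] nt assms(4) by blast
    next
      fix r assume "q = r\<^sup>2" "\<pi> = par_sq r"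
      then show False using U.no_translation_par_sq[OF _ _ C(1) tr', of r] nt assms(4) by blast
    next
      fix r assume "q = r\<^sup>2" "\<pi> = par_sq_inv r"
      then show False using U.no_translation_par_sq[OF _ _ C(1) tr', of r] nt assms(4) by blast
    qed
  qed
  have flat: "(p = 2 \<longrightarrow>
           (\<forall>c f. translation (unital_points \<pi>) (unital_blocks S \<D> \<pi>) c f \<and>
                  nontrivial_on (unital_points \<pi>) f \<longrightarrow>
              (\<exists>x \<in> normalizer SL2 S. involution SL2 x \<and> acts_as_left_mult \<pi> x f)) \<and>
           (\<forall>P \<in> sylow_subgroups 2 (SL2 :: 'a mat2 monoid).
              \<exists>!y. y \<in> P \<and> y \<noteq> \<one>\<^bsub>SL2\<^esub> \<and> y \<in> normalizer SL2 S)) \<and>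
        (odd q \<longrightarrow>
           \<not> (\<exists>c f. translation (unital_points \<pi>) (unital_blocks S \<D> \<pi>) c f \<and>
                    nontrivial_on (unital_points \<pi>) f))"
    if flat: "\<pi> = par_flat p" and q3: "q \<ge> 3"
  proof (intro conjI impI)
    interpret F: flat_unital p e S \<D> \<pi>
      by unfold_locales (use flat q3 assms(4) in simp_all)
    show "\<not> (\<exists>c f. translation (unital_points \<pi>) (unital_blocks S \<D> \<pi>) c f \<and>
                    nontrivial_on (unital_points \<pi>) f)" if "odd q"
      using F.no_translation_odd that assms(4) by blast
    assume p2: "p = 2"
    interpret E: even_flat_unital p e S \<D> \<pi>
      by unfold_locales (rule p2)
    show "\<forall>c f. translation (unital_points \<pi>) (unital_blocks S \<D> \<pi>) c f \<and>
                  nontrivial_on (unital_points \<pi>) f \<longrightarrow>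
              (\<exists>x \<in> normalizer SL2 S. involution SL2 x \<and> acts_as_left_mult \<pi> x f)"
    proof (intro allI impI, elim conjE)
      fix c f
      assume tr: "translation (unital_points \<pi>) (unital_blocks S \<D> \<pi>) c f"
        and nt: "nontrivial_on (unital_points \<pi>) f"
      show "\<exists>x \<in> normalizer SL2 S. involution SL2 x \<and> acts_as_left_mult \<pi> x f"
      proof (cases c)
        \<comment> \<open>Affine centers have been excluded, so this case is vacuous.\<close>
        case (Aff g)
        interpret affine_center p e S \<D> \<pi> g f
          by unfold_locales (use tr nt Aff in simp_all)
        show ?thesis using contradiction by blast
      next
        case (Inf_pt C)
        have "c \<in> unital_points \<pi>" using tr unfolding translation_def by blast
        then have "C \<in> \<pi>" using Inf_pt by (auto simp: unital_points_def)
        then obtain P x where x: "P \<in> sylow_subgroups p SL2" "x \<in> P" "x \<noteq> mat 1"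
            "(\<lambda>s. x ** s ** adj2 x) ` S = S" "acts_as_left_mult \<pi> x f"
          by (rule F.translation_at_infinity[OF tr[unfolded Inf_pt] _ nt])
        have xS: "x \<in> carrier SL2" using U.sylow_subset[OF x(1)] x(2) by blast
        have "x ** x = mat 1" using U.sylow_involution(1)[OF p2 x(1,2)] .
        then have "involution SL2 x" unfolding involution_def using xS x(3) by simp
        moreover have "x \<in> normalizer SL2 S" using U.normalizer_iff xS x(4) by blast
        ultimately show ?thesis using x(5) by blast
      qed
    qed
    show "\<forall>P \<in> sylow_subgroups 2 (SL2 :: 'a mat2 monoid).
              \<exists>!y. y \<in> P \<and> y \<noteq> \<one>\<^bsub>SL2\<^esub> \<and> y \<in> normalizer SL2 S"
    proof
      fix P :: "'a mat2 set" assume "P \<in> sylow_subgroups 2 SL2"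
      then have P: "P \<in> sylow_subgroups p SL2" using p2 by simp
      have "y \<in> P \<and> y \<noteq> \<one>\<^bsub>SL2\<^esub> \<and> y \<in> normalizer SL2 S \<longleftrightarrow>
          y \<in> P \<and> y \<noteq> mat 1 \<and> (\<lambda>s. y ** s ** adj2 y) ` S = S" for y
        using U.normalizer_iff U.sylow_subset[OF P] by auto
      then show "\<exists>!y. y \<in> P \<and> y \<noteq> \<one>\<^bsub>SL2\<^esub> \<and> y \<in> normalizer SL2 S"
        using E.ex1_inverter[OF P] by simp
    qed
  qed
  show ?thesis using inf flat by blast
qed

end
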